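(* Let $J\neq F_n^\infty$ be a WOT-closed two-sided ideal of the noncommutative analytic Toeplitz algebra $F_n^\infty$ and let $[B_1,\ldots,B_n]$ and $[W_1,\ldots,W_n]$ be the corresponding constrained shifts acting on $\mathcal N_J$. For each $j=1,2$, let $\mathcal K_j$ be a Hilbert space and $\mathcal E_j\subseteq\mathcal N_J\otimes\mathcal K_j$ be a co-invariant subspace under each operator $B_i\otimes I_{\mathcal K_j}$, $i=1,\ldots,n$. If $X:\mathcal E_1\to\mathcal E_2$ is a bounded operator such that $$X[P_{\mathcal E_1}(B_i\otimes I_{\mathcal K_1})|_{\mathcal E_1}]=[P_{\mathcal E_2}(B_i\otimes I_{\mathcal K_2})|_{\mathcal E_2}]X,\quad i=1,\ldots,n,\qquad( * )$$ then there exists $$G(W_1,\ldots,W_n)\in\mathcal W(W_1,\ldots,W_n)\bar\otimes B(\mathcal K_1,\mathcal K_2)$$ such that $G(W_1,\ldots,W_n)^*\mathcal E_2\subseteq\mathcal E_1$, $$G(W_1,\ldots,W_n)^*|_{\mathcal E_2}=X^*,\quad\text{and}\quad\|G(W_1,\ldots,W_n)\|=\|X\|.$$ In particular, if $\mathcal E_j:=\mathcal G\otimes\mathcal K_j$, $j=1,2$, where $\mathcal G\subseteq\mathcal N_J$ is a co-invariant subspace under each operator $B_i$ and $W_i$, $i=1,\ldots,n$, then a bounded operator $X:\mathcal E_1\to\mathcal E_2$ satisfies $( * )$ if and only if there exists $G(W_1,\ldots,W_n)\in\mathcal W(W_1,\ldots,W_n)\bar\otimes B(\mathcal K_1,\mathcal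 K_2)$ such that $G(W_1,\ldots,W_n)^*\mathcal E_2\subseteq\mathcal E_1$, $G(W_1,\ldots,W_n)^*|_{\mathcal E_2}=X^*$, and $\|G(W_1,\ldots,W_n)\|=\|X\|$.
   Context: Let $n\in\{1,2,\dots\}$ and let $F^2(H_n)=\bigoplus_{k\ge 0}H_n^{\otimes k}$ be the full Fock space of an $n$-dimensional complex Hilbert space $H_n$ with orthonormal basis $e_1,\dots,e_n$ (with $H_n^{\otimes 0}=\mathbb C1$). Left and right creation operators: $S_i\varphi=e_i\otimes\varphi$, $R_i\varphi=\varphi\otimes e_i$. $F_n^\infty\subset B(F^2(H_n))$ is the WOT-closed algebra generated by $S_1,\dots,S_n$ and the identity. Put $\mathcal N_J=F^2(H_n)\ominus\overline{JF^2(H_n)}$, $B_i=P_{\mathcal N_J}S_i|_{\mathcal N_J}$, $W_i=P_{\mathcal N_J}R_i|_{\mathcal N_J}$. $\mathcal W(W_1,\dots,W_n)$ is the $w^*$-closed algebra generated by $W_1,\dots,W_n$ and $I$; $\mathcal W(W_1,\dots,W_n)\bar\otimes B(\mathcal K_1,\mathcal K_2)$ is the WOT-closed operator space generated by the spatial tensor product, and it coincides with the set of bounded $M:\mathcal N_J\otimes\mathcal K_1\to\mathcal N_J\otimes\mathcal K_2$ satisfying $M(B_i\otimes I_{\mathcal K_1})=(B_i\otimes I_{\mathcal K_2})M$ for all $i$. A subspace is co-invariant under an operator if it is invariant under its adjoint. *)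

theory Defs
  imports "HOL-Analysis.Analysis"
begin

section \<open>Complex Hilbert spaces\<close>

text \<open>
  A complex Hilbert space is a complete real inner product space of the library which in addition
  carries a complex scalar multiplication and a complex inner product (linear in the first
  argument) whose real part is the real inner product. The norm, and the positivity of
  \<open>cinner\<close>, are those of the library class. No separability is assumed.
\<close>

class chilbert_space = real_inner + complete_space +
  fixes scaleC :: "complex \<Rightarrow> 'a \<Rightarrow> 'a"  (infixr \<open>*\<^sub>C\<close> 75)
    and cinner :: "'a \<Rightarrow> 'a \<Rightarrow> complex"
  assumes scaleC_add_right: "c *\<^sub>C (x + y) = c *\<^sub>C x + c *\<^sub>C y"
    and scaleC_add_left: "(c + d) *\<^sub>C x = c *\<^sub>C x + d *\<^sub>C x"
    and scaleC_scaleC: "c *\<^sub>C (d *\<^sub>C x) = (c * d) *\<^sub>C x"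
    and scaleC_of_real: "complex_of_real r *\<^sub>C x = r *\<^sub>R x"
    and cinner_commute: "cinner x y = cnj (cinner y x)"
    and cinner_add_left: "cinner (x + y) z = cinner x z + cinner y z"
    and cinner_scaleC_left: "cinner (c *\<^sub>C x) y = c * cinner x y"
    and Re_cinner: "Re (cinner x y) = inner x y"

lemma cinner_scaleC_right: "cinner x (c *\<^sub>C y) = cnj c * cinner x y"
  for x y :: "'a::chilbert_space"
  by (metis cinner_commute cinner_scaleC_left complex_cnj_mult)

lemma cinner_self: "cinner x x = complex_of_real ((norm x)\<^sup>2)" for x :: "'a::chilbert_space"
proof (rule complex_eqI)
  show "Re (cinner x x) = Re (complex_of_real ((norm x)\<^sup>2))"
    by (simp only: Re_cinner power2_norm_eq_inner Re_complex_of_real)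
  have "Im (cinner x x) = - Im (cinner x x)"
    by (metis cinner_commute cnj.sel(2))
  then show "Im (cinner x x) = Im (complex_of_real ((norm x)\<^sup>2))"
    by simp
qed

lemma norm_scaleC: "norm (c *\<^sub>C x) = cmod c * norm x" for x :: "'a::chilbert_space"
proof -
  have "complex_of_real ((norm (c *\<^sub>C x))\<^sup>2) = (c * cnj c) * complex_of_real ((norm x)\<^sup>2)"
    by (simp only: cinner_self[symmetric] cinner_scaleC_left cinner_scaleC_right
        mult.assoc mult.left_commute)
  also have "\<dots> = complex_of_real ((cmod c * norm x)\<^sup>2)"
    by (simp add: complex_norm_square[symmetric] power_mult_distrib)
  finally have "(norm (c *\<^sub>C x))\<^sup>2 = (cmod c * norm x)\<^sup>2"
    using of_real_eq_iff by blast
  then show ?thesis by simp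
qed

text \<open>Since \<open>Re (cinner x (\<i> y))\<close> is the imaginary part of \<open>cinner x y\<close>:\<close>

lemma cinner_eq_inner: "cinner x y = Complex (inner x y) (inner x (\<i> *\<^sub>C y))"
  for x y :: "'a::chilbert_space"
proof (rule complex_eqI)
  show "Im (cinner x y) = Im (Complex (inner x y) (inner x (\<i> *\<^sub>C y)))"
    unfolding Re_cinner[symmetric] by (simp add: cinner_scaleC_right)
qed (simp add: Re_cinner)

instantiation complex :: chilbert_space
begin
definition scaleC_complex :: "complex \<Rightarrow> complex \<Rightarrow> complex" where "scaleC_complex c x = c * x"
definition cinner_complex :: "complex \<Rightarrow> complex \<Rightarrow> complex" where "cinner_complex x y = x * cnj y"
instance
  by standard
    (auto simp: scaleC_complex_def cinner_complex_def inner_complex_def algebra_simps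
      scaleR_conv_of_real)
end


section \<open>Square summable families\<close>

text \<open>\<open>('i, 'k) ell2\<close> is the Hilbert space direct sum of copies of \<open>'k\<close> indexed by \<open>'i\<close>.\<close>

typedef (overloaded) ('i, 'k::real_inner) ell2 =
  "{f :: 'i \<Rightarrow> 'k. (\<lambda>i. (norm (f i))\<^sup>2) summable_on UNIV}"
  morphisms coord Abs_ell2
  by (rule exI[of _ "\<lambda>_. 0"]) simp

setup_lifting type_definition_ell2

lemma coord_summable: "(\<lambda>i. (norm (coord f i))\<^sup>2) summable_on UNIV"
  using coord[of f] by simp

lemma ell2_eqI: "(\<And>i. coord f i = coord g i) \<Longrightarrow> f = g"
  by (simp add: coord_inject[symmetric] fun_eq_iff)

lemma sq_summable_add:
  fixes f g :: "'i \<Rightarrow> 'k::real_inner"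
  assumes "(\<lambda>i. (norm (f i))\<^sup>2) summable_on UNIV" "(\<lambda>i. (norm (g i))\<^sup>2) summable_on UNIV"
  shows "(\<lambda>i. (norm (f i + g i))\<^sup>2) summable_on UNIV"
proof (rule summable_on_comparison_test)
  show "(\<lambda>i. 2 * (norm (f i))\<^sup>2 + 2 * (norm (g i))\<^sup>2) summable_on UNIV"
    by (intro summable_on_add summable_on_cmult_right assms)
  fix i
  have "(norm (f i + g i))\<^sup>2 \<le> (norm (f i) + norm (g i))\<^sup>2"
    by (intro power_mono norm_triangle_ineq) auto
  also have "\<dots> \<le> 2 * (norm (f i))\<^sup>2 + 2 * (norm (g i))\<^sup>2"
    using sum_squares_bound[of "norm (f i)" "norm (g i)"] by (simp add: power2_sum)
  finally show "(norm (f i + g i))\<^sup>2 \<le> 2 * (norm (f i))\<^sup>2 + 2 * (norm (g i))\<^sup>2" .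
qed auto

lemma inner_abs_summable:
  fixes f g :: "'i \<Rightarrow> 'k::real_inner"
  assumes "(\<lambda>i. (norm (f i))\<^sup>2) summable_on UNIV" "(\<lambda>i. (norm (g i))\<^sup>2) summable_on UNIV"
  shows "(\<lambda>i. norm (f i) * norm (g i)) summable_on UNIV"
proof (rule summable_on_comparison_test)
  show "(\<lambda>i. (norm (f i))\<^sup>2 + (norm (g i))\<^sup>2) summable_on UNIV"
    by (intro summable_on_add assms)
  fix i
  have "0 \<le> norm (f i) * norm (g i)" by simp
  then show "norm (f i) * norm (g i) \<le> (norm (f i))\<^sup>2 + (norm (g i))\<^sup>2"
    using sum_squares_bound[of "norm (f i)" "norm (g i)"] by linarith
qed auto

lemma inner_summable:
  fixes f g :: "'i \<Rightarrow> 'k::real_inner"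
  assumes "(\<lambda>i. (norm (f i))\<^sup>2) summable_on UNIV" "(\<lambda>i. (norm (g i))\<^sup>2) summable_on UNIV"
  shows "(\<lambda>i. inner (f i) (g i)) summable_on UNIV"
proof -
  have "(\<lambda>i. norm (inner (f i) (g i))) summable_on UNIV"
  proof (rule summable_on_comparison_test[OF inner_abs_summable[OF assms]])
    show "norm (inner (f i) (g i)) \<le> norm (f i) * norm (g i)" for i
      using Cauchy_Schwarz_ineq2[of "f i" "g i"] by simp
  qed auto
  then show ?thesis by (rule abs_summable_summable)
qed

instantiation ell2 :: (type, real_inner) real_vector
begin

lift_definition zero_ell2 :: "('a, 'b) ell2" is "\<lambda>_. 0" by simp
lift_definition plus_ell2 :: "('a, 'b) ell2 \<Rightarrow> ('a, 'b) ell2 \<Rightarrow> ('a, 'b) ell2"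
  is "\<lambda>f g i. f i + g i" by (rule sq_summable_add)
lift_definition uminus_ell2 :: "('a, 'b) ell2 \<Rightarrow> ('a, 'b) ell2"
  is "\<lambda>f i. - f i" by simp
lift_definition minus_ell2 :: "('a, 'b) ell2 \<Rightarrow> ('a, 'b) ell2 \<Rightarrow> ('a, 'b) ell2"
  is "\<lambda>f g i. f i - g i"
  subgoal for f g using sq_summable_add[of f "\<lambda>i. - g i"] by simp
  done
lift_definition scaleR_ell2 :: "real \<Rightarrow> ('a, 'b) ell2 \<Rightarrow> ('a, 'b) ell2"
  is "\<lambda>r f i. r *\<^sub>R f i"
  by (simp add: power_mult_distrib summable_on_cmult_right)

instance
proof
  fix f g h :: "('a, 'b) ell2" and r s :: real
  show "f + g + h = f + (g + h)" by transfer (simp add: add.assoc)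
  show "f + g = g + f" by transfer (simp add: add.commute)
  show "0 + f = f" by transfer simp
  show "- f + f = 0" by transfer simp
  show "f - g = f + - g" by transfer simp
  show "r *\<^sub>R (f + g) = r *\<^sub>R f + r *\<^sub>R g" by transfer (simp add: scaleR_add_right)
  show "(r + s) *\<^sub>R f = r *\<^sub>R f + s *\<^sub>R f" by transfer (simp add: scaleR_add_left)
  show "r *\<^sub>R s *\<^sub>R f = (r * s) *\<^sub>R f" by transfer simp
  show "1 *\<^sub>R f = f" by transfer simp
qed

end

instantiation ell2 :: (type, real_inner) real_inner
begin

lift_definition inner_ell2 :: "('a, 'b) ell2 \<Rightarrow> ('a, 'b) ell2 \<Rightarrow> real"
  is "\<lambda>f g. \<Sum>\<^sub>\<infinity>i. inner (f i) (g i)" .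

definition norm_ell2 :: "('a, 'b) ell2 \<Rightarrow> real" where "norm_ell2 f = sqrt (inner f f)"
definition sgn_ell2 :: "('a, 'b) ell2 \<Rightarrow> ('a, 'b) ell2" where "sgn_ell2 f = f /\<^sub>R norm f"
definition dist_ell2 :: "('a, 'b) ell2 \<Rightarrow> ('a, 'b) ell2 \<Rightarrow> real" where "dist_ell2 f g = norm (f - g)"
definition uniformity_ell2 :: "(('a, 'b) ell2 \<times> ('a, 'b) ell2) filter"
  where "uniformity_ell2 = (INF e\<in>{0<..}. principal {(f, g). dist f g < e})"
definition open_ell2 :: "('a, 'b) ell2 set \<Rightarrow> bool"
  where "open_ell2 U = (\<forall>f\<in>U. \<forall>\<^sub>F (f', g) in uniformity. f' = f \<longrightarrow> g \<in> U)"

instance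
proof
  fix f g h :: "('a, 'b) ell2" and r :: real and U :: "('a, 'b) ell2 set"
  show "sgn f = f /\<^sub>R norm f" by (rule sgn_ell2_def)
  show "dist f g = norm (f - g)" by (rule dist_ell2_def)
  show "(uniformity :: (('a, 'b) ell2 \<times> ('a, 'b) ell2) filter)
      = (INF e\<in>{0<..}. principal {(x, y). dist x y < e})" by (rule uniformity_ell2_def)
  show "open U = (\<forall>x\<in>U. \<forall>\<^sub>F (x', y) in uniformity. x' = x \<longrightarrow> y \<in> U)" by (rule open_ell2_def)
  show "inner f g = inner g f" by transfer (simp add: inner_commute)
  show "inner (f + g) h = inner f h + inner g h"
    by transfer (simp add: inner_add_left infsum_add inner_summable)
  show "inner (r *\<^sub>R f) g = r * inner f g"
    by transfer (simp add: infsum_cmult_right inner_summable)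
  show "0 \<le> inner f f" by transfer (simp add: infsum_nonneg)
  show "inner f f = 0 \<longleftrightarrow> f = 0"
  proof
    assume "inner f f = 0"
    then have *: "(\<Sum>\<^sub>\<infinity>i. inner (coord f i) (coord f i)) = 0"
      by (simp add: inner_ell2.rep_eq)
    have "inner (coord f i) (coord f i) = 0" for i
      by (rule nonneg_infsum_le_0D[where A = UNIV and f = "\<lambda>i. inner (coord f i) (coord f i)"])
        (use * in \<open>auto intro!: inner_summable coord_summable\<close>)
    then show "f = 0"
      by (intro ell2_eqI) (simp add: zero_ell2.rep_eq)
  qed (transfer, simp)
  show "norm f = sqrt (inner f f)" by (rule norm_ell2_def)
qed

end

lemma norm_sq_ell2: "(norm f)\<^sup>2 = (\<Sum>\<^sub>\<infinity>i. (norm (coord f i))\<^sup>2)"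
  by (simp add: power2_norm_eq_inner inner_ell2.rep_eq)

lemma norm_sq_sum_le: "finite A \<Longrightarrow> (\<Sum>i\<in>A. (norm (coord f i))\<^sup>2) \<le> (norm f)\<^sup>2"
  unfolding norm_sq_ell2 by (rule finite_sum_le_infsum) (auto intro: coord_summable)

lemma norm_coord_le: "norm (coord f i) \<le> norm f"
  by (rule power2_le_imp_le) (use norm_sq_sum_le[of "{i}" f] in simp_all)

instance ell2 :: (type, "{real_inner, complete_space}") complete_space
proof
  fix X :: "nat \<Rightarrow> ('a, 'b) ell2"
  assume X: "Cauchy X"
  have "Cauchy (\<lambda>n. coord (X n) i)" for i
  proof (rule metric_CauchyI)
    fix e :: real assume "0 < e"
    then obtain M where M: "\<And>m n. m \<ge> M \<Longrightarrow> n \<ge> M \<Longrightarrow> dist (X m) (X n) < e"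
      using metric_CauchyD[OF X] by blast
    have "dist (coord (X m) i) (coord (X n) i) \<le> dist (X m) (X n)" for m n
      using norm_coord_le[of "X m - X n" i] by (simp add: dist_norm minus_ell2.rep_eq)
    then show "\<exists>M. \<forall>m\<ge>M. \<forall>n\<ge>M. dist (coord (X m) i) (coord (X n) i) < e"
      using M by (meson le_less_trans)
  qed
  then have "\<forall>i. \<exists>l. (\<lambda>n. coord (X n) i) \<longlonglongrightarrow> l"
    by (simp add: Cauchy_convergent_iff convergent_def)
  then have "\<exists>l. \<forall>i. (\<lambda>n. coord (X n) i) \<longlonglongrightarrow> l i"
    by (rule choice)
  then obtain l where l: "\<And>i. (\<lambda>n. coord (X n) i) \<longlonglongrightarrow> l i" by blast
  have bound: "\<exists>M. \<forall>m\<ge>M. \<forall>A. finite A \<longrightarrow> (\<Sum>i\<in>A. (norm (coord (X m) i - l i))\<^sup>2) \<le> e\<^sup>2"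
    if "e > 0" for e
  proof -
    obtain M where M: "\<And>m n. m \<ge> M \<Longrightarrow> n \<ge> M \<Longrightarrow> dist (X m) (X n) < e"
      using metric_CauchyD[OF X \<open>e > 0\<close>] by blast
    have "(\<Sum>i\<in>A. (norm (coord (X m) i - l i))\<^sup>2) \<le> e\<^sup>2" if "m \<ge> M" "finite A" for m A
    proof (rule LIMSEQ_le_const2)
      show "(\<lambda>n. \<Sum>i\<in>A. (norm (coord (X m) i - coord (X n) i))\<^sup>2)
          \<longlonglongrightarrow> (\<Sum>i\<in>A. (norm (coord (X m) i - l i))\<^sup>2)"
        by (intro tendsto_sum tendsto_power tendsto_norm tendsto_diff tendsto_const l)
      have "(\<Sum>i\<in>A. (norm (coord (X m) i - coord (X n) i))\<^sup>2) \<le> e\<^sup>2" if "n \<ge> M" for n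
      proof -
        have "(\<Sum>i\<in>A. (norm (coord (X m) i - coord (X n) i))\<^sup>2) \<le> (norm (X m - X n))\<^sup>2"
          using norm_sq_sum_le[OF \<open>finite A\<close>, of "X m - X n"] by (simp add: minus_ell2.rep_eq)
        also have "\<dots> \<le> e\<^sup>2"
          using M[OF \<open>m \<ge> M\<close> that] by (intro power_mono) (auto simp: dist_norm)
        finally show ?thesis .
      qed
      then show "\<exists>N. \<forall>n\<ge>N. (\<Sum>i\<in>A. (norm (coord (X m) i - coord (X n) i))\<^sup>2) \<le> e\<^sup>2" by blast
    qed
    then show ?thesis by blast
  qed
  have diff: "(\<lambda>i. (norm (l i - coord (X m) i))\<^sup>2) summable_on UNIV"
    if "\<And>A. finite A \<Longrightarrow> (\<Sum>i\<in>A. (norm (coord (X m) i - l i))\<^sup>2) \<le> e\<^sup>2" for m e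
    by (rule nonneg_bdd_above_summable_on)
      (use that in \<open>auto intro!: bdd_aboveI[of _ "e\<^sup>2"] simp: norm_minus_commute\<close>)
  obtain m0 where m0: "\<And>A. finite A \<Longrightarrow> (\<Sum>i\<in>A. (norm (coord (X m0) i - l i))\<^sup>2) \<le> 1\<^sup>2"
    using bound[of 1] by auto
  have "(\<lambda>i. (norm (coord (X m0) i + (l i - coord (X m0) i)))\<^sup>2) summable_on UNIV"
    by (rule sq_summable_add[OF coord_summable diff[OF m0]])
  then have l2: "(\<lambda>i. (norm (l i))\<^sup>2) summable_on UNIV" by simp
  define L where "L = Abs_ell2 l"
  have L: "coord L = l" unfolding L_def using l2 by (simp add: Abs_ell2_inverse)
  have "X \<longlonglongrightarrow> L"
  proof (rule metric_LIMSEQ_I)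
    fix r :: real assume "0 < r"
    then obtain M where M: "\<And>m A. m \<ge> M \<Longrightarrow> finite A \<Longrightarrow>
        (\<Sum>i\<in>A. (norm (coord (X m) i - l i))\<^sup>2) \<le> (r/2)\<^sup>2"
      using bound[of "r/2"] by auto
    have "dist (X m) L < r" if "m \<ge> M" for m
    proof -
      have "(norm (X m - L))\<^sup>2 = (\<Sum>\<^sub>\<infinity>i. (norm (coord (X m) i - l i))\<^sup>2)"
        by (simp add: norm_sq_ell2 minus_ell2.rep_eq L)
      also have "\<dots> \<le> (r/2)\<^sup>2"
        by (rule infsum_le_finite_sums)
          (use coord_summable[of "X m - L"] M[OF that] in \<open>auto simp: minus_ell2.rep_eq L\<close>)
      finally have "norm (X m - L) \<le> r/2"
        by (rule power2_le_imp_le) (use \<open>0 < r\<close> in simp)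
      then show ?thesis using \<open>0 < r\<close> by (simp add: dist_norm)
    qed
    then show "\<exists>no. \<forall>n\<ge>no. dist (X n) L < r" by blast
  qed
  then show "convergent X" by (rule convergentI)
qed

lemma cinner_summable:
  fixes f g :: "'i \<Rightarrow> 'k::chilbert_space"
  assumes "(\<lambda>i. (norm (f i))\<^sup>2) summable_on UNIV" "(\<lambda>i. (norm (g i))\<^sup>2) summable_on UNIV"
  shows "(\<lambda>i. cinner (f i) (g i)) summable_on UNIV"
proof -
  have "(\<lambda>i. complex_of_real (inner (f i) (g i)) + \<i> * complex_of_real (inner (f i) (\<i> *\<^sub>C g i)))
      summable_on UNIV"
    using assms
    by (intro summable_on_add summable_on_cmult_right summable_on_of_real inner_summable)
      (simp_all add: norm_scaleC)
  then show ?thesis by (simp add: cinner_eq_inner Complex_eq)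
qed

instantiation ell2 :: (type, chilbert_space) chilbert_space
begin

lift_definition scaleC_ell2 :: "complex \<Rightarrow> ('a, 'b) ell2 \<Rightarrow> ('a, 'b) ell2"
  is "\<lambda>c f i. c *\<^sub>C f i"
  by (simp add: norm_scaleC power_mult_distrib summable_on_cmult_right)
lift_definition cinner_ell2 :: "('a, 'b) ell2 \<Rightarrow> ('a, 'b) ell2 \<Rightarrow> complex"
  is "\<lambda>f g. \<Sum>\<^sub>\<infinity>i. cinner (f i) (g i)" .

instance
proof
  fix f g h :: "('a, 'b) ell2" and c d :: complex and r :: real
  show "c *\<^sub>C (f + g) = c *\<^sub>C f + c *\<^sub>C g" by transfer (simp add: scaleC_add_right)
  show "(c + d) *\<^sub>C f = c *\<^sub>C f + d *\<^sub>C f" by transfer (simp add: scaleC_add_left)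
  show "c *\<^sub>C d *\<^sub>C f = (c * d) *\<^sub>C f" by transfer (simp add: scaleC_scaleC)
  show "complex_of_real r *\<^sub>C f = r *\<^sub>R f" by transfer (simp add: scaleC_of_real)
  have *: "cinner x y = cnj (cinner y x)" for x y :: 'b by (rule cinner_commute)
  show "cinner f g = cnj (cinner g f)"
    by transfer (simp add: infsum_cnj[symmetric] *[symmetric])
  show "cinner (f + g) h = cinner f h + cinner g h"
    by transfer (simp add: cinner_add_left infsum_add cinner_summable)
  show "cinner (c *\<^sub>C f) g = c * cinner f g"
    by transfer (simp add: cinner_scaleC_left infsum_cmult_right cinner_summable)
  show "Re (cinner f g) = inner f g"
  proof transfer
    fix f g :: "'a \<Rightarrow> 'b"
    assume "(\<lambda>i. (norm (f i))\<^sup>2) summable_on UNIV" "(\<lambda>i. (norm (g i))\<^sup>2) summable_on UNIV"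
    then show "Re (\<Sum>\<^sub>\<infinity>i. cinner (f i) (g i)) = (\<Sum>\<^sub>\<infinity>i. inner (f i) (g i))"
      using infsum_Re[OF cinner_summable[of f g]] by (simp add: Re_cinner)
  qed
qed

end


section \<open>Closed subspaces and bounded operators between them\<close>

definition closed_csubspace :: "'a::chilbert_space set \<Rightarrow> bool" where
  "closed_csubspace E \<longleftrightarrow>
     0 \<in> E \<and> (\<forall>x\<in>E. \<forall>y\<in>E. x + y \<in> E) \<and> (\<forall>c. \<forall>x\<in>E. c *\<^sub>C x \<in> E) \<and> closed E"

definition orth_compl :: "'a::chilbert_space set \<Rightarrow> 'a set" where
  "orth_compl E = {x. \<forall>y\<in>E. cinner x y = 0}"

definition proj :: "'a::chilbert_space set \<Rightarrow> 'a \<Rightarrow> 'a" where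
  "proj E x = (THE y. y \<in> E \<and> x - y \<in> orth_compl E)"

text \<open>
  An operator between closed subspaces \<open>E\<close> and \<open>F\<close> is given by a function on the ambient
  space of which only the values on \<open>E\<close> are relevant. \<open>bop E F\<close> is thus \<open>B(E, F)\<close>, up
  to equality on \<open>E\<close>; all the notions below depend on the operators only up to
  this equality, and sets closed in the topologies below are saturated with respect to it.
\<close>

definition bop :: "'a::chilbert_space set \<Rightarrow> 'b::chilbert_space set \<Rightarrow> ('a \<Rightarrow> 'b) set" where
  "bop E F = {T. (\<forall>x\<in>E. T x \<in> F)
     \<and> (\<forall>x\<in>E. \<forall>y\<in>E. T (x + y) = T x + T y) \<and> (\<forall>c. \<forall>x\<in>E. T (c *\<^sub>C x) = c *\<^sub>C T x)
     \<and> (\<exists>K. \<forall>x\<in>E. norm (T x) \<le> K * norm x)}"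

text \<open>The operator norm, as in the library's \<^const>\<open>onorm\<close> but relative to \<open>E\<close>.\<close>

definition onorm_on :: "'a::chilbert_space set \<Rightarrow> ('a \<Rightarrow> 'b::chilbert_space) \<Rightarrow> real" where
  "onorm_on E T = (SUP x\<in>E. norm (T x) / norm x)"

text \<open>For \<open>T\<close> in \<open>bop E F\<close>, the adjoint (an element of \<open>bop F E\<close>).\<close>

definition adj :: "'a::chilbert_space set \<Rightarrow> ('a \<Rightarrow> 'b::chilbert_space) \<Rightarrow> 'b \<Rightarrow> 'a" where
  "adj E T y = (THE z. z \<in> E \<and> (\<forall>x\<in>E. cinner (T x) y = cinner x z))"

definition coinvariant :: "'a::chilbert_space set \<Rightarrow> ('a \<Rightarrow> 'a) \<Rightarrow> 'a set \<Rightarrow> bool" where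
  "coinvariant H T E \<longleftrightarrow> (\<forall>y\<in>E. adj H T y \<in> E)"

text \<open>The weak operator topology on \<open>B(E, F)\<close>.\<close>

definition wot :: "'a::chilbert_space set \<Rightarrow> 'b::chilbert_space set \<Rightarrow> ('a \<Rightarrow> 'b) topology" where
  "wot E F = pullback_topology (bop E F)
     (\<lambda>T. \<lambda>(x, y)\<in>E \<times> F. cinner (T x) y)
     (product_topology (\<lambda>_. euclidean) (E \<times> F))"

text \<open>
  The \<open>w\<^sup>*\<close>-topology on \<open>B(E, F)\<close> as dual of the trace class operators: it is induced by the
  functionals \<open>T \<mapsto> (\<Sum>k. \<langle>T x\<^sub>k, y\<^sub>k\<rangle>)\<close> with \<open>(\<Sum>k. \<parallel>x\<^sub>k\<parallel>\<^sup>2)\<close> and \<open>(\<Sum>k. \<parallel>y\<^sub>k\<parallel>\<^sup>2)\<close> finite.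
\<close>

definition sq_summable_seqs :: "'a::chilbert_space set \<Rightarrow> (nat \<Rightarrow> 'a) set" where
  "sq_summable_seqs E = {x. (\<forall>k. x k \<in> E) \<and> summable (\<lambda>k. (norm (x k))\<^sup>2)}"

definition weak_star :: "'a::chilbert_space set \<Rightarrow> 'b::chilbert_space set \<Rightarrow> ('a \<Rightarrow> 'b) topology" where
  "weak_star E F = pullback_topology (bop E F)
     (\<lambda>T. \<lambda>(x, y)\<in>sq_summable_seqs E \<times> sq_summable_seqs F. \<Sum>k. cinner (T (x k)) (y k))
     (product_topology (\<lambda>_. euclidean) (sq_summable_seqs E \<times> sq_summable_seqs F))"

definition op_space ::
  "'a::chilbert_space set \<Rightarrow> 'b::chilbert_space set \<Rightarrow> ('a \<Rightarrow> 'b) set \<Rightarrow> bool" where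
  "op_space E F V \<longleftrightarrow> V \<subseteq> bop E F \<and> (\<lambda>_. 0) \<in> V
     \<and> (\<forall>S\<in>V. \<forall>T\<in>V. (\<lambda>x. S x + T x) \<in> V) \<and> (\<forall>c. \<forall>T\<in>V. (\<lambda>x. c *\<^sub>C T x) \<in> V)"

definition unital_op_algebra :: "'a::chilbert_space set \<Rightarrow> ('a \<Rightarrow> 'a) set \<Rightarrow> bool" where
  "unital_op_algebra E A \<longleftrightarrow> op_space E E A \<and> id \<in> A \<and> (\<forall>S\<in>A. \<forall>T\<in>A. S \<circ> T \<in> A)"


section \<open>Fock space and Hilbert tensor products with it\<close>

text \<open>
  The \<open>n\<close>-dimensional space has the orthonormal basis \<open>e\<^sub>i\<close> indexed by the elements of a
  finite type \<open>'n\<close>. The vectors \<open>e\<^sub>w = e\<^sub>i\<^sub>1 \<otimes> \<dots> \<otimes> e\<^sub>i\<^sub>k\<close>, with \<open>w = [i\<^sub>1, \<dots>, i\<^sub>k]\<close> of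
  length \<open>k\<close>, form an orthonormal basis of the \<open>k\<close>-th tensor power, so the full Fock space is
  \<open>\<ell>\<^sup>2\<close> of the set of all words. Its Hilbert tensor product with \<open>'k\<close> is the space of square summable
  families of vectors of \<open>'k\<close> indexed by words.
\<close>

type_synonym ('n, 'k) vfock = "('n list, 'k) ell2"
type_synonym 'n fock = "('n, complex) vfock"

lift_definition ket :: "'n list \<Rightarrow> 'n fock" is "\<lambda>w v. if v = w then 1 else 0"
proof -
  fix w :: "'n list"
  show "(\<lambda>v. (norm (if v = w then 1 else 0 :: complex))\<^sup>2) summable_on UNIV"
    by (rule finite_nonzero_values_imp_summable_on)
      (auto intro!: finite_subset[of _ "{w}"] split: if_splits)
qed

text \<open>The elementary tensor of \<open>f\<close> and \<open>k\<close>.\<close>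

lift_definition tensor :: "'n fock \<Rightarrow> 'k::chilbert_space \<Rightarrow> ('n, 'k) vfock"
  is "\<lambda>f k w. f w *\<^sub>C k"
  by (simp add: norm_scaleC power_mult_distrib summable_on_cmult_left)

text \<open>\<open>tensor_space N\<close> is the Hilbert tensor product of the closed subspace \<open>N\<close> with \<open>'k\<close>.\<close>

definition tensor_space :: "'n fock set \<Rightarrow> ('n, 'k::chilbert_space) vfock set" where
  "tensor_space N = closed_csubspace hull {tensor f k | f k. f \<in> N}"

text \<open>The two properties characterizing the Hilbert tensor product:\<close>

lemma cinner_tensor: "cinner (tensor f k) (tensor g l) = cinner f g * cinner k l"
proof -
  have "cinner (tensor f k) (tensor g l) = (\<Sum>\<^sub>\<infinity>w. cinner (coord f w) (coord g w) * cinner k l)"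
    by (simp add: cinner_ell2.rep_eq tensor.rep_eq cinner_scaleC_left cinner_scaleC_right
        cinner_complex_def ac_simps)
  also have "\<dots> = cinner f g * cinner k l"
    by (simp add: cinner_ell2.rep_eq infsum_cmult_left cinner_summable coord_summable)
  finally show ?thesis .
qed

lemma tensor_space_UNIV: "tensor_space UNIV = (UNIV :: ('n, 'k::chilbert_space) vfock set)"
proof -
  have "f \<in> E" if E: "closed_csubspace E" and sub: "{tensor g k | g k. g \<in> UNIV} \<subseteq> E"
    for f :: "('n, 'k) vfock" and E
  proof -
    define s where "s A = (\<Sum>w\<in>A. tensor (ket w) (coord f w))" for A
    have s_in: "s A \<in> E" if "finite A" for A
      using that
    proof (induction A)
      case empty
      then show ?case using E by (simp add: s_def closed_csubspace_def)
    next
      case (insert w A)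
      have "tensor (ket w) (coord f w) \<in> E" using sub by blast
      with insert E show ?case by (auto simp: s_def closed_csubspace_def)
    qed
    have s_coord: "coord (s A) v = (if v \<in> A then coord f v else 0)" if "finite A" for A v
      using that
    proof (induction A)
      case empty
      then show ?case by (simp add: s_def zero_ell2.rep_eq)
    next
      case (insert w A)
      have one: "1 *\<^sub>C x = x" "0 *\<^sub>C x = 0" for x :: 'k
        using scaleC_of_real[of 1 x] scaleC_of_real[of 0 x] by simp_all
      have "coord (s (insert w A)) v = coord (tensor (ket w) (coord f w)) v + coord (s A) v"
        using insert.hyps by (simp add: s_def plus_ell2.rep_eq)
      then show ?case
        using insert by (auto simp: tensor.rep_eq ket.rep_eq one)
    qed
    have "f \<in> closure E"
      unfolding closure_approachable
    proof (intro allI impI)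
      fix e :: real assume e: "0 < e"
      obtain A where A: "finite A"
        "norm (sum (\<lambda>w. (norm (coord f w))\<^sup>2) A - (\<Sum>\<^sub>\<infinity>w. (norm (coord f w))\<^sup>2)) < e\<^sup>2"
      proof -
        have "0 < e\<^sup>2 / 2" "e\<^sup>2 / 2 < e\<^sup>2" using e by simp_all
        with infsum_finite_approximation[OF coord_summable, of "e\<^sup>2 / 2" f]
        obtain A where "finite A"
          "dist (sum (\<lambda>w. (norm (coord f w))\<^sup>2) A) (\<Sum>\<^sub>\<infinity>w. (norm (coord f w))\<^sup>2) < e\<^sup>2"
          by (meson le_less_trans)
        then show thesis using that by (simp add: dist_norm)
      qed
      have "(norm (s A - f))\<^sup>2 = (\<Sum>\<^sub>\<infinity>w. (norm (coord (s A) w - coord f w))\<^sup>2)"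
        by (simp add: norm_sq_ell2 minus_ell2.rep_eq)
      also have "\<dots> = (\<Sum>\<^sub>\<infinity>w\<in>UNIV - A. (norm (coord f w))\<^sup>2)"
        by (rule infsum_cong_neutral) (auto simp: s_coord A)
      also have "\<dots> = (\<Sum>\<^sub>\<infinity>w. (norm (coord f w))\<^sup>2) - (\<Sum>w\<in>A. (norm (coord f w))\<^sup>2)"
        using A(1) by (subst infsum_Diff) (auto intro: coord_summable summable_on_finite)
      also have "\<dots> < e\<^sup>2" using A(2) by simp
      finally have "norm (s A - f) < e" by (rule power2_less_imp_less) (use e in simp)
      then show "\<exists>y\<in>E. dist y f < e" using s_in[OF A(1)] by (auto simp: dist_norm)
    qed
    moreover have "closure E = E" using E by (simp add: closed_csubspace_def)
    ultimately show ?thesis by simp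
  qed
  then show ?thesis unfolding tensor_space_def hull_def by blast
qed

text \<open>
  For \<open>A\<close> in \<open>bop N N\<close> and bounded \<open>T\<close>, the operator \<open>A \<otimes> T\<close> from
  \<open>tensor_space N\<close> to \<open>tensor_space N\<close>, determined on elementary tensors.
\<close>

definition tensor_op :: "'n fock set \<Rightarrow> ('n fock \<Rightarrow> 'n fock) \<Rightarrow>
    ('k\<^sub>1::chilbert_space \<Rightarrow> 'k\<^sub>2::chilbert_space) \<Rightarrow> ('n, 'k\<^sub>1) vfock \<Rightarrow> ('n, 'k\<^sub>2) vfock" where
  "tensor_op N A T = (SOME M. M \<in> bop (tensor_space N) (tensor_space N) \<and>
     (\<forall>f\<in>N. \<forall>k. M (tensor f k) = tensor (A f) (T k)))"


section \<open>Creation operators, the noncommutative analytic Toeplitz algebra and constrained shifts\<close>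

text \<open>In terms of the basis, \<open>S\<^sub>i e\<^sub>w = e\<^sub>i \<otimes> e\<^sub>w = e\<^bsub>i # w\<^esub>\<close> and \<open>R\<^sub>i e\<^sub>w = e\<^sub>w \<otimes> e\<^sub>i = e\<^bsub>w @ [i]\<^esub>\<close>.\<close>

lemma sq_summable_extend:
  fixes f :: "'a \<Rightarrow> 'k::real_inner" and j :: "'a \<Rightarrow> 'a"
  assumes "(\<lambda>w. (norm (f w))\<^sup>2) summable_on UNIV" "inj j"
  shows "(\<lambda>w. (norm (if w \<in> range j then f (inv j w) else 0))\<^sup>2) summable_on UNIV"
proof -
  have "((\<lambda>w. (norm (f (inv j w)))\<^sup>2) \<circ> j) summable_on UNIV"
    using assms by (simp add: o_def)
  then have "(\<lambda>w. (norm (f (inv j w)))\<^sup>2) summable_on range j"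
    using summable_on_reindex[OF \<open>inj j\<close>, of "\<lambda>w. (norm (f (inv j w)))\<^sup>2"] by blast
  then show ?thesis
    by (rule summable_on_cong_neutral[THEN iffD1, rotated -1]) auto
qed

lift_definition left_creation :: "'n \<Rightarrow> 'n fock \<Rightarrow> 'n fock"
  is "\<lambda>i f w. if w \<noteq> [] \<and> hd w = i then f (tl w) else 0"
proof -
  fix i :: 'n and f :: "'n list \<Rightarrow> complex"
  assume f: "(\<lambda>w. (norm (f w))\<^sup>2) summable_on UNIV"
  have inj: "inj (\<lambda>w. i # w)" by simp
  have "(if w \<in> range (\<lambda>w. i # w) then f (inv (\<lambda>w. i # w) w) else 0)
      = (if w \<noteq> [] \<and> hd w = i then f (tl w) else 0)" for w
    by (cases w) (auto simp: inv_f_f[OF inj])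
  then show "(\<lambda>w. (norm (if w \<noteq> [] \<and> hd w = i then f (tl w) else 0))\<^sup>2) summable_on UNIV"
    using sq_summable_extend[OF f inj] by simp
qed

lift_definition right_creation :: "'n \<Rightarrow> 'n fock \<Rightarrow> 'n fock"
  is "\<lambda>i f w. if w \<noteq> [] \<and> last w = i then f (butlast w) else 0"
proof -
  fix i :: 'n and f :: "'n list \<Rightarrow> complex"
  assume f: "(\<lambda>w. (norm (f w))\<^sup>2) summable_on UNIV"
  have inj: "inj (\<lambda>w. w @ [i])" by (simp add: inj_def)
  have "(if w \<in> range (\<lambda>w. w @ [i]) then f (inv (\<lambda>w. w @ [i]) w) else 0)
      = (if w \<noteq> [] \<and> last w = i then f (butlast w) else 0)" for w
    by (cases w rule: rev_cases) (auto simp: inv_f_f[OF inj])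
  then show "(\<lambda>w. (norm (if w \<noteq> [] \<and> last w = i then f (butlast w) else 0))\<^sup>2) summable_on UNIV"
    using sq_summable_extend[OF f inj] by simp
qed

lemma left_creation_ket: "left_creation i (ket w) = ket (i # w)"
proof (rule ell2_eqI)
  show "coord (left_creation i (ket w)) v = coord (ket (i # w)) v" for v
    by (cases v) (auto simp: left_creation.rep_eq ket.rep_eq)
qed

lemma right_creation_ket: "right_creation i (ket w) = ket (w @ [i])"
proof (rule ell2_eqI)
  show "coord (right_creation i (ket w)) v = coord (ket (w @ [i])) v" for v
    by (cases v rule: rev_cases) (auto simp: right_creation.rep_eq ket.rep_eq)
qed

definition toeplitz_algebra :: "('n fock \<Rightarrow> 'n fock) set" where
  "toeplitz_algebra =
     (\<lambda>A. unital_op_algebra UNIV A \<and> closedin (wot UNIV UNIV) A) hull range left_creation"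

definition wot_closed_ideal :: "('n fock \<Rightarrow> 'n fock) set \<Rightarrow> bool" where
  "wot_closed_ideal J \<longleftrightarrow> J \<subseteq> toeplitz_algebra \<and> op_space UNIV UNIV J
     \<and> (\<forall>A\<in>toeplitz_algebra. \<forall>T\<in>J. A \<circ> T \<in> J \<and> T \<circ> A \<in> J)
     \<and> closedin (wot UNIV UNIV) J"

definition constrained_space :: "('n fock \<Rightarrow> 'n fock) set \<Rightarrow> 'n fock set"  (\<open>\<N>\<close>) where
  "\<N> J = orth_compl (closed_csubspace hull {T f | T f. T \<in> J})"

definition shift_B :: "('n fock \<Rightarrow> 'n fock) set \<Rightarrow> 'n \<Rightarrow> 'n fock \<Rightarrow> 'n fock" where
  "shift_B J i = (\<lambda>f. proj (\<N> J) (left_creation i f))"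

definition shift_W :: "('n fock \<Rightarrow> 'n fock) set \<Rightarrow> 'n \<Rightarrow> 'n fock \<Rightarrow> 'n fock" where
  "shift_W J i = (\<lambda>f. proj (\<N> J) (right_creation i f))"

definition algebra_W :: "('n fock \<Rightarrow> 'n fock) set \<Rightarrow> ('n fock \<Rightarrow> 'n fock) set" where
  "algebra_W J =
     (\<lambda>A. unital_op_algebra (\<N> J) A \<and> closedin (weak_star (\<N> J) (\<N> J)) A) hull range (shift_W J)"

text \<open>The \<open>WOT\<close>-closed operator space generated by the \<open>A \<otimes> T\<close> with \<open>A\<close> in \<open>algebra_W J\<close>.\<close>

definition multipliers_W :: "('n fock \<Rightarrow> 'n fock) set \<Rightarrow>
    (('n, 'k\<^sub>1::chilbert_space) vfock \<Rightarrow> ('n, 'k\<^sub>2::chilbert_space) vfock) set" where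
  "multipliers_W J =
     (\<lambda>V. op_space (tensor_space (\<N> J)) (tensor_space (\<N> J)) V
        \<and> closedin (wot (tensor_space (\<N> J)) (tensor_space (\<N> J))) V)
     hull {tensor_op (\<N> J) A T | A T. A \<in> algebra_W J \<and> T \<in> bop UNIV UNIV}"

definition shift_BI :: "('n fock \<Rightarrow> 'n fock) set \<Rightarrow> 'n \<Rightarrow>
    ('n, 'k::chilbert_space) vfock \<Rightarrow> ('n, 'k) vfock" where
  "shift_BI J i = tensor_op (\<N> J) (shift_B J i) id"

definition intertwines :: "('n fock \<Rightarrow> 'n fock) set \<Rightarrow>
    ('n, 'k\<^sub>1::chilbert_space) vfock set \<Rightarrow> ('n, 'k\<^sub>2::chilbert_space) vfock set \<Rightarrow>
    (('n, 'k\<^sub>1) vfock \<Rightarrow> ('n, 'k\<^sub>2) vfock) \<Rightarrow> bool" where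
  "intertwines J E\<^sub>1 E\<^sub>2 X \<longleftrightarrow>
     (\<forall>i. \<forall>x\<in>E\<^sub>1. X (proj E\<^sub>1 (shift_BI J i x)) = proj E\<^sub>2 (shift_BI J i (X x)))"

text \<open>\<open>G\<^sup>* E\<^sub>2 \<subseteq> E\<^sub>1\<close>, \<open>G\<^sup>*|E\<^sub>2 = X\<^sup>*\<close> and \<open>\<parallel>G\<parallel> = \<parallel>X\<parallel>\<close>.\<close>

definition lifts :: "('n fock \<Rightarrow> 'n fock) set \<Rightarrow>
    ('n, 'k\<^sub>1::chilbert_space) vfock set \<Rightarrow> ('n, 'k\<^sub>2::chilbert_space) vfock set \<Rightarrow>
    (('n, 'k\<^sub>1) vfock \<Rightarrow> ('n, 'k\<^sub>2) vfock) \<Rightarrow> (('n, 'k\<^sub>1) vfock \<Rightarrow> ('n, 'k\<^sub>2) vfock) \<Rightarrow> bool" where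
  "lifts J E\<^sub>1 E\<^sub>2 X G \<longleftrightarrow>
     adj (tensor_space (\<N> J)) G ` E\<^sub>2 \<subseteq> E\<^sub>1
     \<and> (\<forall>y\<in>E\<^sub>2. adj (tensor_space (\<N> J)) G y = adj E\<^sub>1 X y)
     \<and> onorm_on (tensor_space (\<N> J)) G = onorm_on E\<^sub>1 X"

end

theory Submission
  imports Defs
begin

text \<open>
  Since the \<open>E\<^sub>j\<close> are co-invariant, \<open>X\<^sup>*\<close> intertwines the backward shifts \<open>S\<^sub>i\<^sup>* \<otimes> I\<close> on \<open>E\<^sub>2\<close> and
  \<open>E\<^sub>1\<close>. It is extended to the whole of \<open>F\<^sup>2 \<otimes> K\<^sub>2\<close> with the same norm, by Zorn's lemma on graphs:
  if \<open>S\<^sub>i\<^sup>* f\<close> lies in the domain for all \<open>i\<close>, then everything but the vacuum coordinate of the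
  image of \<open>f\<close> is prescribed, and a minimizing sequence yields a vacuum coordinate that keeps the
  norm bound; as a maximal graph is closed, its domain contains all \<open>e\<^sub>w \<otimes> k\<close> and is everything.
  The extension maps \<open>N\<^sub>J \<otimes> K\<^sub>2\<close> to \<open>N\<^sub>J \<otimes> K\<^sub>1\<close>, and \<open>G\<close> is the adjoint of its restriction.
  The Fejer means of the Fourier series \<open>\<Sum>\<^sub>w W\<^sub>w \<otimes> A\<^sub>w\<close> of \<open>G\<close> are uniformly bounded and converge
  to \<open>G\<close> in the weak operator topology. Conversely, the operators that intertwine the
  \<open>B\<^sub>i \<otimes> I\<close> form a weakly closed space containing all \<open>A \<otimes> T\<close>.
\<close>

section \<open>Complex inner products\<close>

text \<open>The extension is built on the whole Fock space, although only its restriction to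
  \<open>H\<close> is wanted: the induction over words that exhausts the domain runs through the
  \<open>tensor (ket w) k\<close>, and these need not lie in \<open>H\<close>. The obstacle in a
  one-step extension is that a single \<open>h\<close> must satisfy \<parallel>h - y\<parallel>
  \<le> c \<parallel>f - x\<parallel> for all pairs (x, y) of the graph at once. Once all
  \<open>lann i h\<close> are prescribed, this is a family of ball conditions on the vacuum
  coordinate alone. The squared radii are non-negative and strongly convex in the pair, because the
  norm bound of the graph also holds for differences of pairs; this gives the balls a common point.
  That the extension respects \<open>\<N> J\<close> costs nothing: \<open>\<N> J\<close> is the
  orthogonal complement of the range of an ideal, and the adjoint of an operator commuting with the
  backward shifts commutes with the Toeplitz algebra. Fejer weights are used because plain partial
  sums of the Fourier series need not be uniformly bounded, and the uniform bound carries the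
  convergence from the basis tensors to all vectors.\<close>

lemma scaleC_zero_left [simp]: "0 *\<^sub>C x = 0" for x :: "'a::chilbert_space"
  using scaleC_of_real[of 0 x] by simp

lemma scaleC_one [simp]: "1 *\<^sub>C x = x" for x :: "'a::chilbert_space"
  using scaleC_of_real[of 1 x] by simp

lemma scaleC_zero_right [simp]: "c *\<^sub>C 0 = 0" for c :: complex
  using scaleC_add_right[of c 0 "0::'a::chilbert_space"] by simp

lemma scaleC_minus_one: "(- 1) *\<^sub>C x = - x" for x :: "'a::chilbert_space"
  using scaleC_of_real[of "- 1" x] by simp

lemma scaleC_minus_right: "c *\<^sub>C (- x) = - (c *\<^sub>C x)" for x :: "'a::chilbert_space"
  by (metis mult.commute scaleC_minus_one scaleC_scaleC)

lemma scaleC_diff_right: "c *\<^sub>C (x - y) = c *\<^sub>C x - c *\<^sub>C y" for x :: "'a::chilbert_space"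
  using scaleC_add_right[of c x "- y"] by (simp add: scaleC_minus_right)

lemma cinner_add_right: "cinner x (y + z) = cinner x y + cinner x z"
  for x :: "'a::chilbert_space"
  by (metis cinner_commute cinner_add_left complex_cnj_add)

lemma cinner_zero_left [simp]: "cinner 0 x = 0" for x :: "'a::chilbert_space"
  using cinner_add_left[of 0 0 x] by simp

lemma cinner_zero_right [simp]: "cinner x 0 = 0" for x :: "'a::chilbert_space"
  using cinner_add_right[of x 0 0] by simp

lemma cinner_minus_left: "cinner (- x) y = - cinner x y" for x :: "'a::chilbert_space"
  using cinner_add_left[of x "- x" y] by (simp add: eq_neg_iff_add_eq_0 add.commute)

lemma cinner_minus_right: "cinner x (- y) = - cinner x y" for x :: "'a::chilbert_space"
  using cinner_add_right[of x y "- y"] by (simp add: eq_neg_iff_add_eq_0 add.commute)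

lemma cinner_diff_left: "cinner (x - y) z = cinner x z - cinner y z"
  for x :: "'a::chilbert_space"
  using cinner_add_left[of x "- y" z] by (simp add: cinner_minus_left)

lemma cinner_diff_right: "cinner x (y - z) = cinner x y - cinner x z"
  for x :: "'a::chilbert_space"
  using cinner_add_right[of x y "- z"] by (simp add: cinner_minus_right)

lemma cinner_sum_left: "cinner (\<Sum>i\<in>A. f i) y = (\<Sum>i\<in>A. cinner (f i) y)"
  for y :: "'a::chilbert_space"
  by (induction A rule: infinite_finite_induct) (simp_all add: cinner_add_left)

lemma cinner_sum_right: "cinner y (\<Sum>i\<in>A. f i) = (\<Sum>i\<in>A. cinner y (f i))"
  for y :: "'a::chilbert_space"
  by (induction A rule: infinite_finite_induct) (simp_all add: cinner_add_right)

lemma cinner_eq_zero_iff [simp]: "cinner x x = 0 \<longleftrightarrow> x = 0" for x :: "'a::chilbert_space"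
  by (simp add: cinner_self)

text \<open>A unimodular factor \<open>u\<close> makes the product real and non-negative, so that
  the Cauchy-Schwarz inequality of the real inner product applies.\<close>

lemma norm_cinner_le: "cmod (cinner x y) \<le> norm x * norm y" for x y :: "'a::chilbert_space"
proof (cases "cinner x y = 0")
  case False
  define u where "u = cnj (sgn (cinner x y))"
  have "cmod u = 1" using False by (simp add: u_def norm_sgn)
  have "u * cinner x y = complex_of_real (cmod (cinner x y))"
    using False complex_norm_square[of "cinner x y"]
    by (simp add: u_def sgn_eq field_simps power2_eq_square)
  then have "cmod (cinner x y) = inner (u *\<^sub>C x) y"
    by (metis Re_cinner Re_complex_of_real cinner_scaleC_left)
  also have "\<dots> \<le> norm (u *\<^sub>C x) * norm y" by (rule norm_cauchy_schwarz)
  finally show ?thesis by (simp add: norm_scaleC \<open>cmod u = 1\<close>)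
qed simp

interpretation cinner: bounded_bilinear "cinner :: 'a::chilbert_space \<Rightarrow> 'a \<Rightarrow> complex"
proof
  show "cinner (r *\<^sub>R x) y = r *\<^sub>R cinner x y" "cinner x (r *\<^sub>R y) = r *\<^sub>R cinner x y"
    for r and x y :: 'a
    using cinner_scaleC_left[of "complex_of_real r" x y]
      cinner_scaleC_right[of x "complex_of_real r" y]
    by (simp_all add: scaleC_of_real scaleR_conv_of_real)
  show "\<exists>K. \<forall>x y :: 'a. cmod (cinner x y) \<le> norm x * norm y * K"
    by (rule exI[of _ 1]) (simp add: norm_cinner_le)
qed (simp_all add: cinner_add_left cinner_add_right)

lemma bounded_linear_scaleC: "bounded_linear (\<lambda>x :: 'a::chilbert_space. c *\<^sub>C x)"
proof
  show "c *\<^sub>C (x + y) = c *\<^sub>C x + c *\<^sub>C y" for x y :: 'a by (rule scaleC_add_right)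
  show "c *\<^sub>C r *\<^sub>R x = r *\<^sub>R c *\<^sub>C x" for r and x :: 'a
    by (simp add: scaleC_of_real[symmetric] scaleC_scaleC mult.commute)
  show "\<exists>K. \<forall>x :: 'a. norm (c *\<^sub>C x) \<le> norm x * K"
    by (rule exI[of _ "cmod c"]) (simp add: norm_scaleC mult.commute)
qed

lemmas tendsto_scaleC = bounded_linear.tendsto[OF bounded_linear_scaleC]

text \<open>The last term is the exact defect of convexity; it supplies the strong convexity in both
  minimization arguments below.\<close>

lemma norm_sq_convex_combination:
  fixes a b :: "'a::real_inner"
  shows "(norm ((1 - t) *\<^sub>R a + t *\<^sub>R b))\<^sup>2
    = (1 - t) * (norm a)\<^sup>2 + t * (norm b)\<^sup>2 - t * (1 - t) * (norm (a - b))\<^sup>2"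
  by (simp add: power2_norm_eq_inner inner_add_left inner_add_right inner_diff_left
      inner_diff_right inner_commute[of b a] algebra_simps)

text \<open>
  A strongly convex function need not attain its infimum, but \<open>z\<close> converges along every
  minimizing sequence. This replaces completions and square roots of positive forms.
\<close>

lemma strongly_convex_minimizing_limit:
  fixes z :: "'a::real_vector \<Rightarrow> 'b::{real_normed_vector, complete_space}"
  assumes "convex E" "E \<noteq> {}" and lower: "\<And>e. e \<in> E \<Longrightarrow> L \<le> Q e"
    and strong: "\<And>a b t. a \<in> E \<Longrightarrow> b \<in> E \<Longrightarrow> 0 \<le> t \<Longrightarrow> t \<le> 1 \<Longrightarrow>
      Q ((1 - t) *\<^sub>R a + t *\<^sub>R b) \<le> (1 - t) * Q a + t * Q b - t * (1 - t) * (norm (z a - z b))\<^sup>2"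
  obtains z0 d where "z0 \<in> closure (z ` E)" "L \<le> d" "\<And>e. e \<in> E \<Longrightarrow> (norm (z0 - z e))\<^sup>2 \<le> Q e - d"
proof -
  define d where "d = Inf (Q ` E)"
  have bdd: "bdd_below (Q ` E)" using lower by (auto intro!: bdd_belowI[of _ L])
  have d_le: "d \<le> Q e" if "e \<in> E" for e
    unfolding d_def using bdd that by (auto intro: cInf_lower)
  have "L \<le> d" unfolding d_def using \<open>E \<noteq> {}\<close> lower by (auto intro!: cInf_greatest)
  have "\<exists>e\<in>E. Q e < d + inverse (real (Suc n))" for n
    using cInf_lessD[of "Q ` E" "d + inverse (real (Suc n))"] \<open>E \<noteq> {}\<close> by (auto simp: d_def)
  then obtain e where e: "\<And>n. e n \<in> E" and Qe: "\<And>n. Q (e n) < d + inverse (real (Suc n))"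
    by metis
  have mid: "(1 - t) *\<^sub>R a + t *\<^sub>R b \<in> E" if "a \<in> E" "b \<in> E" "0 \<le> t" "t \<le> 1" for a b t
    using convexD_alt[OF \<open>convex E\<close>] that by blast
  have Q_lim: "(\<lambda>n. Q (e n)) \<longlonglongrightarrow> d"
  proof (rule real_tendsto_sandwich[of "\<lambda>_. d" _ _ "\<lambda>n. d + inverse (real (Suc n))"])
    show "(\<lambda>n. d + inverse (real (Suc n))) \<longlonglongrightarrow> d"
      using tendsto_add[OF tendsto_const[of d] LIMSEQ_inverse_real_of_nat] by simp
    show "\<forall>\<^sub>F n in sequentially. d \<le> Q (e n)" using d_le e by simp
    show "\<forall>\<^sub>F n in sequentially. Q (e n) \<le> d + inverse (real (Suc n))"
      using Qe by (simp add: less_imp_le)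
  qed simp
  have "Cauchy (\<lambda>n. z (e n))"
  proof (rule metric_CauchyI)
    fix \<epsilon> :: real assume "0 < \<epsilon>"
    then obtain M where M: "inverse (real (Suc M)) < \<epsilon>\<^sup>2 / 4"
      using reals_Archimedean[of "\<epsilon>\<^sup>2 / 4"] by auto
    have "dist (z (e m)) (z (e n)) < \<epsilon>" if "m \<ge> M" "n \<ge> M" for m n
    proof -
      have less: "Q (e k) < d + \<epsilon>\<^sup>2 / 4" if "k \<ge> M" for k
      proof -
        have "inverse (real (Suc k)) \<le> inverse (real (Suc M))" using that by simp
        then show ?thesis using Qe[of k] M by linarith
      qed
      \<comment> \<open>At the midpoint the gain is a quarter of the squared distance, hence the
        tolerance \<open>\<epsilon>\<^sup>2 / 4\<close>.\<close>
      have "d \<le> (1 - 1/2) * Q (e m) + 1/2 * Q (e n) - 1/2 * (1 - 1/2) * (norm (z (e m) - z (e n)))\<^sup>2"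
        using d_le[OF mid[OF e e, of "1/2" m n]] strong[OF e e, of "1/2" m n] by simp
      then have "(norm (z (e m) - z (e n)))\<^sup>2 < \<epsilon>\<^sup>2"
        using less[OF \<open>m \<ge> M\<close>] less[OF \<open>n \<ge> M\<close>] by simp
      then show ?thesis
        using \<open>0 < \<epsilon>\<close> by (simp add: dist_norm power_less_imp_less_base)
    qed
    then show "\<exists>M. \<forall>m\<ge>M. \<forall>n\<ge>M. dist (z (e m)) (z (e n)) < \<epsilon>" by blast
  qed
  then obtain z0 where z0: "(\<lambda>n. z (e n)) \<longlonglongrightarrow> z0"
    using Cauchy_convergent convergent_def by blast
  have "(norm (z0 - z a))\<^sup>2 \<le> Q a - d" if a: "a \<in> E" for a
  proof -
    \<comment> \<open>Strong convexity between \<open>e n\<close> and \<open>a\<close>, in the limit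
      of \<open>n\<close> and divided by \<open>t\<close>, leaves the factor \<open>1 - t\<close>;
      it disappears as \<open>t\<close> tends to 0.\<close>
    have step: "(1 - t) * (norm (z0 - z a))\<^sup>2 \<le> Q a - d" if t: "0 < t" "t < 1" for t
    proof -
      have "d \<le> (1 - t) * Q (e n) + t * Q a - t * (1 - t) * (norm (z (e n) - z a))\<^sup>2" for n
        using d_le[OF mid[OF e a, of t]] strong[OF e a, of t] t by (meson less_imp_le order_trans)
      then have "d \<le> (1 - t) * d + t * Q a - t * (1 - t) * (norm (z0 - z a))\<^sup>2"
        by (intro tendsto_lowerbound[OF _ _ trivial_limit_sequentially,
              of "\<lambda>n. (1 - t) * Q (e n) + t * Q a - t * (1 - t) * (norm (z (e n) - z a))\<^sup>2"]
            tendsto_intros Q_lim z0) auto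
      then have "t * ((1 - t) * (norm (z0 - z a))\<^sup>2) \<le> t * (Q a - d)"
        by (simp add: algebra_simps)
      then show ?thesis using t by simp
    qed
    have "((\<lambda>t. (1 - t) * (norm (z0 - z a))\<^sup>2) \<longlongrightarrow> (1 - 0) * (norm (z0 - z a))\<^sup>2) (at_right 0)"
      by (intro tendsto_intros)
    moreover have "\<forall>\<^sub>F t in at_right (0::real). (1 - t) * (norm (z0 - z a))\<^sup>2 \<le> Q a - d"
      unfolding eventually_at_right_field using step by (intro exI[of _ 1]) simp
    ultimately have "(1 - 0) * (norm (z0 - z a))\<^sup>2 \<le> Q a - d"
      by (rule tendsto_upperbound) simp
    then show ?thesis by simp
  qed
  moreover have "z0 \<in> closure (z ` E)"
    unfolding closure_sequential using z0 e by (intro exI[of _ "\<lambda>n. z (e n)"]) simp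
  ultimately show thesis using that \<open>L \<le> d\<close> by blast
qed


section \<open>Closed subspaces, projections and adjoints\<close>

lemma closed_csubspaceD:
  assumes "closed_csubspace E"
  shows "0 \<in> E" "\<And>x y. x \<in> E \<Longrightarrow> y \<in> E \<Longrightarrow> x + y \<in> E" "\<And>c x. x \<in> E \<Longrightarrow> c *\<^sub>C x \<in> E" "closed E"
  using assms by (auto simp: closed_csubspace_def)

lemma closed_csubspace_uminus: "closed_csubspace E \<Longrightarrow> x \<in> E \<Longrightarrow> - x \<in> E"
  by (metis closed_csubspaceD(3) scaleC_minus_one)

lemma closed_csubspace_diff: "closed_csubspace E \<Longrightarrow> x \<in> E \<Longrightarrow> y \<in> E \<Longrightarrow> x - y \<in> E"
  by (metis closed_csubspaceD(2) closed_csubspace_uminus uminus_add_conv_diff add.commute)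

lemma closed_csubspace_sum: "closed_csubspace E \<Longrightarrow> (\<And>i. i \<in> A \<Longrightarrow> f i \<in> E) \<Longrightarrow> (\<Sum>i\<in>A. f i) \<in> E"
  by (induction A rule: infinite_finite_induct) (auto intro: closed_csubspaceD)

lemma closed_csubspace_scaleR: "closed_csubspace E \<Longrightarrow> x \<in> E \<Longrightarrow> r *\<^sub>R x \<in> E"
  by (metis closed_csubspaceD(3) scaleC_of_real)

lemma closed_csubspace_convex: "closed_csubspace E \<Longrightarrow> convex E"
  by (auto intro!: convexI closed_csubspaceD(2) closed_csubspace_scaleR)

lemma closed_csubspace_UNIV: "closed_csubspace UNIV"
  by (simp add: closed_csubspace_def)

lemma closed_csubspace_Inter: "(\<And>E. E \<in> F \<Longrightarrow> closed_csubspace E) \<Longrightarrow> closed_csubspace (\<Inter>F)"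
  by (auto simp: closed_csubspace_def)

lemma closed_csubspace_hull: "closed_csubspace (closed_csubspace hull S)"
  by (rule hull_in) (rule closed_csubspace_Inter, blast)

lemma closed_csubspace_orth_compl: "closed_csubspace (orth_compl E)"
proof -
  have "closed {x. cinner x y = 0}" for y :: 'a
    by (intro closed_Collect_eq continuous_on_const linear_continuous_on
        cinner.bounded_linear_left)
  moreover have "orth_compl E = (\<Inter>y\<in>E. {x. cinner x y = 0})" by (auto simp: orth_compl_def)
  ultimately have "closed (orth_compl E)" by auto
  then show ?thesis
    by (auto simp: closed_csubspace_def orth_compl_def cinner_add_left cinner_scaleC_left)
qed

lemma cinner_eq_zero_commute: "cinner x y = 0 \<longleftrightarrow> cinner y x = 0" for x :: "'a::chilbert_space"
  by (metis cinner_commute complex_cnj_zero)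

lemma orth_compl_hull: "orth_compl (closed_csubspace hull S) = orth_compl S"
proof
  show "orth_compl (closed_csubspace hull S) \<subseteq> orth_compl S"
    using hull_subset[of S closed_csubspace] by (auto simp: orth_compl_def)
  show "orth_compl S \<subseteq> orth_compl (closed_csubspace hull S)"
  proof
    fix x assume x: "x \<in> orth_compl S"
    then have "S \<subseteq> orth_compl {x}"
      by (auto simp: orth_compl_def cinner_eq_zero_commute[of x])
    then have "closed_csubspace hull S \<subseteq> orth_compl {x}"
      by (rule hull_minimal) (rule closed_csubspace_orth_compl)
    then show "x \<in> orth_compl (closed_csubspace hull S)"
      by (auto simp: orth_compl_def cinner_eq_zero_commute[of x])
  qed
qed

text \<open>The representing vector minimizes \<open>\<parallel>x\<parallel>\<^sup>2 - 2 Re (\<phi> x)\<close>.\<close>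

lemma riesz_representation:
  fixes \<phi> :: "'a::chilbert_space \<Rightarrow> complex"
  assumes E: "closed_csubspace E"
    and add: "\<And>x y. x \<in> E \<Longrightarrow> y \<in> E \<Longrightarrow> \<phi> (x + y) = \<phi> x + \<phi> y"
    and scale: "\<And>c x. x \<in> E \<Longrightarrow> \<phi> (c *\<^sub>C x) = c * \<phi> x"
    and bound: "\<And>x. x \<in> E \<Longrightarrow> cmod (\<phi> x) \<le> K * norm x"
  obtains z where "z \<in> E" "\<And>x. x \<in> E \<Longrightarrow> \<phi> x = cinner x z"
proof -
  have scaleR: "\<phi> (r *\<^sub>R x) = r * \<phi> x" if "x \<in> E" for r x
    using scale[OF that, of "complex_of_real r"] by (simp add: scaleC_of_real)
  define Q where "Q x = (norm x)\<^sup>2 - 2 * Re (\<phi> x)" for x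
  have lower: "- K\<^sup>2 \<le> Q x" if "x \<in> E" for x
  proof -
    have "Re (\<phi> x) \<le> K * norm x" using bound[OF that] complex_Re_le_cmod order_trans by blast
    \<comment> \<open>Completing the square: the square of \<open>norm x - K\<close> is
      non-negative.\<close>
    then show ?thesis
      using sum_squares_ge_zero[of "norm x - K" 0]
      by (simp add: Q_def power2_eq_square algebra_simps)
  qed
  have strong: "Q ((1 - t) *\<^sub>R a + t *\<^sub>R b)
      \<le> (1 - t) * Q a + t * Q b - t * (1 - t) * (norm (id a - id b))\<^sup>2"
    if "a \<in> E" "b \<in> E" for a b t
  proof -
    have "\<phi> ((1 - t) *\<^sub>R a + t *\<^sub>R b) = complex_of_real (1 - t) * \<phi> a + complex_of_real t * \<phi> b"
      using that by (simp add: add scaleR closed_csubspace_scaleR[OF E])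
    then have "Re (\<phi> ((1 - t) *\<^sub>R a + t *\<^sub>R b)) = (1 - t) * Re (\<phi> a) + t * Re (\<phi> b)" by simp
    then show ?thesis
      unfolding Q_def norm_sq_convex_combination id_apply by (simp only:) (simp add: algebra_simps)
  qed
  obtain z d where z: "z \<in> closure (id ` E)" and min: "\<And>e. e \<in> E \<Longrightarrow> (norm (z - id e))\<^sup>2 \<le> Q e - d"
    by (rule strongly_convex_minimizing_limit[of E "- K\<^sup>2" Q id])
      (use closed_csubspace_convex[OF E] closed_csubspaceD(1)[OF E] lower strong in blast)+
  have "z \<in> E" using z closed_csubspaceD(4)[OF E] by simp
  have Re_eq: "Re (\<phi> u) = Re (cinner u z)" if u: "u \<in> E" for u
  proof (rule ccontr)
    define s where "s = inner z u - Re (\<phi> u)"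
    assume "Re (\<phi> u) \<noteq> Re (cinner u z)"
    then have "s \<noteq> 0" by (simp add: s_def Re_cinner inner_commute)
    \<comment> \<open>In the minimality inequality at \<open>z + t *\<^sub>R u\<close> the quadratic
      terms cancel, leaving 0 \<le> Q z - d + 2 t s. This \<open>t\<close> makes the right-hand side
      equal to -1.\<close>
    define t where "t = (d - Q z - 1) / (2 * s)"
    have "(norm (z - (z + t *\<^sub>R u)))\<^sup>2 \<le> Q (z + t *\<^sub>R u) - d"
      using min[of "z + t *\<^sub>R u"] u \<open>z \<in> E\<close> E
      by (simp add: closed_csubspaceD closed_csubspace_scaleR)
    moreover have "(norm (z + t *\<^sub>R u))\<^sup>2 = (norm z)\<^sup>2 + 2 * t * inner z u + t\<^sup>2 * (norm u)\<^sup>2"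
      unfolding power2_norm_eq_inner
      by (simp add: inner_add_left inner_add_right inner_commute[of u z] power2_eq_square algebra_simps)
    then have "Q (z + t *\<^sub>R u) = Q z + 2 * t * s + t\<^sup>2 * (norm u)\<^sup>2"
      unfolding Q_def using u \<open>z \<in> E\<close> E
      by (simp add: add scaleR closed_csubspace_scaleR s_def algebra_simps)
    ultimately have "0 \<le> Q z + 2 * t * s - d"
      by (simp add: power_mult_distrib)
    moreover have "2 * t * s = d - Q z - 1" using \<open>s \<noteq> 0\<close> by (simp add: t_def)
    ultimately show False by simp
  qed
  have "\<phi> u = cinner u z" if u: "u \<in> E" for u
  proof (rule complex_eqI)
    show "Re (\<phi> u) = Re (cinner u z)" by (rule Re_eq[OF u])
    show "Im (\<phi> u) = Im (cinner u z)"
      using Re_eq[OF closed_csubspaceD(3)[OF E u, of \<i>]] scale[OF u, of \<i>]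
      by (simp add: cinner_scaleC_left)
  qed
  then show thesis using that \<open>z \<in> E\<close> by blast
qed

lemma eq_if_cinner_eq:
  assumes "closed_csubspace E" "x \<in> E" "y \<in> E" "\<And>u. u \<in> E \<Longrightarrow> cinner u x = cinner u y"
  shows "x = y"
proof -
  have "cinner (x - y) (x - y) = 0"
    using assms(4)[of "x - y"] closed_csubspace_diff[OF assms(1-3)] by (simp add: cinner_diff_right)
  then show ?thesis by simp
qed

lemma proj_eqI:
  assumes "closed_csubspace E" "y \<in> E" "x - y \<in> orth_compl E"
  shows "proj E x = y"
  unfolding proj_def
proof (rule the_equality)
  fix y' assume y': "y' \<in> E \<and> x - y' \<in> orth_compl E"
  show "y' = y"
  proof (rule eq_if_cinner_eq[OF assms(1)])
    fix u assume "u \<in> E"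
    with y' assms(3) have "cinner x u = cinner y' u" "cinner x u = cinner y u"
      by (auto simp: orth_compl_def cinner_diff_left)
    then show "cinner u y' = cinner u y" by (metis cinner_commute)
  qed (use y' assms in auto)
qed (use assms in auto)

text \<open>\<open>proj\<close> is a definite description. The Riesz vector of
  \<open>\<lambda>u. cinner u x\<close> on \<open>E\<close> supplies existence, and
  \<open>proj_eqI\<close> uniqueness.\<close>

lemma
  assumes E: "closed_csubspace E"
  shows proj_in: "proj E x \<in> E" and cinner_proj: "y \<in> E \<Longrightarrow> cinner (proj E x) y = cinner x y"
proof -
  obtain z where "z \<in> E" "\<And>u. u \<in> E \<Longrightarrow> cinner u x = cinner u z"
    by (rule riesz_representation[OF E, of "\<lambda>u. cinner u x" "norm x"])
      (auto simp: cinner_add_left cinner_scaleC_left mult.commute[of "norm x"] norm_cinner_le)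
  then have z: "z \<in> E" "x - z \<in> orth_compl E"
    by (auto simp: orth_compl_def cinner_diff_left) (metis cinner_commute)
  then have "proj E x = z" by (rule proj_eqI[OF E])
  with z show "proj E x \<in> E" and "y \<in> E \<Longrightarrow> cinner (proj E x) y = cinner x y"
    by (auto simp: orth_compl_def cinner_diff_left)
qed

lemma cinner_proj_right: "closed_csubspace E \<Longrightarrow> y \<in> E \<Longrightarrow> cinner y (proj E x) = cinner y x"
  by (metis cinner_commute cinner_proj)

lemma closed_csubspace_eq_UNIV:
  assumes "closed_csubspace E" "\<And>x. x \<in> orth_compl E \<Longrightarrow> x = 0"
  shows "E = UNIV"
proof -
  have "x - proj E x \<in> orth_compl E" for x
    using cinner_proj[OF assms(1)] by (simp add: orth_compl_def cinner_diff_left)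
  then have "x = proj E x" for x using assms(2) by (metis right_minus_eq)
  then show ?thesis using proj_in[OF assms(1)] by (metis UNIV_eq_I)
qed

lemma proj_bop:
  fixes E :: "'a::chilbert_space set"
  assumes E: "closed_csubspace E"
  shows "proj E \<in> bop UNIV E"
proof -
  have "norm (proj E x) \<le> 1 * norm x" for x
  proof -
    have "(norm (proj E x))\<^sup>2 = inner x (proj E x)"
      by (simp add: power2_norm_eq_inner Re_cinner[symmetric] cinner_proj proj_in E)
    then have "(norm (proj E x))\<^sup>2 \<le> norm x * norm (proj E x)"
      by (simp add: norm_cauchy_schwarz)
    then show ?thesis
      by (cases "norm (proj E x) = 0") (simp_all add: power2_eq_square)
  qed
  moreover have "proj E (x + y) = proj E x + proj E y" for x y
    by (rule eq_if_cinner_eq[OF E])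
      (auto simp: E proj_in closed_csubspaceD cinner_add_right cinner_proj_right)
  moreover have "proj E (c *\<^sub>C x) = c *\<^sub>C proj E x" for c x
    by (rule eq_if_cinner_eq[OF E])
      (auto simp: E proj_in closed_csubspaceD cinner_scaleC_right cinner_proj_right)
  ultimately show ?thesis unfolding bop_def using proj_in[OF E] by blast
qed

section \<open>Bounded operators between closed subspaces, their adjoints and norms\<close>

lemma bopD:
  assumes "T \<in> bop E F"
  shows "\<And>x. x \<in> E \<Longrightarrow> T x \<in> F" "\<And>x y. x \<in> E \<Longrightarrow> y \<in> E \<Longrightarrow> T (x + y) = T x + T y"
    "\<And>c x. x \<in> E \<Longrightarrow> T (c *\<^sub>C x) = c *\<^sub>C T x"
  using assms by (auto simp: bop_def)

lemma bop_bound: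
  assumes "T \<in> bop E F"
  obtains K where "0 < K" "\<And>x. x \<in> E \<Longrightarrow> norm (T x) \<le> K * norm x"
proof -
  obtain K where K: "\<And>x. x \<in> E \<Longrightarrow> norm (T x) \<le> K * norm x"
    using assms unfolding bop_def by blast
  have "norm (T x) \<le> max K 1 * norm x" if "x \<in> E" for x
    using K[OF that] mult_right_mono[of K "max K 1" "norm x"] by simp
  then show thesis using that[of "max K 1"] by simp
qed

lemma bopI:
  assumes "\<And>x. x \<in> E \<Longrightarrow> T x \<in> F" "\<And>x y. x \<in> E \<Longrightarrow> y \<in> E \<Longrightarrow> T (x + y) = T x + T y"
    "\<And>c x. x \<in> E \<Longrightarrow> T (c *\<^sub>C x) = c *\<^sub>C T x" "\<And>x. x \<in> E \<Longrightarrow> norm (T x) \<le> K * norm x"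
  shows "T \<in> bop E F"
  unfolding bop_def using assms by blast

lemma bop_zero: "T \<in> bop E F \<Longrightarrow> closed_csubspace E \<Longrightarrow> T 0 = 0"
  using bopD(3)[of T E F 0 0] closed_csubspaceD(1)[of E] by simp

lemma bop_diff:
  assumes "T \<in> bop E F" "closed_csubspace E" "x \<in> E" "y \<in> E"
  shows "T (x - y) = T x - T y"
  using bopD(2)[OF assms(1), of "x - y" y] closed_csubspace_diff[OF assms(2-4)] assms
  by (simp add: eq_diff_eq)

lemma bop_sum:
  assumes "T \<in> bop E F" "closed_csubspace E" "\<And>i. i \<in> A \<Longrightarrow> f i \<in> E"
  shows "T (\<Sum>i\<in>A. f i) = (\<Sum>i\<in>A. T (f i))"
  using assms(3)
  by (induction A rule: infinite_finite_induct)
    (auto simp: bop_zero[OF assms(1,2)] bopD(2)[OF assms(1)] closed_csubspace_sum[OF assms(2)])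

lemma bop_subset: "T \<in> bop E F \<Longrightarrow> E' \<subseteq> E \<Longrightarrow> (\<And>x. x \<in> E' \<Longrightarrow> T x \<in> F') \<Longrightarrow> T \<in> bop E' F'"
  unfolding bop_def by blast

lemma bop_comp:
  assumes S: "S \<in> bop F G" and T: "T \<in> bop E F"
  shows "S \<circ> T \<in> bop E G"
proof -
  obtain K L where K: "0 < K" "\<And>x. x \<in> F \<Longrightarrow> norm (S x) \<le> K * norm x"
    and L: "0 < L" "\<And>x. x \<in> E \<Longrightarrow> norm (T x) \<le> L * norm x"
    using bop_bound[OF S] bop_bound[OF T] by metis
  show ?thesis
  proof (rule bopI)
    show "norm ((S \<circ> T) x) \<le> K * L * norm x" if "x \<in> E" for x
      using order_trans[OF K(2)[OF bopD(1)[OF T that]] mult_left_mono[OF L(2)[OF that], of K]] K(1)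
      by (simp add: mult.assoc)
  qed (simp_all add: bopD[OF S] bopD[OF T])
qed

lemma bop_id: "E \<subseteq> F \<Longrightarrow> id \<in> bop E F"
  by (rule bopI[where K = 1]) auto

lemma op_space_bop: "closed_csubspace F \<Longrightarrow> op_space E F (bop E F)"
  unfolding op_space_def
proof (intro conjI ballI allI)
  assume F: "closed_csubspace F"
  show "(\<lambda>_. 0) \<in> bop E F" by (rule bopI[where K = 0]) (auto simp: closed_csubspaceD[OF F])
  fix S assume S: "S \<in> bop E F"
  obtain K where K: "0 < K" "\<And>x. x \<in> E \<Longrightarrow> norm (S x) \<le> K * norm x" using bop_bound[OF S] by blast
  show "(\<lambda>x. c *\<^sub>C S x) \<in> bop E F" for c
  proof (rule bopI)
    show "norm (c *\<^sub>C S x) \<le> cmod c * K * norm x" if "x \<in> E" for x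
      using mult_left_mono[OF K(2)[OF that], of "cmod c"] by (simp add: norm_scaleC mult.assoc)
  qed (auto simp: bopD[OF S] closed_csubspaceD[OF F] scaleC_add_right scaleC_scaleC mult.commute)
  fix T assume T: "T \<in> bop E F"
  obtain L where L: "0 < L" "\<And>x. x \<in> E \<Longrightarrow> norm (T x) \<le> L * norm x" using bop_bound[OF T] by blast
  show "(\<lambda>x. S x + T x) \<in> bop E F"
  proof (rule bopI)
    show "norm (S x + T x) \<le> (K + L) * norm x" if "x \<in> E" for x
      using norm_triangle_ineq[of "S x" "T x"] K(2)[OF that] L(2)[OF that]
      by (simp add: distrib_right)
  qed (auto simp: bopD[OF S] bopD[OF T] closed_csubspaceD[OF F] scaleC_add_right algebra_simps)
qed simp

lemma
  assumes E: "closed_csubspace E" and T: "T \<in> bop E F"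
  shows adj_in: "adj E T y \<in> E"
    and cinner_adj: "x \<in> E \<Longrightarrow> cinner (T x) y = cinner x (adj E T y)"
proof -
  obtain K where K: "\<And>x. x \<in> E \<Longrightarrow> norm (T x) \<le> K * norm x" using bop_bound[OF T] by blast
  have bound: "cmod (cinner (T x) y) \<le> (K * norm y) * norm x" if "x \<in> E" for x
  proof -
    have "cmod (cinner (T x) y) \<le> norm (T x) * norm y" by (rule norm_cinner_le)
    also have "\<dots> \<le> (K * norm x) * norm y" by (intro mult_right_mono K that) simp
    finally show ?thesis by (simp add: ac_simps)
  qed
  obtain z where z: "z \<in> E" "\<And>x. x \<in> E \<Longrightarrow> cinner (T x) y = cinner x z"
    by (rule riesz_representation[OF E, of "\<lambda>x. cinner (T x) y", OF _ _ bound])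
      (auto simp: bopD[OF T] cinner_add_left cinner_scaleC_left)
  have "adj E T y = z"
    unfolding adj_def
  proof (rule the_equality)
    fix z' assume z': "z' \<in> E \<and> (\<forall>x\<in>E. cinner (T x) y = cinner x z')"
    then show "z' = z" by (intro eq_if_cinner_eq[OF E]) (use z in auto)
  qed (use z in auto)
  with z show "adj E T y \<in> E" and "x \<in> E \<Longrightarrow> cinner (T x) y = cinner x (adj E T y)" by auto
qed

lemma adj_eqI:
  assumes "closed_csubspace E" "z \<in> E" "\<And>x. x \<in> E \<Longrightarrow> cinner (T x) y = cinner x z"
  shows "adj E T y = z"
  unfolding adj_def
proof (rule the_equality)
  fix z' assume "z' \<in> E \<and> (\<forall>x\<in>E. cinner (T x) y = cinner x z')"
  then show "z' = z" by (intro eq_if_cinner_eq[OF assms(1)]) (use assms in auto)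
qed (use assms in auto)

lemma norm_adj_le:
  assumes E: "closed_csubspace E" and T: "T \<in> bop E F" and "0 \<le> K"
    and bound: "\<And>x. x \<in> E \<Longrightarrow> norm (T x) \<le> K * norm x"
  shows "norm (adj E T y) \<le> K * norm y"
proof (cases "adj E T y = 0")
  case False
  let ?z = "adj E T y"
  have "(norm ?z)\<^sup>2 = inner (T ?z) y"
    by (simp add: power2_norm_eq_inner Re_cinner[symmetric] cinner_adj[OF E T] adj_in[OF E T])
  then have "(norm ?z)\<^sup>2 \<le> norm (T ?z) * norm y"
    by (simp add: norm_cauchy_schwarz)
  also have "\<dots> \<le> (K * norm ?z) * norm y"
    by (intro mult_right_mono bound adj_in[OF E T]) simp
  finally have "norm ?z * norm ?z \<le> norm ?z * (K * norm y)" by (simp add: power2_eq_square ac_simps)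
  then show ?thesis using False by simp
qed (simp add: \<open>0 \<le> K\<close>)

lemma adj_bop:
  assumes E: "closed_csubspace E" and T: "T \<in> bop E F"
  shows "adj E T \<in> bop F E"
proof -
  obtain K where K: "0 < K" "\<And>x. x \<in> E \<Longrightarrow> norm (T x) \<le> K * norm x" using bop_bound[OF T] by blast
  show ?thesis
  proof (rule bopI)
    show "adj E T (y + y') = adj E T y + adj E T y'" for y y'
      by (rule adj_eqI[OF E])
        (simp_all add: adj_in[OF E T] closed_csubspaceD[OF E] cinner_add_right cinner_adj[OF E T])
    show "adj E T (c *\<^sub>C y) = c *\<^sub>C adj E T y" for c y
      by (rule adj_eqI[OF E])
        (simp_all add: adj_in[OF E T] closed_csubspaceD[OF E] cinner_scaleC_right cinner_adj[OF E T])
    show "norm (adj E T y) \<le> K * norm y" for y using norm_adj_le[OF E T _ K(2)] K(1) by simp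
  qed (rule adj_in[OF E T])
qed

text \<open>The supremum is one of reals, so boundedness of the quotients has to be known first. At
  vectors of norm 0 the quotient is 0 by the convention on division.\<close>

lemma onorm_on_bound:
  assumes T: "T \<in> bop E F" and "x \<in> E"
  shows "norm (T x) \<le> onorm_on E T * norm x"
proof -
  obtain K where K: "0 < K" "\<And>x. x \<in> E \<Longrightarrow> norm (T x) \<le> K * norm x" using bop_bound[OF T] by blast
  show ?thesis
  proof (cases "norm x = 0")
    case True
    then show ?thesis using K(2)[OF \<open>x \<in> E\<close>] by simp
  next
    case False
    have "norm (T u) / norm u \<le> K" if "u \<in> E" for u
      using K(2)[OF that] K(1) by (cases "norm u = 0") (simp_all add: field_simps)
    then have "norm (T x) / norm x \<le> onorm_on E T"
      unfolding onorm_on_def using \<open>x \<in> E\<close> by (intro cSUP_upper) (auto intro!: bdd_aboveI)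
    then show ?thesis using False by (simp add: field_simps)
  qed
qed

lemma onorm_on_le:
  assumes "E \<noteq> {}" "0 \<le> K" "\<And>x. x \<in> E \<Longrightarrow> norm (T x) \<le> K * norm x"
  shows "onorm_on E T \<le> K"
  unfolding onorm_on_def
proof (rule cSUP_least[OF assms(1)])
  show "norm (T x) / norm x \<le> K" if "x \<in> E" for x
    using assms(3)[OF that] assms(2) by (cases "norm x = 0") (simp_all add: field_simps)
qed

text \<open>The quotient at the vector 0 is 0, and it belongs to the family; this covers
  \<open>E = {0}\<close> too.\<close>

lemma onorm_on_nonneg:
  assumes T: "T \<in> bop E F" and E: "closed_csubspace E"
  shows "0 \<le> onorm_on E T"
proof -
  obtain K where K: "0 < K" "\<And>x. x \<in> E \<Longrightarrow> norm (T x) \<le> K * norm x" using bop_bound[OF T] by blast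
  have "norm (T u) / norm u \<le> K" if "u \<in> E" for u
    using K(2)[OF that] K(1) by (cases "norm u = 0") (simp_all add: field_simps)
  then have "norm (T 0) / norm (0::'a) \<le> onorm_on E T"
    unfolding onorm_on_def using closed_csubspaceD(1)[OF E]
    by (intro cSUP_upper) (auto intro!: bdd_aboveI)
  then show ?thesis by simp
qed

text \<open>The equation says that \<open>x\<close> is orthogonal to \<open>adj y - z\<close>, and
  the orthogonal complement of a vector is a closed subspace. This is how identities on elementary
  tensors spread to the tensor space.\<close>

lemma cinner_eq_on_hull:
  assumes T: "T \<in> bop (closed_csubspace hull S) F"
    and eq: "\<And>x. x \<in> S \<Longrightarrow> cinner (T x) y = cinner x z"
    and x: "x \<in> closed_csubspace hull S"
  shows "cinner (T x) y = cinner x z"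
proof -
  let ?E = "closed_csubspace hull S"
  note adj = cinner_adj[OF closed_csubspace_hull T]
  have "cinner s (adj ?E T y) = cinner s z" if "s \<in> S" for s
    using eq[OF that] adj[OF hull_inc[of s S], of y] that by simp
  then have "S \<subseteq> orth_compl {adj ?E T y - z}"
    by (auto simp: orth_compl_def cinner_diff_right)
  then have "?E \<subseteq> orth_compl {adj ?E T y - z}"
    by (rule hull_minimal) (rule closed_csubspace_orth_compl)
  then show ?thesis
    using x adj[OF x, of y] by (auto simp: orth_compl_def cinner_diff_right)
qed

lemma bop_eq_on_hull:
  assumes T: "T \<in> bop (closed_csubspace hull S) F" and T': "T' \<in> bop (closed_csubspace hull S) F'"
    and eq: "\<And>x. x \<in> S \<Longrightarrow> T x = T' x" and x: "x \<in> closed_csubspace hull S"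
  shows "T x = T' x"
proof (rule eq_if_cinner_eq[OF closed_csubspace_UNIV])
  let ?E = "closed_csubspace hull S"
  fix u
  have "cinner (T x) u = cinner x (adj ?E T' u)"
  proof (rule cinner_eq_on_hull[OF T _ x])
    show "cinner (T s) u = cinner s (adj ?E T' u)" if "s \<in> S" for s
      using that eq cinner_adj[OF closed_csubspace_hull T', of s u] hull_subset[of S closed_csubspace]
      by auto
  qed
  also have "\<dots> = cinner (T' x) u" using cinner_adj[OF closed_csubspace_hull T' x] by simp
  finally show "cinner u (T x) = cinner u (T' x)" by (metis cinner_commute)
qed simp_all


section \<open>Coordinates of vectors of the Fock space\<close>

lemmas coord_simps = zero_ell2.rep_eq plus_ell2.rep_eq minus_ell2.rep_eq uminus_ell2.rep_eq
  scaleR_ell2.rep_eq scaleC_ell2.rep_eq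

lemma coord_sum: "coord (\<Sum>i\<in>A. f i) w = (\<Sum>i\<in>A. coord (f i) w)"
  by (induction A rule: infinite_finite_induct) (simp_all add: coord_simps)

lemma norm_ell2_le:
  assumes "0 \<le> c" "\<And>A. finite A \<Longrightarrow> (\<Sum>i\<in>A. (norm (coord f i))\<^sup>2) \<le> c\<^sup>2"
  shows "norm f \<le> c"
proof (rule power2_le_imp_le[OF _ assms(1)])
  show "(norm f)\<^sup>2 \<le> c\<^sup>2"
    unfolding norm_sq_ell2 using assms(2) coord_summable by (intro infsum_le_finite_sums) auto
qed

lemma ell2_exists:
  fixes g :: "'i \<Rightarrow> 'k::real_inner"
  assumes "0 \<le> c" "\<And>A. finite A \<Longrightarrow> (\<Sum>i\<in>A. (norm (g i))\<^sup>2) \<le> c\<^sup>2"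
  obtains h where "coord h = g" "norm h \<le> c"
proof -
  have "(\<lambda>i. (norm (g i))\<^sup>2) summable_on UNIV"
    using assms(2) by (intro nonneg_bdd_above_summable_on) (auto intro!: bdd_aboveI[of _ "c\<^sup>2"])
  then have "coord (Abs_ell2 g) = g" by (simp add: Abs_ell2_inverse)
  moreover from this have "norm (Abs_ell2 g) \<le> c" using assms by (intro norm_ell2_le) simp_all
  ultimately show thesis using that by blast
qed

lemma sum_norm_sq_le_scale:
  assumes "0 \<le> K" "\<And>i. norm (g i) \<le> K * norm (coord f i)" "finite A"
  shows "(\<Sum>i\<in>A. (norm (g i))\<^sup>2) \<le> (K * norm f)\<^sup>2"
proof -
  have "(\<Sum>i\<in>A. (norm (g i))\<^sup>2) \<le> (\<Sum>i\<in>A. K\<^sup>2 * (norm (coord f i))\<^sup>2)"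
    using assms(2) by (intro sum_mono) (metis norm_ge_zero power_mono power_mult_distrib)
  also have "\<dots> \<le> K\<^sup>2 * (norm f)\<^sup>2"
    unfolding sum_distrib_left[symmetric] by (intro mult_left_mono norm_sq_sum_le assms) simp
  finally show ?thesis by (simp add: power_mult_distrib)
qed

lemma norm_ell2_le_scale:
  "0 \<le> K \<Longrightarrow> (\<And>i. norm (coord g i) \<le> K * norm (coord f i)) \<Longrightarrow> norm g \<le> K * norm f"
  by (intro norm_ell2_le sum_norm_sq_le_scale) simp_all

lemma sq_summable_reindex:
  fixes f :: "'i \<Rightarrow> 'k::real_inner"
  assumes "(\<lambda>i. (norm (f i))\<^sup>2) summable_on UNIV" "inj j"
  shows "(\<lambda>i. (norm (f (j i)))\<^sup>2) summable_on UNIV"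
proof -
  have "(\<lambda>i. (norm (f i))\<^sup>2) summable_on range j"
    using assms(1) by (rule summable_on_subset_banach) simp
  then show ?thesis
    using summable_on_reindex[OF \<open>inj j\<close>, of "\<lambda>i. (norm (f i))\<^sup>2"] by (simp add: o_def)
qed

text \<open>The backward shift S_i^* \<otimes> I. For complex coordinates it is the adjoint of
  \<open>left_creation i\<close>, as \<open>cinner_left_creation\<close> shows.\<close>

lift_definition lann :: "'n \<Rightarrow> ('n, 'k::real_inner) vfock \<Rightarrow> ('n, 'k) vfock" is "\<lambda>i f w. f (i # w)"
  by (rule sq_summable_reindex) auto

text \<open>The analogue on the right, removing a whole suffix: the terms of the Fourier series of
  an intertwiner are indexed by words.\<close>

lift_definition rann :: "'n list \<Rightarrow> ('n, 'k::real_inner) vfock \<Rightarrow> ('n, 'k) vfock" is "\<lambda>u f w. f (w @ u)"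
  by (rule sq_summable_reindex) (auto simp: inj_def)

text \<open>The adjoint of \<open>\<lambda>f. tensor f k\<close>, see
  \<open>cinner_tensor_left\<close>. Slices reduce questions about tensor spaces to scalar ones
  without a basis of \<open>'k\<close>.\<close>

lift_definition slice :: "'k::chilbert_space \<Rightarrow> ('n, 'k) vfock \<Rightarrow> 'n fock" is "\<lambda>k f w. cinner (f w) k"
proof -
  fix k :: 'k and f :: "'n list \<Rightarrow> 'k"
  assume f: "(\<lambda>w. (norm (f w))\<^sup>2) summable_on UNIV"
  show "(\<lambda>w. (norm (cinner (f w) k))\<^sup>2) summable_on UNIV"
  proof (rule summable_on_comparison_test)
    show "(\<lambda>w. (norm (f w))\<^sup>2 * (norm k)\<^sup>2) summable_on UNIV"
      using f by (rule summable_on_cmult_left)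
    show "(norm (cinner (f w) k))\<^sup>2 \<le> (norm (f w))\<^sup>2 * (norm k)\<^sup>2" for w
      unfolding power_mult_distrib[symmetric] by (intro power_mono norm_cinner_le) simp
  qed simp
qed

text \<open>The operator I \<otimes> T. It is meaningful for bounded \<open>T\<close> only, since
  \<open>Abs_ell2\<close> is unspecified on families that are not square summable.\<close>

definition amplify :: "('k\<^sub>1::chilbert_space \<Rightarrow> 'k\<^sub>2::chilbert_space) \<Rightarrow> ('n, 'k\<^sub>1) vfock \<Rightarrow> ('n, 'k\<^sub>2) vfock"
  where "amplify T f = Abs_ell2 (\<lambda>w. T (coord f w))"

lemma coord_amplify:
  assumes T: "T \<in> bop UNIV UNIV"
  shows "coord (amplify T f) w = T (coord f w)"
proof -
  obtain K where K: "0 < K" "\<And>x. norm (T x) \<le> K * norm x" using bop_bound[OF T] by auto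
  obtain h where "coord h = (\<lambda>w. T (coord f w))"
    by (rule ell2_exists[of "K * norm f" "\<lambda>w. T (coord f w)"])
      (use K in \<open>auto intro!: sum_norm_sq_le_scale\<close>)
  then have "amplify T f = h" unfolding amplify_def by (metis coord_inverse)
  then show ?thesis using \<open>coord h = _\<close> by simp
qed

lemma linear_bopI:
  assumes "\<And>f g. T (f + g) = T f + T g" "\<And>c f. T (c *\<^sub>C f) = c *\<^sub>C T f" "\<And>f. norm (T f) \<le> K * norm f"
  shows "T \<in> bop UNIV UNIV"
  using assms by (intro bopI) auto

lemma amplify_bop:
  assumes T: "T \<in> bop UNIV UNIV"
  shows "amplify T \<in> bop UNIV UNIV"
proof -
  obtain K where K: "0 < K" "\<And>x. norm (T x) \<le> K * norm x" using bop_bound[OF T] by auto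
  show ?thesis
  proof (rule linear_bopI)
    show "norm (amplify T f) \<le> K * norm f" for f :: "('n, 'a) vfock"
      using K by (intro norm_ell2_le_scale) (simp_all add: coord_amplify[OF T])
  qed (rule ell2_eqI, simp add: coord_amplify[OF T] coord_simps bopD[OF T])+
qed

lemma norm_reindex_le:
  assumes "inj j" "\<And>w. coord g w = coord f (j w)"
  shows "norm g \<le> norm f"
proof (rule norm_ell2_le)
  fix A :: "'a set" assume "finite A"
  have "(\<Sum>w\<in>A. (norm (coord g w))\<^sup>2) = (\<Sum>w\<in>j ` A. (norm (coord f w))\<^sup>2)"
    using assms by (subst sum.reindex) (auto intro: inj_on_subset)
  also have "\<dots> \<le> (norm f)\<^sup>2" using \<open>finite A\<close> by (intro norm_sq_sum_le) simp
  finally show "(\<Sum>w\<in>A. (norm (coord g w))\<^sup>2) \<le> (norm f)\<^sup>2" .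
qed simp

lemma lann_add: "lann i (f + g) = lann i f + lann i g"
  by (rule ell2_eqI) (simp add: lann.rep_eq coord_simps)

lemma lann_scaleC: "lann i (c *\<^sub>C f) = c *\<^sub>C lann i f"
  by (rule ell2_eqI) (simp add: lann.rep_eq coord_simps)

lemma lann_bop: "lann i \<in> bop UNIV UNIV"
proof (rule linear_bopI)
  show "norm (lann i f) \<le> 1 * norm f" for f :: "('a, 'b) vfock"
    using norm_reindex_le[of "(#) i" "lann i f" f] by (simp add: lann.rep_eq)
qed (rule lann_add lann_scaleC)+

lemma rann_bop: "rann u \<in> bop UNIV UNIV"
proof (rule linear_bopI)
  show "norm (rann u f) \<le> 1 * norm f" for f :: "('a, 'b) vfock"
    using norm_reindex_le[of "\<lambda>w. w @ u" "rann u f" f] by (simp add: rann.rep_eq inj_def)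
qed (rule ell2_eqI, simp add: rann.rep_eq coord_simps)+

lemma norm_slice_le: "norm (slice k f) \<le> norm k * norm f"
  by (rule norm_ell2_le_scale) (simp_all add: slice.rep_eq norm_cinner_le mult.commute[of "norm k"])

lemma slice_bop: "(slice k :: ('n, 'k::chilbert_space) vfock \<Rightarrow> 'n fock) \<in> bop UNIV UNIV"
proof (rule linear_bopI)
  show "norm (slice k f) \<le> norm k * norm f" for f :: "('n, 'k) vfock" by (rule norm_slice_le)
qed (rule ell2_eqI, simp add: slice.rep_eq coord_simps cinner_add_left cinner_scaleC_left
    scaleC_complex_def)+

lemma slice_add_index: "slice (k + l) f = slice k f + slice l f"
  by (rule ell2_eqI) (simp add: slice.rep_eq coord_simps cinner_add_right)

lemma slice_scaleC_index: "slice (c *\<^sub>C k) f = cnj c *\<^sub>C slice k f"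
  by (rule ell2_eqI) (simp add: slice.rep_eq coord_simps cinner_scaleC_right scaleC_complex_def)

text \<open>Every word is empty or of the form \<open>i # w\<close> in exactly one way; in operator
  terms, I is the sum of the vacuum projection and of all S_i S_i^*.\<close>

lemma norm_sq_lann:
  fixes f :: "('n::finite, 'k::real_inner) vfock"
  shows "(norm f)\<^sup>2 = (norm (coord f []))\<^sup>2 + (\<Sum>i\<in>UNIV. (norm (lann i f))\<^sup>2)"
proof -
  let ?g = "\<lambda>w. (norm (coord f w))\<^sup>2" and ?cons = "\<lambda>(i :: 'n, w). i # w"
  have inj: "inj ?cons" by (auto simp: inj_def)
  have rng: "range ?cons = UNIV - {[]}"
    by (auto simp: image_iff) (metis list.exhaust)
  have sm: "?g summable_on A" for A
    using coord_summable by (rule summable_on_subset_banach) simp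
  have sm2: "(\<lambda>(i, w). ?g (i # w)) summable_on (UNIV \<times> UNIV)"
    using summable_on_reindex[OF inj, of ?g] sm[of "range ?cons"] by (simp add: o_def case_prod_unfold)
  have "(norm f)\<^sup>2 = infsum ?g ({[]} \<union> (UNIV - {[]}))" by (simp add: norm_sq_ell2)
  also have "\<dots> = ?g [] + infsum ?g (range ?cons)"
    unfolding rng by (subst infsum_Un_disjoint) (auto intro: sm)
  also have "infsum ?g (range ?cons) = infsum (\<lambda>(i, w). ?g (i # w)) (UNIV \<times> UNIV)"
    using infsum_reindex[OF inj, of ?g] by (simp add: o_def case_prod_unfold)
  also have "\<dots> = (\<Sum>\<^sub>\<infinity>i. \<Sum>\<^sub>\<infinity>w. ?g (i # w))"
    using infsum_Sigma'_banach[of "\<lambda>i w. ?g (i # w)" UNIV "\<lambda>_. UNIV"] sm2 by simp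
  also have "\<dots> = (\<Sum>i\<in>UNIV. (norm (lann i f))\<^sup>2)"
    by (simp add: norm_sq_ell2 lann.rep_eq)
  finally show ?thesis .
qed

text \<open>The converse of the decomposition behind \<open>norm_sq_lann\<close>: vacuum coordinate
  and backward shifts can be prescribed independently.\<close>

lemma vfock_of_lann:
  fixes g :: "'n::finite \<Rightarrow> ('n, 'k::real_inner) vfock"
  obtains h where "coord h [] = z" "\<And>i. lann i h = g i"
proof -
  define F where "F w = (case w of [] \<Rightarrow> z | i # v \<Rightarrow> coord (g i) v)" for w
  define C where "C = (norm z)\<^sup>2 + (\<Sum>i\<in>UNIV. (norm (g i))\<^sup>2)"
  have "0 \<le> C" by (auto simp: C_def intro!: add_nonneg_nonneg sum_nonneg)
  have bound: "(\<Sum>w\<in>A. (norm (F w))\<^sup>2) \<le> (sqrt C)\<^sup>2" if "finite A" for A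
  proof -
    let ?T = "tl ` A"
    \<comment> \<open>A finite set of words is enlarged to a product of letters and tails, so that
      the sum splits over the first letter.\<close>
    have "A \<subseteq> insert [] ((\<lambda>(i, v). i # v) ` (UNIV \<times> ?T))"
    proof
      fix w assume "w \<in> A"
      then show "w \<in> insert [] ((\<lambda>(i, v). i # v) ` (UNIV \<times> ?T))"
        by (cases w) (force intro!: image_eqI[of _ _ "(hd w, tl w)"])+
    qed
    then have "(\<Sum>w\<in>A. (norm (F w))\<^sup>2)
        \<le> (\<Sum>w\<in>insert [] ((\<lambda>(i, v). i # v) ` (UNIV \<times> ?T)). (norm (F w))\<^sup>2)"
      using \<open>finite A\<close> by (intro sum_mono2) auto
    also have "\<dots> = (norm z)\<^sup>2 + (\<Sum>w\<in>(\<lambda>(i, v). i # v) ` (UNIV \<times> ?T). (norm (F w))\<^sup>2)"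
      using \<open>finite A\<close> by (subst sum.insert) (auto simp: F_def)
    also have "(\<Sum>w\<in>(\<lambda>(i, v). i # v) ` (UNIV \<times> ?T). (norm (F w))\<^sup>2)
        = (\<Sum>(i, v)\<in>UNIV \<times> ?T. (norm (coord (g i) v))\<^sup>2)"
      by (subst sum.reindex) (auto simp: inj_on_def F_def case_prod_unfold)
    also have "\<dots> = (\<Sum>i\<in>UNIV. \<Sum>v\<in>?T. (norm (coord (g i) v))\<^sup>2)"
      by (simp add: sum.cartesian_product)
    also have "\<dots> \<le> (\<Sum>i\<in>UNIV. (norm (g i))\<^sup>2)"
      using \<open>finite A\<close> by (intro sum_mono norm_sq_sum_le) simp
    finally show ?thesis using \<open>0 \<le> C\<close> by (simp add: C_def)
  qed
  obtain h where "coord h = F" using ell2_exists[OF _ bound] \<open>0 \<le> C\<close> by auto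
  then have "coord h [] = z" "lann i h = g i" for i
    by (auto intro!: ell2_eqI simp: lann.rep_eq F_def \<open>coord h = F\<close>)
  then show thesis using that by blast
qed

text \<open>Pushing forward along an injection (with zeros elsewhere) and pulling back are adjoint;
  prepending and appending a letter are the two instances.\<close>

lemma cinner_reindex:
  assumes "inj j" "\<And>w. coord f (j w) = coord f' w" "\<And>v. v \<notin> range j \<Longrightarrow> coord f v = 0"
    and "\<And>w. coord g' w = coord g (j w)"
  shows "cinner f g = cinner f' g'"
proof -
  have "cinner f g = (\<Sum>\<^sub>\<infinity>v\<in>range j. cinner (coord f v) (coord g v))"
    unfolding cinner_ell2.rep_eq using assms(3) by (intro infsum_cong_neutral) auto
  also have "\<dots> = (\<Sum>\<^sub>\<infinity>w. cinner (coord f (j w)) (coord g (j w)))"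
    using infsum_reindex[OF assms(1)] by (simp add: o_def)
  finally show ?thesis by (simp add: cinner_ell2.rep_eq assms)
qed

lemma cinner_left_creation: "cinner (left_creation i f) g = cinner f (lann i g)"
proof (rule cinner_reindex[of "(#) i"])
  show "coord (left_creation i f) v = 0" if "v \<notin> range ((#) i)" for v
    using that by (cases v) (auto simp: left_creation.rep_eq)
qed (auto simp: left_creation.rep_eq lann.rep_eq)

lemma cinner_right_creation: "cinner (right_creation i f) g = cinner f (rann [i] g)"
proof (rule cinner_reindex[of "\<lambda>w. w @ [i]"])
  show "coord (right_creation i f) v = 0" if "v \<notin> range (\<lambda>w. w @ [i])" for v
    using that by (cases v rule: rev_cases) (auto simp: right_creation.rep_eq)
qed (auto simp: right_creation.rep_eq rann.rep_eq inj_def)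

lemma left_creation_bop: "left_creation i \<in> bop UNIV UNIV"
proof (rule linear_bopI)
  fix f :: "'a fock"
  have "lann i (left_creation i f) = f"
    by (rule ell2_eqI) (simp add: lann.rep_eq left_creation.rep_eq)
  then have "norm (left_creation i f) = norm f"
    by (simp add: norm_eq_sqrt_inner Re_cinner[symmetric] cinner_left_creation)
  then show "norm (left_creation i f) \<le> 1 * norm f" by simp
qed (rule ell2_eqI, simp add: left_creation.rep_eq coord_simps)+

lemma right_creation_bop: "right_creation i \<in> bop UNIV UNIV"
proof (rule linear_bopI)
  fix f :: "'a fock"
  have "rann [i] (right_creation i f) = f"
    by (rule ell2_eqI) (simp add: rann.rep_eq right_creation.rep_eq)
  then have "norm (right_creation i f) = norm f"
    by (simp add: norm_eq_sqrt_inner Re_cinner[symmetric] cinner_right_creation)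
  then show "norm (right_creation i f) \<le> 1 * norm f" by simp
qed (rule ell2_eqI, simp add: right_creation.rep_eq coord_simps)+

text \<open>Removing a prefix and removing a suffix do not interfere. All commutation between left
  and right shifts below rests on this.\<close>

lemma rann_lann: "rann u (lann i f) = lann i (rann u f)"
  by (rule ell2_eqI) (simp add: rann.rep_eq lann.rep_eq)

lemma slice_lann: "slice k (lann i f) = lann i (slice k f)"
  by (rule ell2_eqI) (simp add: slice.rep_eq lann.rep_eq)

lemma lann_tensor: "lann i (tensor f k) = tensor (lann i f) k"
  by (rule ell2_eqI) (simp add: tensor.rep_eq lann.rep_eq)

lemma lann_ket_Cons: "lann i (ket (j # w)) = (if i = j then ket w else 0)"
  by (rule ell2_eqI) (simp add: lann.rep_eq ket.rep_eq coord_simps)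

lemma lann_ket_Nil: "lann i (ket []) = 0"
  by (rule ell2_eqI) (simp add: lann.rep_eq ket.rep_eq coord_simps)

lemma tensor_zero_left [simp]: "tensor 0 k = 0"
  by (rule ell2_eqI) (simp add: tensor.rep_eq coord_simps)

lemma tensor_add_left: "tensor (f + g) k = tensor f k + tensor g k"
  by (rule ell2_eqI) (simp add: tensor.rep_eq coord_simps scaleC_add_left)

lemma tensor_scaleC_left: "tensor (c *\<^sub>C f) k = c *\<^sub>C tensor f k"
  by (rule ell2_eqI) (simp add: tensor.rep_eq coord_simps scaleC_scaleC scaleC_complex_def)

lemma norm_tensor: "norm (tensor f k) = norm f * norm k"
proof -
  have "complex_of_real ((norm (tensor f k))\<^sup>2) = complex_of_real ((norm f * norm k)\<^sup>2)"
    by (simp only: cinner_self[symmetric] cinner_tensor power_mult_distrib of_real_mult)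
  then have "(norm (tensor f k))\<^sup>2 = (norm f * norm k)\<^sup>2" by (simp only: of_real_eq_iff)
  then show ?thesis by simp
qed

lemma slice_tensor: "slice k (tensor f l) = cinner l k *\<^sub>C f"
  by (rule ell2_eqI)
    (simp add: slice.rep_eq tensor.rep_eq coord_simps cinner_scaleC_left scaleC_complex_def mult.commute)

lemma cinner_tensor_left: "cinner (tensor f k) y = cinner f (slice k y)"
  unfolding cinner_ell2.rep_eq
  by (rule infsum_cong)
    (simp add: tensor.rep_eq slice.rep_eq cinner_scaleC_left cinner_complex_def cinner_commute[symmetric])

lemma cinner_ket: "cinner f (ket w) = coord f w"
proof -
  have "cinner f (ket w) = (\<Sum>\<^sub>\<infinity>v\<in>{w}. cinner (coord f v) (coord (ket w) v))"
    unfolding cinner_ell2.rep_eq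
    by (intro infsum_cong_neutral) (auto simp: ket.rep_eq cinner_complex_def)
  then show ?thesis by (simp add: ket.rep_eq cinner_complex_def)
qed

lemma eq_zero_if_slices_zero:
  assumes "\<And>k. slice k f = 0"
  shows "f = 0"
proof (rule ell2_eqI)
  fix w
  have "cinner (coord f w) (coord f w) = coord (slice (coord f w) f) w" by (simp add: slice.rep_eq)
  then show "coord f w = coord 0 w" by (simp add: assms coord_simps)
qed

lemma closed_csubspace_tensor_space: "closed_csubspace (tensor_space N)"
  unfolding tensor_space_def by (rule closed_csubspace_hull)

lemma tensor_in_tensor_space: "f \<in> N \<Longrightarrow> tensor f k \<in> tensor_space N"
  unfolding tensor_space_def using hull_subset[of "{tensor f k | f k. f \<in> N}"] by blast

text \<open>For the direction from slices to membership, subtract the projection \<open>p\<close>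
  onto the tensor space: each slice of \<open>x - p\<close> lies in \<open>N\<close>, hence its
  tensor with \<open>k\<close> is orthogonal to \<open>x - p\<close>, hence the slice is orthogonal
  to itself.\<close>

lemma slice_in_iff:
  fixes N :: "'n fock set" and x :: "('n, 'k::chilbert_space) vfock"
  assumes N: "closed_csubspace N"
  shows "x \<in> tensor_space N \<longleftrightarrow> (\<forall>k. slice k x \<in> N)"
proof
  let ?E = "{x :: ('n, 'k) vfock. \<forall>k. slice k x \<in> N}"
  have E: "closed_csubspace ?E"
    unfolding closed_csubspace_def
  proof (intro conjI ballI allI)
    have "closed (slice k -` N :: ('n, 'k) vfock set)" for k :: 'k
    proof (rule continuous_closed_vimage)
      interpret bounded_linear "slice k :: ('n, 'k) vfock \<Rightarrow> 'n fock"
      proof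
        show "slice k (r *\<^sub>R x) = r *\<^sub>R slice k x" for r x
          by (rule ell2_eqI) (simp add: slice.rep_eq coord_simps cinner.scaleR_left)
        show "\<exists>K. \<forall>x. norm (slice k x) \<le> norm x * K"
          by (metis norm_slice_le mult.commute)
      qed (simp add: bopD[OF slice_bop])
      show "isCont (slice k) x" for x :: "('n, 'k) vfock" by (rule isCont) simp
    qed (rule closed_csubspaceD(4)[OF N])
    then have "closed (\<Inter>k. slice k -` N :: ('n, 'k) vfock set)" by blast
    moreover have "?E = (\<Inter>k. slice k -` N)" by auto
    ultimately show "closed ?E" by (simp only:)
  qed (simp_all add: bopD[OF slice_bop] bop_zero[OF slice_bop closed_csubspace_UNIV] closed_csubspaceD[OF N])
  have "{tensor f k | f k. f \<in> N} \<subseteq> ?E"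
    by (auto simp: slice_tensor closed_csubspaceD[OF N])
  then have sub: "tensor_space N \<subseteq> ?E" unfolding tensor_space_def by (rule hull_minimal) (rule E)
  show "\<forall>k. slice k x \<in> N" if "x \<in> tensor_space N" using that sub by blast
  assume x: "\<forall>k. slice k x \<in> N"
  define p where "p = proj (tensor_space N) x"
  have p: "p \<in> tensor_space N" by (simp add: p_def proj_in closed_csubspace_tensor_space)
  have orth: "cinner t p = cinner t x" if "t \<in> tensor_space N" for t
    unfolding p_def by (rule cinner_proj_right[OF closed_csubspace_tensor_space that])
  have "slice k (x - p) = 0" for k
  proof -
    have mem: "slice k (x - p) \<in> N"
      using x p sub bop_diff[OF slice_bop closed_csubspace_UNIV, of x p] closed_csubspace_diff[OF N]
      by auto
    have "cinner (slice k (x - p)) (slice k (x - p)) = cinner (tensor (slice k (x - p)) k) (x - p)"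
      by (simp add: cinner_tensor_left)
    also have "\<dots> = 0"
      by (simp only: cinner_diff_right orth[OF tensor_in_tensor_space[OF mem]] diff_self)
    finally show ?thesis by simp
  qed
  then have "x = p" using eq_zero_if_slices_zero[of "x - p"] by simp
  with p show "x \<in> tensor_space N" by simp
qed

lemma closed_csubspace_UNIV_if_ket_tensors:
  fixes E :: "('n, 'k::chilbert_space) vfock set"
  assumes "closed_csubspace E" "\<And>w k. tensor (ket w) k \<in> E"
  shows "E = UNIV"
proof (rule closed_csubspace_eq_UNIV[OF assms(1)])
  fix x assume "x \<in> orth_compl E"
  then have "cinner x (tensor (ket w) k) = 0" for w k using assms(2) by (auto simp: orth_compl_def)
  then have "cinner (ket w) (slice k x) = 0" for w k
    by (metis cinner_tensor_left cinner_eq_zero_commute)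
  then have "coord (slice k x) w = 0" for w k
    by (metis cinner_eq_zero_commute cinner_ket)
  then have "slice k x = 0" for k by (intro ell2_eqI) (simp add: coord_simps)
  then show "x = 0" by (rule eq_zero_if_slices_zero)
qed


section \<open>Operator topologies\<close>

lemma continuous_map_wot:
  assumes "x \<in> E" "y \<in> F"
  shows "continuous_map (wot E F) euclidean (\<lambda>T. cinner (T x) y)"
proof -
  have "continuous_map (product_topology (\<lambda>_. euclidean) (E \<times> F)) euclidean (\<lambda>h :: _ \<Rightarrow> complex. h (x, y))"
    using assms by (intro continuous_map_product_projection) simp
  then have "continuous_map (wot E F) euclidean
      ((\<lambda>h. h (x, y)) \<circ> (\<lambda>T. \<lambda>(x, y)\<in>E \<times> F. cinner (T x) y))"
    unfolding wot_def by (rule continuous_map_pullback)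
  then show ?thesis using assms by (simp add: o_def)
qed

lemma topspace_wot [simp]: "topspace (wot E F) = bop E F"
  by (auto simp: wot_def topspace_pullback_topology)

text \<open>Commutation relations are brought into this form by moving the outer operator to the
  other side of the inner product. Only continuity of matrix coefficients enters, so the weak
  operator and the weak-star topology are treated together.\<close>

lemma closedin_equations:
  assumes cont: "\<And>x y. x \<in> E \<Longrightarrow> y \<in> F \<Longrightarrow> continuous_map X euclidean (\<lambda>T. cinner (T x) y)"
    and top: "topspace X = bop E F"
    and R: "\<And>x y x' y'. (x, y, x', y') \<in> R \<Longrightarrow> x \<in> E \<and> y \<in> F \<and> x' \<in> E \<and> y' \<in> F"
  shows "closedin X {T \<in> bop E F. \<forall>(x, y, x', y')\<in>R. cinner (T x) y = cinner (T x') y'}"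
proof -
  have *: "closedin X {T \<in> topspace X. cinner (T x) y = cinner (T x') y'}"
    if "(x, y, x', y') \<in> R" for x y x' y'
    using R[OF that] by (intro closedin_continuous_maps_eq[of euclidean] cont) auto
  have "closedin X (\<Inter>(insert (topspace X)
      ((\<lambda>(x, y, x', y'). {T \<in> topspace X. cinner (T x) y = cinner (T x') y'}) ` R)))"
    by (intro closedin_Inter) (use * in \<open>auto simp del: top\<close>)
  then show ?thesis
    by (rule back_subst[of "closedin X"]) (auto simp: top)
qed

lemmas closedin_wot_equations = closedin_equations[OF continuous_map_wot topspace_wot]

lemma limit_in_wot_closed:
  assumes V: "closedin (wot E F) V" and "\<And>m :: nat. T m \<in> V" "G \<in> bop E F"
    and lim: "\<And>x y. x \<in> E \<Longrightarrow> y \<in> F \<Longrightarrow> (\<lambda>m. cinner (T m x) y) \<longlonglongrightarrow> cinner (G x) y"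
  shows "G \<in> V"
proof (rule limitin_closedin[OF _ V])
  let ?\<Phi> = "\<lambda>T. \<lambda>(x, y)\<in>E \<times> F. cinner (T x) y"
  have T: "T m \<in> bop E F" for m using closedin_subset[OF V] assms(2) by auto
  have "limitin (product_topology (\<lambda>_. euclidean) (E \<times> F)) (\<lambda>m. ?\<Phi> (T m)) (?\<Phi> G) sequentially"
    using lim by (auto simp: limitin_componentwise)
  then have ev: "\<forall>\<^sub>F m in sequentially. ?\<Phi> (T m) \<in> U"
    if "openin (product_topology (\<lambda>_. euclidean) (E \<times> F)) U" "?\<Phi> G \<in> U" for U
    using that unfolding limitin_def by blast
  show "limitin (wot E F) T G sequentially"
    unfolding limitin_def
  proof (intro conjI allI impI)
    fix U assume U: "openin (wot E F) U \<and> G \<in> U"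
    then obtain U' where U': "openin (product_topology (\<lambda>_. euclidean) (E \<times> F)) U'"
      "U = ?\<Phi> -` U' \<inter> bop E F"
      unfolding wot_def openin_pullback_topology by blast
    then show "\<forall>\<^sub>F m in sequentially. T m \<in> U"
      using ev[of U'] U T by simp
  qed (use assms in simp)
qed (use assms in auto)

lemma topspace_weak_star [simp]: "topspace (weak_star E F) = bop E F"
  by (auto simp: weak_star_def topspace_pullback_topology)

text \<open>A matrix coefficient is the functional of the sequences x, 0, 0, ... and y, 0, 0, ...;
  this is why 0 must belong to \<open>E\<close> and \<open>F\<close>.\<close>

lemma continuous_map_weak_star:
  assumes "x \<in> E" "y \<in> F" "0 \<in> E" "0 \<in> F"
  shows "continuous_map (weak_star E F) euclidean (\<lambda>T. cinner (T x) y)"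
proof -
  define xs where "xs k = (if k = 0 then x else 0)" for k :: nat
  define ys where "ys k = (if k = 0 then y else 0)" for k :: nat
  let ?I = "sq_summable_seqs E \<times> sq_summable_seqs F"
  have "summable (\<lambda>k. (norm (xs k))\<^sup>2)" "summable (\<lambda>k. (norm (ys k))\<^sup>2)"
    by (rule summable_finite[of "{0}"]; simp add: xs_def ys_def)+
  then have I: "(xs, ys) \<in> ?I" using assms by (simp add: sq_summable_seqs_def xs_def ys_def)
  then have "continuous_map (product_topology (\<lambda>_. euclidean) ?I) euclidean (\<lambda>h :: _ \<Rightarrow> complex. h (xs, ys))"
    by (intro continuous_map_product_projection) simp
  then have "continuous_map (weak_star E F) euclidean
      ((\<lambda>h. h (xs, ys)) \<circ> (\<lambda>T. \<lambda>(x, y)\<in>?I. \<Sum>k. cinner (T (x k)) (y k)))"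
    unfolding weak_star_def by (rule continuous_map_pullback)
  moreover have "(\<Sum>k. cinner (T (xs k)) (ys k)) = cinner (T x) y" for T
    by (subst suminf_finite[of "{0}"]) (simp_all add: xs_def ys_def)
  ultimately show ?thesis using I by (simp add: o_def)
qed

lemma closedin_weak_star_equations:
  "0 \<in> E \<Longrightarrow> 0 \<in> F \<Longrightarrow>
    (\<And>x y x' y'. (x, y, x', y') \<in> R \<Longrightarrow> x \<in> E \<and> y \<in> F \<and> x' \<in> E \<and> y' \<in> F) \<Longrightarrow>
    closedin (weak_star E F) {T \<in> bop E F. \<forall>(x, y, x', y')\<in>R. cinner (T x) y = cinner (T x') y'}"
  by (rule closedin_equations[OF continuous_map_weak_star topspace_weak_star])


section \<open>Ideals of the Toeplitz algebra and constrained shifts\<close>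

lemma left_creation_in_toeplitz: "left_creation i \<in> toeplitz_algebra"
  unfolding toeplitz_algebra_def by (rule hull_inc) simp

text \<open>The commutant of \<open>C\<close> is a unital algebra containing the generators. Writing
  \<open>C (T f)\<close> weakly, with the adjoint of \<open>C\<close> on the right, shows that it is
  closed, so it contains the hull.\<close>

lemma toeplitz_commutes:
  fixes C :: "'n fock \<Rightarrow> 'n fock"
  assumes C: "C \<in> bop UNIV UNIV" and comm: "\<And>i f. C (left_creation i f) = left_creation i (C f)"
    and T: "T \<in> toeplitz_algebra"
  shows "C (T f) = T (C f)"
proof -
  let ?A = "{T \<in> bop UNIV UNIV. \<forall>f. T (C f) = C (T f)}"
  have "closedin (wot UNIV UNIV) ?A"
  proof -
    have "(\<forall>f. T (C f) = C (T f)) \<longleftrightarrow> (\<forall>f g. cinner (T (C f)) g = cinner (T f) (adj UNIV C g))" for T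
      using cinner_adj[OF closed_csubspace_UNIV C] eq_if_cinner_eq[OF closed_csubspace_UNIV]
      by (metis UNIV_I cinner_commute)
    then have "?A = {T \<in> bop UNIV UNIV. \<forall>(x, y, x', y')\<in>{(C f, g, f, adj UNIV C g) | f g. True}.
        cinner (T x) y = cinner (T x') y'}"
      by auto
    moreover have "closedin (wot UNIV UNIV) \<dots>" by (rule closedin_wot_equations) simp_all
    ultimately show ?thesis by (simp only:)
  qed
  moreover have "unital_op_algebra UNIV ?A"
    using op_space_bop[OF closed_csubspace_UNIV, of UNIV]
    by (auto simp: unital_op_algebra_def op_space_def bopD[OF C] bop_zero[OF C closed_csubspace_UNIV]
        bop_id bop_comp)
  moreover have "range left_creation \<subseteq> ?A"
    using left_creation_bop comm by auto
  ultimately have "toeplitz_algebra \<subseteq> ?A"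
    unfolding toeplitz_algebra_def by (intro hull_minimal) auto
  then show ?thesis using T by auto
qed

locale toeplitz_ideal =
  fixes J :: "('n::finite fock \<Rightarrow> 'n fock) set"
  assumes ideal: "wot_closed_ideal J"
begin

abbreviation "H \<equiv> tensor_space (\<N> J)"

lemma N_closed: "closed_csubspace (\<N> J)"
  unfolding constrained_space_def by (rule closed_csubspace_orth_compl)

lemma H_closed: "closed_csubspace H"
  by (rule closed_csubspace_tensor_space)

lemma in_N_iff: "f \<in> \<N> J \<longleftrightarrow> (\<forall>T\<in>J. \<forall>h. cinner f (T h) = 0)"
  unfolding constrained_space_def orth_compl_hull by (auto simp: orth_compl_def)

lemma in_H_iff: "x \<in> H \<longleftrightarrow> (\<forall>k. slice k x \<in> \<N> J)"
  by (rule slice_in_iff[OF N_closed])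

text \<open>\<open>J\<close> absorbs multiplication by \<open>left_creation i\<close> from the left,
  so the range of \<open>J\<close> is invariant under it and the complement is invariant under the
  adjoint.\<close>

lemma lann_N: "f \<in> \<N> J \<Longrightarrow> lann i f \<in> \<N> J"
  unfolding in_N_iff
proof (intro ballI allI)
  fix T h assume f: "\<forall>T\<in>J. \<forall>h. cinner f (T h) = 0" and "T \<in> J"
  have "\<forall>A\<in>toeplitz_algebra. \<forall>T\<in>J. A \<circ> T \<in> J \<and> T \<circ> A \<in> J"
    using ideal by (simp add: wot_closed_ideal_def)
  from bspec[OF bspec[OF this left_creation_in_toeplitz[of i]] \<open>T \<in> J\<close>]
  have "left_creation i \<circ> T \<in> J" by simp
  with f have "cinner (left_creation i (T h)) f = 0"
    by (metis cinner_eq_zero_commute comp_apply)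
  then show "cinner (lann i f) (T h) = 0"
    by (metis cinner_eq_zero_commute cinner_left_creation)
qed

text \<open>The adjoint of \<open>D\<close> commutes with the \<open>S\<^sub>i\<close>, hence with \<open>J\<close>, so it leaves the range of \<open>J\<close> invariant.\<close>

lemma lann_commutant_N:
  assumes D: "D \<in> bop UNIV UNIV" and comm: "\<And>i f. D (lann i f) = lann i (D f)" and f: "f \<in> \<N> J"
  shows "D f \<in> \<N> J"
  unfolding in_N_iff
proof (intro ballI allI)
  let ?C = "adj UNIV D"
  note adj = cinner_adj[OF closed_csubspace_UNIV D]
  have C: "?C \<in> bop UNIV UNIV" by (rule adj_bop[OF closed_csubspace_UNIV D])
  have C_comm: "?C (left_creation i h) = left_creation i (?C h)" for i h
  proof (rule eq_if_cinner_eq[OF closed_csubspace_UNIV])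
    fix u
    have "cinner u (?C (left_creation i h)) = cinner (D u) (left_creation i h)" by (simp add: adj)
    also have "\<dots> = cinner (lann i (D u)) h" by (metis cinner_commute cinner_left_creation)
    also have "\<dots> = cinner (lann i u) (?C h)" by (simp add: comm[symmetric] adj)
    also have "\<dots> = cinner u (left_creation i (?C h))" by (metis cinner_commute cinner_left_creation)
    finally show "cinner u (?C (left_creation i h)) = cinner u (left_creation i (?C h))" .
  qed simp_all
  fix T h assume "T \<in> J"
  then have "T \<in> toeplitz_algebra" using ideal by (auto simp: wot_closed_ideal_def)
  then have "cinner (D f) (T h) = cinner f (T (?C h))"
    using toeplitz_commutes[OF C C_comm] by (simp add: adj)
  then show "cinner (D f) (T h) = 0" using f \<open>T \<in> J\<close> by (simp add: in_N_iff)
qed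

lemma rann_N: "f \<in> \<N> J \<Longrightarrow> rann u f \<in> \<N> J"
  by (rule lann_commutant_N[OF rann_bop rann_lann])

lemma lann_H: "x \<in> H \<Longrightarrow> lann i x \<in> H"
  by (simp add: in_H_iff slice_lann lann_N)

lemma shift_B_bop: "shift_B J i \<in> bop (\<N> J) (\<N> J)"
proof (rule bop_subset)
  show "shift_B J i \<in> bop UNIV (\<N> J)"
    using bop_comp[OF proj_bop[OF N_closed] left_creation_bop] by (simp add: shift_B_def o_def)
qed (simp_all add: shift_B_def proj_in[OF N_closed])

lemma shift_W_bop: "shift_W J i \<in> bop (\<N> J) (\<N> J)"
proof (rule bop_subset)
  show "shift_W J i \<in> bop UNIV (\<N> J)"
    using bop_comp[OF proj_bop[OF N_closed] right_creation_bop] by (simp add: shift_W_def o_def)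
qed (simp_all add: shift_W_def proj_in[OF N_closed])

lemma cinner_shift_B: "g \<in> \<N> J \<Longrightarrow> cinner (shift_B J i f) g = cinner f (lann i g)"
  by (simp add: shift_B_def cinner_proj[OF N_closed] cinner_left_creation)

lemma cinner_shift_W: "g \<in> \<N> J \<Longrightarrow> cinner (shift_W J i f) g = cinner f (rann [i] g)"
  by (simp add: shift_W_def cinner_proj[OF N_closed] cinner_right_creation)

text \<open>The hull argument again, for the commutant of the \<open>shift_B J i\<close> in the
  weak-star topology. The generators belong to it because on \<open>\<N> J\<close> the adjoints
  \<open>rann [j]\<close> and \<open>lann i\<close> commute and stay inside.\<close>

lemma algebra_W_commutes:
  assumes "A \<in> algebra_W J"
  shows "A \<in> bop (\<N> J) (\<N> J)" and "f \<in> \<N> J \<Longrightarrow> A (shift_B J i f) = shift_B J i (A f)"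
proof -
  let ?A = "{A \<in> bop (\<N> J) (\<N> J). \<forall>i. \<forall>f\<in>\<N> J. A (shift_B J i f) = shift_B J i (A f)}"
  have "closedin (weak_star (\<N> J) (\<N> J)) ?A"
  proof -
    have "A (shift_B J i f) = shift_B J i (A f)
        \<longleftrightarrow> (\<forall>g\<in>\<N> J. cinner (A (shift_B J i f)) g = cinner (A f) (lann i g))"
      if A: "A \<in> bop (\<N> J) (\<N> J)" and f: "f \<in> \<N> J" for A i f
    proof
      assume "\<forall>g\<in>\<N> J. cinner (A (shift_B J i f)) g = cinner (A f) (lann i g)"
      then have "cinner u (A (shift_B J i f)) = cinner u (shift_B J i (A f))" if "u \<in> \<N> J" for u
        using that cinner_shift_B by (metis cinner_commute)
      then show "A (shift_B J i f) = shift_B J i (A f)"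
        by (intro eq_if_cinner_eq[OF N_closed]) (auto intro!: bopD(1)[OF A] bopD(1)[OF shift_B_bop] f)
    qed (simp add: cinner_shift_B)
    then have "?A = {T \<in> bop (\<N> J) (\<N> J). \<forall>(x, y, x', y')\<in>
          {(shift_B J i f, g, f, lann i g) | i f g. f \<in> \<N> J \<and> g \<in> \<N> J}.
        cinner (T x) y = cinner (T x') y'}"
      by fastforce
    moreover have "closedin (weak_star (\<N> J) (\<N> J)) \<dots>"
      by (rule closedin_weak_star_equations)
        (auto intro: bopD(1)[OF shift_B_bop] lann_N closed_csubspaceD[OF N_closed])
    ultimately show ?thesis by (simp only:)
  qed
  moreover have "unital_op_algebra (\<N> J) ?A"
    using op_space_bop[OF N_closed, of "\<N> J"]
    by (auto simp: unital_op_algebra_def op_space_def bopD[OF shift_B_bop]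
        bop_zero[OF shift_B_bop N_closed] bop_id bop_comp bopD(1))
  moreover have "range (shift_W J) \<subseteq> ?A"
  proof clarsimp
    fix j
    have "shift_W J j (shift_B J i f) = shift_B J i (shift_W J j f)" if f: "f \<in> \<N> J" for i f
    proof (rule eq_if_cinner_eq[OF N_closed])
      fix u assume u: "u \<in> \<N> J"
      have "cinner (shift_W J j (shift_B J i f)) u = cinner (shift_B J i (shift_W J j f)) u"
        using u by (simp add: cinner_shift_B cinner_shift_W lann_N rann_N rann_lann)
      then show "cinner u (shift_W J j (shift_B J i f)) = cinner u (shift_B J i (shift_W J j f))"
        by (metis cinner_commute)
    qed (auto intro!: bopD(1)[OF shift_B_bop] bopD(1)[OF shift_W_bop] f)
    then show "shift_W J j \<in> bop (\<N> J) (\<N> J) \<and>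
        (\<forall>i. \<forall>f\<in>\<N> J. shift_W J j (shift_B J i f) = shift_B J i (shift_W J j f))"
      using shift_W_bop by blast
  qed
  ultimately have "algebra_W J \<subseteq> ?A"
    unfolding algebra_W_def by (intro hull_minimal) auto
  then show "A \<in> bop (\<N> J) (\<N> J)" and "f \<in> \<N> J \<Longrightarrow> A (shift_B J i f) = shift_B J i (A f)"
    using assms by auto
qed

end


section \<open>Tensor products of operators\<close>

lemma
  fixes B :: "'a::chilbert_space set"
  assumes "finite B" and orth: "\<And>b c. b \<in> B \<Longrightarrow> c \<in> B \<Longrightarrow> cinner b c = (if b = c then 1 else 0)"
  shows norm_sq_orthonormal_sum: "(norm (\<Sum>b\<in>B. cinner x b *\<^sub>C b))\<^sup>2 = (\<Sum>b\<in>B. (cmod (cinner x b))\<^sup>2)"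
    and bessel_inequality: "(\<Sum>b\<in>B. (cmod (cinner x b))\<^sup>2) \<le> (norm x)\<^sup>2"
proof -
  define s where "s = (\<Sum>b\<in>B. cinner x b *\<^sub>C b)"
  have sb: "cinner s b = cinner x b" if "b \<in> B" for b
  proof -
    have "cinner s b = (\<Sum>c\<in>B. if c = b then cinner x c else 0)"
      unfolding s_def cinner_sum_left cinner_scaleC_left using that by (intro sum.cong) (auto simp: orth)
    then show ?thesis using that \<open>finite B\<close> by simp
  qed
  have xs: "cinner y s = (\<Sum>b\<in>B. cinner y b * cnj (cinner x b))" for y
    unfolding s_def cinner_sum_right cinner_scaleC_right by (simp add: mult.commute)
  have "cinner x s = complex_of_real (\<Sum>b\<in>B. (cmod (cinner x b))\<^sup>2)"
    unfolding xs by (simp only: of_real_sum complex_norm_square)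
  moreover have "cinner s s = cinner x s"
    unfolding xs by (intro sum.cong) (simp_all add: sb)
  ultimately have eq: "(norm s)\<^sup>2 = (\<Sum>b\<in>B. (cmod (cinner x b))\<^sup>2)" "(norm s)\<^sup>2 = inner x s"
    by (simp_all only: power2_norm_eq_inner Re_cinner[symmetric] Re_complex_of_real)
  then show "(norm (\<Sum>b\<in>B. cinner x b *\<^sub>C b))\<^sup>2 = (\<Sum>b\<in>B. (cmod (cinner x b))\<^sup>2)" by (simp add: s_def)
  have "norm s * norm s \<le> norm x * norm s"
    using norm_cauchy_schwarz[of x s] eq(2) by (simp add: power2_eq_square)
  then have "norm s \<le> norm x" by (cases "norm s = 0") simp_all
  then show "(\<Sum>b\<in>B. (cmod (cinner x b))\<^sup>2) \<le> (norm x)\<^sup>2"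
    unfolding eq(1)[symmetric] by (intro power_mono) simp_all
qed

text \<open>Gram-Schmidt: the residual \<open>r\<close> of each new vector is normalized and added
  unless it vanishes. Finite systems suffice for norm estimates and avoid orthonormal bases of a
  possibly non-separable \<open>'k\<close>.\<close>

lemma finite_orthonormal_set:
  fixes S :: "'a::chilbert_space set"
  assumes "finite S"
  obtains B where "finite B" "\<And>b c. b \<in> B \<Longrightarrow> c \<in> B \<Longrightarrow> cinner b c = (if b = c then 1 else 0)"
    "\<And>x. x \<in> S \<Longrightarrow> x = (\<Sum>b\<in>B. cinner x b *\<^sub>C b)"
proof -
  have "\<exists>B. finite B \<and> (\<forall>b\<in>B. \<forall>c\<in>B. cinner b c = (if b = c then 1 else 0)) \<and>
      (\<forall>x\<in>S. x = (\<Sum>b\<in>B. cinner x b *\<^sub>C b))"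
    using assms
  proof (induction S)
    case empty
    then show ?case by (intro exI[of _ "{}"]) simp
  next
    case (insert x S)
    then obtain B where B: "finite B" "\<And>b c. b \<in> B \<Longrightarrow> c \<in> B \<Longrightarrow> cinner b c = (if b = c then 1 else 0)"
      and span: "\<And>y. y \<in> S \<Longrightarrow> y = (\<Sum>b\<in>B. cinner y b *\<^sub>C b)" by blast
    define r where "r = x - (\<Sum>b\<in>B. cinner x b *\<^sub>C b)"
    have rB: "cinner r b = 0" if "b \<in> B" for b
    proof -
      have "cinner (\<Sum>c\<in>B. cinner x c *\<^sub>C c) b = (\<Sum>c\<in>B. if c = b then cinner x c else 0)"
        unfolding cinner_sum_left cinner_scaleC_left using that by (intro sum.cong) (auto simp: B(2))
      then show ?thesis using that \<open>finite B\<close> by (simp add: r_def cinner_diff_left)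
    qed
    show ?case
    proof (cases "r = 0")
      case True
      then show ?thesis using B span by (intro exI[of _ B]) (auto simp: r_def)
    next
      case False
      define u where "u = complex_of_real (inverse (norm r)) *\<^sub>C r"
      have ub: "cinner u b = 0" "cinner b u = 0" if "b \<in> B" for b
        using rB[OF that] cinner_eq_zero_commute[of b u] by (simp_all add: u_def cinner_scaleC_left)
      have uu: "cinner u u = 1"
        using False
        by (simp add: u_def cinner_scaleC_left cinner_scaleC_right cinner_self[of r] power2_eq_square field_simps)
      then have "u \<notin> B" using ub by auto
      have sum_B: "cinner (\<Sum>b\<in>B. f b *\<^sub>C b) u = 0" for f
        unfolding cinner_sum_left cinner_scaleC_left by (simp add: ub)
      have "cinner y u = 0" if "y \<in> S" for y
        using span[OF that] sum_B by metis
      then have "y = (\<Sum>b\<in>insert u B. cinner y b *\<^sub>C b)" if "y \<in> S" for y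
        using span[OF that] that \<open>u \<notin> B\<close> \<open>finite B\<close> by simp
      moreover have "x = (\<Sum>b\<in>insert u B. cinner x b *\<^sub>C b)"
      proof -
        have x: "x = r + (\<Sum>b\<in>B. cinner x b *\<^sub>C b)" by (simp add: r_def)
        have "cinner x u = cinner r u" using x sum_B by (metis cinner_add_left add.right_neutral)
        also have "\<dots> = complex_of_real (norm r)"
          using False by (simp add: u_def cinner_scaleC_right cinner_self power2_eq_square)
        finally have "cinner x u *\<^sub>C u = r"
          using False by (simp add: u_def scaleC_scaleC)
        then show ?thesis using x \<open>u \<notin> B\<close> \<open>finite B\<close> by simp
      qed
      moreover have "cinner b c = (if b = c then 1 else 0)" if "b \<in> insert u B" "c \<in> insert u B" for b c
        using that B(2) ub uu \<open>u \<notin> B\<close> by auto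
      ultimately show ?thesis
        using B(1) by (intro exI[of _ "insert u B"]) simp
    qed
  qed
  then show thesis using that by blast
qed

lemma has_sum_finite_sum:
  fixes f :: "'b \<Rightarrow> 'a \<Rightarrow> real"
  assumes "finite B" "\<And>b. b \<in> B \<Longrightarrow> (f b has_sum s b) A"
  shows "((\<lambda>x. \<Sum>b\<in>B. f b x) has_sum (\<Sum>b\<in>B. s b)) A"
  using assms by (induction B) (simp_all add: has_sum_add)

text \<open>Bessel's inequality at each word, summed over all words.\<close>

lemma sum_norm_sq_slices_le:
  fixes x :: "('n, 'k::chilbert_space) vfock"
  assumes "finite B" and orth: "\<And>b c. b \<in> B \<Longrightarrow> c \<in> B \<Longrightarrow> cinner b c = (if b = c then 1 else 0)"
  shows "(\<Sum>b\<in>B. (norm (slice b x))\<^sup>2) \<le> (norm x)\<^sup>2"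
proof -
  let ?g = "\<lambda>b w. (cmod (cinner (coord x w) b))\<^sup>2"
  have "(?g b has_sum (norm (slice b x))\<^sup>2) UNIV" for b
    using has_sum_infsum[OF coord_summable[of "slice b x"]] by (simp add: slice.rep_eq norm_sq_ell2)
  then have "((\<lambda>w. \<Sum>b\<in>B. ?g b w) has_sum (\<Sum>b\<in>B. (norm (slice b x))\<^sup>2)) UNIV"
    by (intro has_sum_finite_sum assms)
  moreover have "((\<lambda>w. (norm (coord x w))\<^sup>2) has_sum (norm x)\<^sup>2) UNIV"
    unfolding norm_sq_ell2 by (rule has_sum_infsum[OF coord_summable])
  ultimately show ?thesis
    by (rule has_sum_mono) (rule bessel_inequality[OF assms])
qed

lemma eq_if_slices_eq:
  fixes x y :: "('n, 'k::chilbert_space) vfock"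
  assumes "\<And>k. slice k x = slice k y"
  shows "x = y"
proof -
  have "slice k (x - y) = 0" for k
    using bop_diff[OF slice_bop closed_csubspace_UNIV, of x y k] assms by simp
  then show ?thesis using eq_zero_if_slices_zero[of "x - y"] by simp
qed

lemma tensor_id_exists:
  fixes N :: "'n fock set"
  assumes N: "closed_csubspace N" and A: "A \<in> bop N N"
  obtains M :: "('n, 'k::chilbert_space) vfock \<Rightarrow> ('n, 'k) vfock"
  where "M \<in> bop (tensor_space N) (tensor_space N)"
    "\<And>x k. x \<in> tensor_space N \<Longrightarrow> slice k (M x) = A (slice k x)"
proof -
  obtain K where K: "0 < K" "\<And>f. f \<in> N \<Longrightarrow> norm (A f) \<le> K * norm f" using bop_bound[OF A] by blast
  have "\<exists>h. (\<forall>k. slice k h = A (slice k x)) \<and> norm h \<le> K * norm x"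
    if x: "x \<in> tensor_space N" for x :: "('n, 'k) vfock"
  proof -
    have sl: "slice k x \<in> N" for k using x slice_in_iff[OF N] by blast
    have "\<exists>y. \<forall>k. cinner y k = coord (A (slice k x)) v" for v
    proof -
      \<comment> \<open>Slices are conjugate linear in \<open>k\<close>; the conjugation makes the
        functional linear.\<close>
      obtain y :: 'k where "\<And>k. cnj (coord (A (slice k x)) v) = cinner k y"
      proof (rule riesz_representation[OF closed_csubspace_UNIV, of "\<lambda>k. cnj (coord (A (slice k x)) v)"])
        show "cmod (cnj (coord (A (slice k x)) v)) \<le> (K * norm x) * norm k" for k
        proof -
          have "cmod (cnj (coord (A (slice k x)) v)) \<le> norm (A (slice k x))"
            using norm_coord_le[of "A (slice k x)" v] by simp
          also have "\<dots> \<le> K * norm (slice k x)" by (rule K(2)[OF sl])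
          also have "\<dots> \<le> K * (norm k * norm x)"
            using K(1) by (intro mult_left_mono norm_slice_le) simp
          finally show ?thesis by (simp add: ac_simps)
        qed
      qed (auto simp: slice_add_index slice_scaleC_index bopD[OF A] sl coord_simps scaleC_complex_def
          closed_csubspaceD[OF N])
      then have "cinner y k = coord (A (slice k x)) v" for k
        by (metis cinner_commute complex_cnj_cnj)
      then show ?thesis by blast
    qed
    then obtain y where y: "\<And>v k. cinner (y v) k = coord (A (slice k x)) v" by metis
    have "(\<Sum>v\<in>F. (norm (y v))\<^sup>2) \<le> (K * norm x)\<^sup>2" if "finite F" for F
    proof -
      obtain B where B: "finite B" "\<And>b c. b \<in> B \<Longrightarrow> c \<in> B \<Longrightarrow> cinner b c = (if b = c then 1 else 0)"
        and span: "\<And>z. z \<in> y ` F \<Longrightarrow> z = (\<Sum>b\<in>B. cinner z b *\<^sub>C b)"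
        using finite_orthonormal_set[of "y ` F"] \<open>finite F\<close> by auto
      have "(norm (y v))\<^sup>2 = (\<Sum>b\<in>B. (cmod (coord (A (slice b x)) v))\<^sup>2)" if "v \<in> F" for v
        using norm_sq_orthonormal_sum[OF B, of "y v"] span[of "y v"] that by (simp add: y)
      then have "(\<Sum>v\<in>F. (norm (y v))\<^sup>2) = (\<Sum>b\<in>B. \<Sum>v\<in>F. (cmod (coord (A (slice b x)) v))\<^sup>2)"
        by (simp add: sum.swap[of _ B])
      also have "\<dots> \<le> (\<Sum>b\<in>B. (norm (A (slice b x)))\<^sup>2)"
        by (intro sum_mono norm_sq_sum_le \<open>finite F\<close>)
      also have "\<dots> \<le> (\<Sum>b\<in>B. K\<^sup>2 * (norm (slice b x))\<^sup>2)"
        unfolding power_mult_distrib[symmetric] by (intro sum_mono power_mono K sl) simp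
      also have "\<dots> \<le> K\<^sup>2 * (norm x)\<^sup>2"
        unfolding sum_distrib_left[symmetric] by (intro mult_left_mono sum_norm_sq_slices_le B) simp_all
      finally show ?thesis by (simp add: power_mult_distrib)
    qed
    then obtain h where h: "coord h = y" "norm h \<le> K * norm x"
      using ell2_exists[of "K * norm x" y] K(1) by auto
    then have "slice k h = A (slice k x)" for k
      by (intro ell2_eqI) (simp add: slice.rep_eq y)
    with h show ?thesis by blast
  qed
  then obtain M :: "('n, 'k) vfock \<Rightarrow> ('n, 'k) vfock"
    where M: "\<And>x k. x \<in> tensor_space N \<Longrightarrow> slice k (M x) = A (slice k x)"
    "\<And>x. x \<in> tensor_space N \<Longrightarrow> norm (M x) \<le> K * norm x" by metis
  have sl: "slice k x \<in> N" if "x \<in> tensor_space N" for x :: "('n, 'k) vfock" and k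
    using that slice_in_iff[OF N] by blast
  note closed = closed_csubspaceD[OF closed_csubspace_tensor_space]
  have "M \<in> bop (tensor_space N) (tensor_space N)"
  proof (rule bopI[OF _ _ _ M(2)])
    show "M x \<in> tensor_space N" if "x \<in> tensor_space N" for x
      using that by (simp add: slice_in_iff[OF N] M(1) bopD[OF A])
    show "M (x + y) = M x + M y" if "x \<in> tensor_space N" "y \<in> tensor_space N" for x y
      by (rule eq_if_slices_eq) (use that in \<open>simp add: M(1) closed bopD[OF A] bopD[OF slice_bop] sl\<close>)
    show "M (c *\<^sub>C x) = c *\<^sub>C M x" if "x \<in> tensor_space N" for c x
      by (rule eq_if_slices_eq) (use that in \<open>simp add: M(1) closed bopD[OF A] bopD[OF slice_bop] sl\<close>)
  qed
  with M(1) show thesis using that by blast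
qed

lemma slice_amplify:
  assumes "T \<in> bop UNIV UNIV"
  shows "slice k (amplify T x) = slice (adj UNIV T k) x"
  by (rule ell2_eqI)
    (simp add: slice.rep_eq coord_amplify[OF assms] cinner_adj[OF closed_csubspace_UNIV assms])

text \<open>The choice in \<open>tensor_op\<close> needs a witness: A \<otimes> T is A \<otimes> I
  followed by I \<otimes> T.\<close>

lemma
  fixes N :: "'n fock set" and T :: "'k\<^sub>1::chilbert_space \<Rightarrow> 'k\<^sub>2::chilbert_space"
  assumes N: "closed_csubspace N" and A: "A \<in> bop N N" and T: "T \<in> bop UNIV UNIV"
  shows tensor_op_bop: "tensor_op N A T \<in> bop (tensor_space N) (tensor_space N)"
    and tensor_op_tensor: "f \<in> N \<Longrightarrow> tensor_op N A T (tensor f k) = tensor (A f) (T k)"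
proof -
  obtain M :: "('n, 'k\<^sub>1) vfock \<Rightarrow> ('n, 'k\<^sub>1) vfock" where M: "M \<in> bop (tensor_space N) (tensor_space N)"
    "\<And>x k. x \<in> tensor_space N \<Longrightarrow> slice k (M x) = A (slice k x)"
    using tensor_id_exists[OF N A] by blast
  have "amplify T \<circ> M \<in> bop (tensor_space N) UNIV"
    by (rule bop_comp[OF bop_subset[OF amplify_bop[OF T]] M(1)]) simp_all
  then have "amplify T \<circ> M \<in> bop (tensor_space N) (tensor_space N)"
    by (rule bop_subset)
      (simp_all add: slice_in_iff[OF N] slice_amplify[OF T] M(2) bopD[OF A])
  moreover have "amplify T (M (tensor f k)) = tensor (A f) (T k)" if "f \<in> N" for f k
  proof -
    have "M (tensor f k) = tensor (A f) k"
      by (rule eq_if_slices_eq)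
        (simp add: M(2) tensor_in_tensor_space that slice_tensor bopD[OF A])
    then show ?thesis
      by (intro ell2_eqI) (simp add: coord_amplify[OF T] tensor.rep_eq bopD[OF T])
  qed
  ultimately have "\<exists>M. M \<in> bop (tensor_space N) (tensor_space N) \<and>
      (\<forall>f\<in>N. \<forall>k. M (tensor f k) = tensor (A f) (T k))"
    by (intro exI[of _ "amplify T \<circ> M"]) simp
  from someI_ex[OF this] show "tensor_op N A T \<in> bop (tensor_space N) (tensor_space N)"
    and "f \<in> N \<Longrightarrow> tensor_op N A T (tensor f k) = tensor (A f) (T k)"
    unfolding tensor_op_def by blast+
qed

context toeplitz_ideal
begin

lemma shift_BI_bop: "shift_BI J i \<in> bop H H"
  unfolding shift_BI_def by (rule tensor_op_bop[OF N_closed shift_B_bop bop_id]) simp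

lemma shift_BI_tensor: "f \<in> \<N> J \<Longrightarrow> shift_BI J i (tensor f k) = tensor (shift_B J i f) k"
  unfolding shift_BI_def by (simp add: tensor_op_tensor[OF N_closed shift_B_bop bop_id])

text \<open>\<open>shift_BI\<close> is known only on elementary tensors, whereas its adjoint is
  explicit on all of \<open>H\<close>; the later arguments therefore work with
  \<open>lann\<close>.\<close>

lemma cinner_shift_BI:
  assumes "x \<in> H" "y \<in> H"
  shows "cinner (shift_BI J i x) y = cinner x (lann i y)"
proof (rule cinner_eq_on_hull)
  show "shift_BI J i \<in> bop (closed_csubspace hull {tensor f k |f k. f \<in> \<N> J}) H"
    using shift_BI_bop by (simp add: tensor_space_def)
  show "x \<in> closed_csubspace hull {tensor f k |f k. f \<in> \<N> J}"
    using assms by (simp add: tensor_space_def)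
  fix z assume "z \<in> {tensor f k |f k :: 'a. f \<in> \<N> J}"
  then obtain f k where "f \<in> \<N> J" "z = tensor f k" by blast
  then show "cinner (shift_BI J i z) y = cinner z (lann i y)"
    using \<open>y \<in> H\<close>
    by (simp add: shift_BI_tensor cinner_tensor_left cinner_shift_B in_H_iff slice_lann)
qed

lemma adj_shift_BI: "y \<in> H \<Longrightarrow> adj H (shift_BI J i) y = lann i y"
  by (rule adj_eqI[OF H_closed]) (simp_all add: lann_H cinner_shift_BI)

text \<open>The intertwining relation is put weakly so that \<open>closedin_wot_equations\<close>
  applies. For a generator it is checked on elementary tensors, where it reduces to
  \<open>algebra_W_commutes\<close>.\<close>

lemma multipliers_W_commute:
  fixes G :: "('n, 'k\<^sub>1::chilbert_space) vfock \<Rightarrow> ('n, 'k\<^sub>2::chilbert_space) vfock"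
  assumes "G \<in> multipliers_W J"
  shows "G \<in> bop H H"
    and "x \<in> H \<Longrightarrow> y \<in> H \<Longrightarrow> cinner (G (shift_BI J i x)) y = cinner (G x) (lann i y)"
proof -
  let ?R = "{(shift_BI J i x, y, x, lann i y) | i x y. x \<in> H \<and> y \<in> H}"
  let ?V = "{G :: ('n, 'k\<^sub>1) vfock \<Rightarrow> ('n, 'k\<^sub>2) vfock. G \<in> bop H H \<and>
    (\<forall>(x, y, x', y')\<in>?R. cinner (G x) y = cinner (G x') y')}"
  have V: "?V = {G \<in> bop H H. \<forall>i. \<forall>x\<in>H. \<forall>y\<in>H. cinner (G (shift_BI J i x)) y = cinner (G x) (lann i y)}"
    by fastforce
  have "closedin (wot H H) ?V"
    by (rule closedin_wot_equations) (auto intro: bopD(1)[OF shift_BI_bop] lann_H)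
  moreover have "op_space H H ?V"
    using op_space_bop[OF H_closed, of H]
    unfolding op_space_def V by (auto simp: cinner_add_left cinner_scaleC_left)
  moreover have "tensor_op (\<N> J) A T \<in> ?V" if A: "A \<in> algebra_W J" and T: "T \<in> bop UNIV UNIV" for A T
    unfolding V mem_Collect_eq
  proof (intro conjI allI ballI)
    let ?M = "tensor_op (\<N> J) A T"
    note AN = algebra_W_commutes(1)[OF A]
    note M = tensor_op_bop[OF N_closed AN T]
    show "?M \<in> bop H H" by (rule M)
    fix i and x :: "('n, 'k\<^sub>1) vfock" and y :: "('n, 'k\<^sub>2) vfock" assume x: "x \<in> H" and y: "y \<in> H"
    have "(?M \<circ> shift_BI J i) x = (shift_BI J i \<circ> ?M) x"
    proof (rule bop_eq_on_hull[where T = "?M \<circ> shift_BI J i" and T' = "shift_BI J i \<circ> ?M" and x = x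
          and S = "{tensor f k |f k. f \<in> \<N> J}"])
      show "?M \<circ> shift_BI J i \<in> bop (closed_csubspace hull {tensor f k |f k. f \<in> \<N> J}) H"
        using bop_comp[OF M shift_BI_bop] by (simp add: tensor_space_def)
      show "shift_BI J i \<circ> ?M \<in> bop (closed_csubspace hull {tensor f k |f k. f \<in> \<N> J}) H"
        using bop_comp[OF shift_BI_bop M] by (simp add: tensor_space_def)
      show "x \<in> closed_csubspace hull {tensor f k |f k. f \<in> \<N> J}"
        using x by (simp add: tensor_space_def)
      fix z assume "z \<in> {tensor f k |f k :: 'k\<^sub>1. f \<in> \<N> J}"
      then show "(?M \<circ> shift_BI J i) z = (shift_BI J i \<circ> ?M) z"
        by (auto simp: shift_BI_tensor tensor_op_tensor[OF N_closed AN T] bopD(1)[OF AN]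
            bopD(1)[OF shift_B_bop] algebra_W_commutes(2)[OF A])
    qed
    then show "cinner (?M (shift_BI J i x)) y = cinner (?M x) (lann i y)"
      using cinner_shift_BI[OF bopD(1)[OF M x] y] by simp
  qed
  then have "{tensor_op (\<N> J) A T |A T. A \<in> algebra_W J \<and> T \<in> bop UNIV UNIV} \<subseteq> ?V" by blast
  ultimately have "multipliers_W J \<subseteq> ?V"
    unfolding multipliers_W_def by (intro hull_minimal conjI)
  then have "G \<in> ?V" using assms by blast
  then show "G \<in> bop H H"
    and "x \<in> H \<Longrightarrow> y \<in> H \<Longrightarrow> cinner (G (shift_BI J i x)) y = cinner (G x) (lann i y)"
    unfolding V by auto
qed

end


section \<open>Lifting intertwiners of backward shifts\<close>

lemma bop_UNIV_bounded_linear: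
  assumes T: "T \<in> bop UNIV UNIV"
  shows "bounded_linear T"
proof -
  obtain K where K: "0 < K" "\<And>x. norm (T x) \<le> K * norm x" using bop_bound[OF T] by auto
  show ?thesis
  proof
    show "T (r *\<^sub>R x) = r *\<^sub>R T x" for r x
      using bopD(3)[OF T, of x "complex_of_real r"] by (simp add: scaleC_of_real)
    show "\<exists>K. \<forall>x. norm (T x) \<le> norm x * K"
      by (rule exI[of _ K]) (use K in \<open>simp add: mult.commute\<close>)
  qed (simp add: bopD[OF T])
qed

lemmas lann_bounded_linear = bop_UNIV_bounded_linear[OF lann_bop]

lemmas lann_diff = linear_diff[OF bounded_linear.linear[OF lann_bounded_linear]]
  and lann_scaleR = linear_scale[OF bounded_linear.linear[OF lann_bounded_linear]]
  and continuous_on_lann = bounded_linear.continuous_on[OF lann_bounded_linear]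

text \<open>Graphs of partial linear maps of norm at most \<open>c\<close> that commute with the
  backward shifts. Single-valuedness need not be demanded: the bound forces \<open>snd p = 0\<close>
  whenever \<open>fst p = 0\<close>.\<close>

definition shift_graph ::
  "real \<Rightarrow> (('n, 'k\<^sub>1::chilbert_space) vfock \<times> ('n, 'k\<^sub>2::chilbert_space) vfock) set \<Rightarrow> bool" where
  "shift_graph c \<Gamma> \<longleftrightarrow> 0 \<in> \<Gamma> \<and> (\<forall>p\<in>\<Gamma>. \<forall>q\<in>\<Gamma>. p + q \<in> \<Gamma>)
     \<and> (\<forall>a. \<forall>p\<in>\<Gamma>. (a *\<^sub>C fst p, a *\<^sub>C snd p) \<in> \<Gamma>)
     \<and> (\<forall>p\<in>\<Gamma>. norm (snd p) \<le> c * norm (fst p))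
     \<and> (\<forall>i. \<forall>p\<in>\<Gamma>. (lann i (fst p), lann i (snd p)) \<in> \<Gamma>)"

lemma shift_graphD:
  assumes "shift_graph c \<Gamma>"
  shows "0 \<in> \<Gamma>" "\<And>p q. p \<in> \<Gamma> \<Longrightarrow> q \<in> \<Gamma> \<Longrightarrow> p + q \<in> \<Gamma>"
    "\<And>a p. p \<in> \<Gamma> \<Longrightarrow> (a *\<^sub>C fst p, a *\<^sub>C snd p) \<in> \<Gamma>"
    "\<And>p. p \<in> \<Gamma> \<Longrightarrow> norm (snd p) \<le> c * norm (fst p)"
    "\<And>i p. p \<in> \<Gamma> \<Longrightarrow> (lann i (fst p), lann i (snd p)) \<in> \<Gamma>"
  using assms by (auto simp: shift_graph_def)

lemma shift_graph_subspace:
  assumes "shift_graph c \<Gamma>"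
  shows "subspace \<Gamma>"
proof (rule subspaceI)
  fix r p assume "p \<in> \<Gamma>"
  then show "r *\<^sub>R p \<in> \<Gamma>"
    using shift_graphD(3)[OF assms, of p "complex_of_real r"] by (simp add: scaleC_of_real scaleR_prod_def)
qed (use shift_graphD[OF assms] in auto)

text \<open>
  The condition on \<open>f\<close> prescribes \<open>S\<^sub>i\<^sup>* h\<close>, so that only the vacuum coordinate of \<open>h\<close> has to be
  chosen. It is the limit of the vacuum coordinates along a minimizing sequence of
  \<open>c\<^sup>2 \<parallel>f - x\<parallel>\<^sup>2 - \<Sum>\<^sub>i \<parallel>S\<^sub>i\<^sup>* h - S\<^sub>i\<^sup>* y\<parallel>\<^sup>2\<close> over \<open>(x, y)\<close> in the graph.
\<close>

lemma shift_graph_extension_vector: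
  fixes \<Gamma> :: "(('n::finite, 'k\<^sub>1::chilbert_space) vfock \<times> ('n, 'k\<^sub>2::chilbert_space) vfock) set"
  assumes \<Gamma>: "shift_graph c \<Gamma>" and f: "\<And>i. \<exists>y. (lann i f, y) \<in> \<Gamma>"
  obtains h where "\<And>p. p \<in> \<Gamma> \<Longrightarrow> (norm (h - snd p))\<^sup>2 \<le> (c * norm (f - fst p))\<^sup>2"
    "\<And>i. (lann i f, lann i h) \<in> \<Gamma>"
proof -
  note subspace = shift_graph_subspace[OF \<Gamma>]
  obtain y where y: "\<And>i. (lann i f, y i) \<in> \<Gamma>" using f by metis
  define Q where "Q p = (c * norm (f - fst p))\<^sup>2 - (\<Sum>i\<in>UNIV. (norm (y i - lann i (snd p)))\<^sup>2)" for p
  define z where "z p = coord (snd p) []" for p :: "('n, 'k\<^sub>1) vfock \<times> ('n, 'k\<^sub>2) vfock"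
  \<comment> \<open>The graph bound is applied to the differences of the backward shifts;
    \<open>norm_sq_lann\<close> then sums them up, with the vacuum coordinate of
    \<open>f - fst p\<close> dropped.\<close>
  have lower: "0 \<le> Q p" if p: "p \<in> \<Gamma>" for p
  proof -
    have "(\<Sum>i\<in>UNIV. (norm (y i - lann i (snd p)))\<^sup>2) \<le> (\<Sum>i\<in>UNIV. c\<^sup>2 * (norm (lann i (f - fst p)))\<^sup>2)"
    proof (rule sum_mono)
      fix i
      have "(lann i f, y i) - (lann i (fst p), lann i (snd p)) \<in> \<Gamma>"
        by (intro subspace_diff[OF subspace] y shift_graphD(5)[OF \<Gamma> p])
      then have "norm (y i - lann i (snd p)) \<le> c * norm (lann i (f - fst p))"
        using shift_graphD(4)[OF \<Gamma>] by (fastforce simp: lann_diff)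
      then show "(norm (y i - lann i (snd p)))\<^sup>2 \<le> c\<^sup>2 * (norm (lann i (f - fst p)))\<^sup>2"
        unfolding power_mult_distrib[symmetric] by (rule power_mono) simp
    qed
    also have "\<dots> \<le> c\<^sup>2 * (norm (f - fst p))\<^sup>2"
      unfolding sum_distrib_left[symmetric] norm_sq_lann[of "f - fst p"] by (intro mult_left_mono) simp_all
    finally show ?thesis by (simp add: Q_def power_mult_distrib)
  qed
  have strong: "Q ((1 - t) *\<^sub>R a + t *\<^sub>R b) \<le> (1 - t) * Q a + t * Q b - t * (1 - t) * (norm (z a - z b))\<^sup>2"
    if ab: "a \<in> \<Gamma>" "b \<in> \<Gamma>" and t: "0 \<le> t" "t \<le> 1" for a b t
  proof -
    \<comment> \<open>\<open>D\<close> is the convexity defect of \<open>Q\<close>. The graph bound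
      for \<open>a - b\<close>, split by \<open>norm_sq_lann\<close>, says exactly that
      \<open>D\<close> dominates the vacuum part.\<close>
    define D where "D = c\<^sup>2 * (norm (fst a - fst b))\<^sup>2
      - (\<Sum>i\<in>UNIV. (norm (lann i (snd a) - lann i (snd b)))\<^sup>2)"
    have "a - b \<in> \<Gamma>" by (intro subspace_diff[OF subspace] ab)
    then have "(norm (snd (a - b)))\<^sup>2 \<le> (c * norm (fst (a - b)))\<^sup>2"
      by (intro power_mono shift_graphD(4)[OF \<Gamma>]) simp_all
    then have D: "(norm (z a - z b))\<^sup>2 \<le> D"
      unfolding norm_sq_lann[of "snd (a - b)"]
      by (simp add: D_def z_def coord_simps lann_diff power_mult_distrib)
    have comb: "u - ((1 - t) *\<^sub>R v + t *\<^sub>R w) = (1 - t) *\<^sub>R (u - v) + t *\<^sub>R (u - w)" for u v w :: "'z::real_vector"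
      by (simp add: algebra_simps)
    have 1: "(norm (f - fst ((1 - t) *\<^sub>R a + t *\<^sub>R b)))\<^sup>2
        = (1 - t) * (norm (f - fst a))\<^sup>2 + t * (norm (f - fst b))\<^sup>2 - t * (1 - t) * (norm (fst a - fst b))\<^sup>2"
      unfolding fst_add fst_scaleR comb norm_sq_convex_combination by (simp add: norm_minus_commute)
    have 2: "(norm (y i - lann i (snd ((1 - t) *\<^sub>R a + t *\<^sub>R b))))\<^sup>2
        = (1 - t) * (norm (y i - lann i (snd a)))\<^sup>2 + t * (norm (y i - lann i (snd b)))\<^sup>2
          - t * (1 - t) * (norm (lann i (snd a) - lann i (snd b)))\<^sup>2" for i
      unfolding snd_add snd_scaleR lann_add lann_scaleR comb norm_sq_convex_combination
      by (simp add: norm_minus_commute)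
    have "Q ((1 - t) *\<^sub>R a + t *\<^sub>R b) = (1 - t) * Q a + t * Q b - t * (1 - t) * D"
      unfolding Q_def D_def power_mult_distrib 1 2
      by (simp add: sum.distrib sum_subtractf sum_distrib_left[symmetric] algebra_simps)
    also have "\<dots> \<le> (1 - t) * Q a + t * Q b - t * (1 - t) * (norm (z a - z b))\<^sup>2"
      using t D by (intro diff_left_mono mult_left_mono) simp_all
    finally show ?thesis .
  qed
  obtain z0 d where min: "0 \<le> d" "\<And>p. p \<in> \<Gamma> \<Longrightarrow> (norm (z0 - z p))\<^sup>2 \<le> Q p - d"
  proof (rule strongly_convex_minimizing_limit[of \<Gamma> 0 Q z])
    show "convex \<Gamma>" by (rule subspace_imp_convex[OF subspace])
    show "\<Gamma> \<noteq> {}" using shift_graphD(1)[OF \<Gamma>] by blast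
  qed (use lower strong in auto)
  obtain h where h: "coord h [] = z0" "\<And>i. lann i h = y i" using vfock_of_lann by blast
  \<comment> \<open>Vacuum part at most \<open>Q p - d \<le> Q p\<close>; the remaining part is the
    sum subtracted in \<open>Q p\<close>.\<close>
  have bound: "(norm (h - snd p))\<^sup>2 \<le> (c * norm (f - fst p))\<^sup>2" if "p \<in> \<Gamma>" for p
    unfolding norm_sq_lann[of "h - snd p"]
    using min(1) min(2)[OF that] by (simp add: coord_simps lann_diff h z_def Q_def)
  show thesis by (rule that[of h]) (use bound h y in simp_all)
qed

text \<open>It suffices to add the line through (f, h): its backward shifts already lie in the
  graph, and the norm bound for \<open>p + a (f, h)\<close> follows from that for (f, h) minus
  elements of the graph by scaling.\<close>

lemma shift_graph_extend:
  fixes \<Gamma> :: "(('n::finite, 'k\<^sub>1::chilbert_space) vfock \<times> ('n, 'k\<^sub>2::chilbert_space) vfock) set"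
  assumes \<Gamma>: "shift_graph c \<Gamma>" and "0 \<le> c" and f: "\<And>i. \<exists>y. (lann i f, y) \<in> \<Gamma>"
  obtains \<Gamma>' h where "shift_graph c \<Gamma>'" "\<Gamma> \<subseteq> \<Gamma>'" "(f, h) \<in> \<Gamma>'"
proof -
  obtain h where bound: "\<And>p. p \<in> \<Gamma> \<Longrightarrow> (norm (h - snd p))\<^sup>2 \<le> (c * norm (f - fst p))\<^sup>2"
    and h: "\<And>i. (lann i f, lann i h) \<in> \<Gamma>"
    using shift_graph_extension_vector[OF \<Gamma> f] by blast
  define \<Gamma>' where "\<Gamma>' = {(fst p + a *\<^sub>C f, snd p + a *\<^sub>C h) | p a. p \<in> \<Gamma>}"
  have \<Gamma>'I: "(fst p + a *\<^sub>C f, snd p + a *\<^sub>C h) \<in> \<Gamma>'" if "p \<in> \<Gamma>" for p a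
    unfolding \<Gamma>'_def using that by blast
  have sub: "\<Gamma> \<subseteq> \<Gamma>'"
  proof
    fix p assume "p \<in> \<Gamma>"
    then show "p \<in> \<Gamma>'" using \<Gamma>'I[of p 0] by simp
  qed
  have "shift_graph c \<Gamma>'"
    unfolding shift_graph_def
  proof (intro conjI ballI allI)
    show "0 \<in> \<Gamma>'" using sub shift_graphD(1)[OF \<Gamma>] by blast
    fix p assume "p \<in> \<Gamma>'"
    then obtain q a where q: "q \<in> \<Gamma>" and p: "p = (fst q + a *\<^sub>C f, snd q + a *\<^sub>C h)"
      by (auto simp: \<Gamma>'_def)
    show "(b *\<^sub>C fst p, b *\<^sub>C snd p) \<in> \<Gamma>'" for b
      using \<Gamma>'I[OF shift_graphD(3)[OF \<Gamma> q, of b], of "b * a"] by (simp add: p scaleC_add_right scaleC_scaleC)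
    show "p + p' \<in> \<Gamma>'" if p'_in: "p' \<in> \<Gamma>'" for p'
    proof -
      obtain q' a' where q': "q' \<in> \<Gamma>" and p': "p' = (fst q' + a' *\<^sub>C f, snd q' + a' *\<^sub>C h)"
        using p'_in unfolding \<Gamma>'_def by blast
      show ?thesis
        using \<Gamma>'I[OF shift_graphD(2)[OF \<Gamma> q q'], of "a + a'"]
        by (simp add: p p' scaleC_add_left algebra_simps)
    qed
    show "(lann i (fst p), lann i (snd p)) \<in> \<Gamma>'" for i
    proof -
      have "(lann i (fst q), lann i (snd q)) + (a *\<^sub>C lann i f, a *\<^sub>C lann i h) \<in> \<Gamma>"
        using shift_graphD(2,3)[OF \<Gamma>] shift_graphD(5)[OF \<Gamma> q, of i] h[of i] by fastforce
      then show ?thesis using sub by (auto simp: p lann_add lann_scaleC)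
    qed
    show "norm (snd p) \<le> c * norm (fst p)"
    proof (cases "a = 0")
      case True
      then show ?thesis using shift_graphD(4)[OF \<Gamma> q] by (simp add: p)
    next
      case False
      \<comment> \<open>Dividing by \<open>a\<close> turns the new pair into (f, h) - q'.\<close>
      define q' where "q' = ((- 1 / a) *\<^sub>C fst q, (- 1 / a) *\<^sub>C snd q)"
      have "q' \<in> \<Gamma>" unfolding q'_def by (rule shift_graphD(3)[OF \<Gamma> q])
      then have "norm (h - snd q') \<le> c * norm (f - fst q')"
        using bound[of q'] \<open>0 \<le> c\<close> by (simp add: power_mono_iff)
      moreover have "a *\<^sub>C (h - snd q') = snd p" "a *\<^sub>C (f - fst q') = fst p"
        using False by (simp_all add: p q'_def scaleC_diff_right scaleC_scaleC scaleC_minus_one)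
      then have "norm (snd p) = cmod a * norm (h - snd q')" "norm (fst p) = cmod a * norm (f - fst q')"
        by (metis norm_scaleC)+
      ultimately show ?thesis
        using mult_left_mono[of "norm (h - snd q')" "c * norm (f - fst q')" "cmod a"]
        by (simp add: mult.left_commute)
    qed
  qed
  moreover have "(f, h) \<in> \<Gamma>'" using \<Gamma>'I[OF shift_graphD(1)[OF \<Gamma>], of 1] by simp
  ultimately show thesis using that sub by blast
qed

lemma shift_graph_closure:
  assumes \<Gamma>: "shift_graph c \<Gamma>"
  shows "shift_graph c (closure \<Gamma>)"
  unfolding shift_graph_def
proof (intro conjI ballI allI)
  let ?C = "closure \<Gamma>"
  have image: "g ` ?C \<subseteq> T" if "continuous_on UNIV g" "closed T" "g ` \<Gamma> \<subseteq> T" for g and T :: "'z::t2_space set"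
    using that by (intro image_closure_subset) (auto intro: continuous_on_subset)
  note sub = closure_subset[of \<Gamma>]
  show "0 \<in> ?C" using sub shift_graphD(1)[OF \<Gamma>] by blast
  fix p assume p: "p \<in> ?C"
  have "(\<lambda>p. (a *\<^sub>C fst p, a *\<^sub>C snd p)) ` ?C \<subseteq> ?C" for a
    using shift_graphD(3)[OF \<Gamma>] sub
    by (intro image) (auto intro!: continuous_intros bounded_linear.continuous_on[OF bounded_linear_scaleC])
  then show "(a *\<^sub>C fst p, a *\<^sub>C snd p) \<in> ?C" for a using p by blast
  have "(\<lambda>p. (lann i (fst p), lann i (snd p))) ` ?C \<subseteq> ?C" for i
    using shift_graphD(5)[OF \<Gamma>] sub
    by (intro image) (auto intro!: continuous_intros continuous_on_lann)
  then show "(lann i (fst p), lann i (snd p)) \<in> ?C" for i using p by blast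
  have "(\<lambda>p. p) ` ?C \<subseteq> {p. norm (snd p) \<le> c * norm (fst p)}"
    using shift_graphD(4)[OF \<Gamma>]
    by (intro image closed_Collect_le) (auto intro!: continuous_intros)
  then show "norm (snd p) \<le> c * norm (fst p)" using p by blast
  \<comment> \<open>Addition is extended to the closure in one argument at a time.\<close>
  have "(\<lambda>p'. p + p') ` ?C \<subseteq> ?C"
  proof (rule image)
    have "(\<lambda>p. p + p') ` ?C \<subseteq> ?C" if "p' \<in> \<Gamma>" for p'
      using shift_graphD(2)[OF \<Gamma> _ that] sub by (intro image) (auto intro!: continuous_intros)
    then show "(\<lambda>p'. p + p') ` \<Gamma> \<subseteq> ?C" using p by blast
  qed (auto intro!: continuous_intros)
  then show "p + p' \<in> ?C" if "p' \<in> ?C" for p' using that by blast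
qed

lemma backward_shift_lifting:
  fixes Z :: "('n::finite, 'k\<^sub>1::chilbert_space) vfock \<Rightarrow> ('n, 'k\<^sub>2::chilbert_space) vfock"
  assumes E: "closed_csubspace E" and Z: "Z \<in> bop E F" and "0 \<le> c"
    and bound: "\<And>x. x \<in> E \<Longrightarrow> norm (Z x) \<le> c * norm x"
    and inv: "\<And>i x. x \<in> E \<Longrightarrow> lann i x \<in> E" and comm: "\<And>i x. x \<in> E \<Longrightarrow> Z (lann i x) = lann i (Z x)"
  obtains Z' where "Z' \<in> bop UNIV UNIV" "\<And>x. norm (Z' x) \<le> c * norm x"
    "\<And>i x. Z' (lann i x) = lann i (Z' x)" "\<And>x. x \<in> E \<Longrightarrow> Z' x = Z x"
proof -
  define \<Gamma>0 where "\<Gamma>0 = {(x, Z x) | x. x \<in> E}"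
  define \<A> where "\<A> = {\<Gamma>. shift_graph c \<Gamma> \<and> \<Gamma>0 \<subseteq> \<Gamma>}"
  have "shift_graph c \<Gamma>0"
    by (auto simp: shift_graph_def \<Gamma>0_def zero_prod_def bop_zero[OF Z E] bopD[OF Z] closed_csubspaceD[OF E]
        bound inv comm)
  then have "\<A> \<noteq> {}" by (auto simp: \<A>_def)
  moreover have "\<Union>C \<in> \<A>" if C: "C \<noteq> {}" "subset.chain \<A> C" for C
  proof -
    have sg: "shift_graph c \<Gamma>" "\<Gamma>0 \<subseteq> \<Gamma>" if "\<Gamma> \<in> C" for \<Gamma>
      using that C(2) by (auto simp: \<A>_def subset_chain_def)
    have "shift_graph c (\<Union>C)"
      unfolding shift_graph_def
    proof (intro conjI ballI allI)
      show "0 \<in> \<Union>C" using C(1) sg(1) shift_graphD(1) by blast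
      fix p assume "p \<in> \<Union>C"
      then obtain \<Gamma> where \<Gamma>: "\<Gamma> \<in> C" "p \<in> \<Gamma>" by blast
      note D = shift_graphD[OF sg(1)[OF \<Gamma>(1)]]
      show "(a *\<^sub>C fst p, a *\<^sub>C snd p) \<in> \<Union>C" for a using D(3)[OF \<Gamma>(2)] \<Gamma>(1) by blast
      show "(lann i (fst p), lann i (snd p)) \<in> \<Union>C" for i using D(5)[OF \<Gamma>(2)] \<Gamma>(1) by blast
      show "norm (snd p) \<le> c * norm (fst p)" by (rule D(4)[OF \<Gamma>(2)])
      fix q assume "q \<in> \<Union>C"
      then obtain \<Gamma>' where \<Gamma>': "\<Gamma>' \<in> C" "q \<in> \<Gamma>'" by blast
      then have "\<Gamma> \<subseteq> \<Gamma>' \<or> \<Gamma>' \<subseteq> \<Gamma>" using C(2) \<Gamma>(1) by (auto simp: subset_chain_def)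
      then show "p + q \<in> \<Union>C"
        using \<Gamma> \<Gamma>' shift_graphD(2)[OF sg(1)] by blast
    qed
    then show ?thesis using sg(2) C(1) by (auto simp: \<A>_def)
  qed
  ultimately obtain M where "M \<in> \<A>" and max: "\<And>\<Gamma>. \<Gamma> \<in> \<A> \<Longrightarrow> M \<subseteq> \<Gamma> \<Longrightarrow> \<Gamma> = M"
    using subset_Zorn_nonempty[of \<A>] by blast
  then have M: "shift_graph c M" "\<Gamma>0 \<subseteq> M" by (auto simp: \<A>_def)
  note D = shift_graphD[OF M(1)] and subspace = shift_graph_subspace[OF M(1)]
  have "closure M = M"
    using max[of "closure M"] shift_graph_closure[OF M(1)] closure_subset[of M] M(2) by (auto simp: \<A>_def)
  then have "complete M" by (metis closed_closure complete_eq_closed)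
  have "closed_csubspace (fst ` M)"
    unfolding closed_csubspace_def
  proof (intro conjI ballI allI)
    \<comment> \<open>By the norm bound the first projection is bounded below on \<open>M\<close> by
      1 / (1 + c), so completeness passes from the graph to the domain.\<close>
    have "complete (fst ` M)"
    proof (rule complete_isometric_image[OF _ subspace bounded_linear_fst _ \<open>complete M\<close>])
      show "\<forall>p\<in>M. inverse (1 + c) * norm p \<le> norm (fst p)"
      proof
        fix p assume "p \<in> M"
        have "norm p \<le> norm (fst p) + norm (snd p)"
          using norm_Pair_le[of "fst p" "snd p"] by simp
        also have "\<dots> \<le> (1 + c) * norm (fst p)" using D(4)[OF \<open>p \<in> M\<close>] by (simp add: algebra_simps)
        finally show "inverse (1 + c) * norm p \<le> norm (fst p)" using \<open>0 \<le> c\<close> by (simp add: field_simps)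
      qed
    qed (use \<open>0 \<le> c\<close> in simp)
    then show "closed (fst ` M)" by (rule complete_imp_closed)
    show "0 \<in> fst ` M" using D(1) by force
    show "x + y \<in> fst ` M" if "x \<in> fst ` M" "y \<in> fst ` M" for x y
      using that D(2) by (metis (no_types, opaque_lifting) fst_add imageE image_eqI)
    show "a *\<^sub>C x \<in> fst ` M" if "x \<in> fst ` M" for a x
      using that D(3) by (metis (no_types, opaque_lifting) fst_conv imageE image_eqI)
  qed
  \<comment> \<open>By maximality, a vector whose backward shifts all lie in the domain lies there
    itself. For \<open>tensor (ket w) k\<close> this gives an induction on \<open>w\<close>.\<close>
  moreover have extend: "x \<in> fst ` M" if "\<And>i. lann i x \<in> fst ` M" for x
  proof -
    have "\<exists>y. (lann i x, y) \<in> M" for i using that[of i] by force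
    then obtain \<Gamma>' h where "shift_graph c \<Gamma>'" "M \<subseteq> \<Gamma>'" "(x, h) \<in> \<Gamma>'"
      using shift_graph_extend[OF M(1) \<open>0 \<le> c\<close>] by metis
    then have "(x, h) \<in> M" using max[of \<Gamma>'] M(2) by (auto simp: \<A>_def)
    then show ?thesis by force
  qed
  have zero: "0 \<in> fst ` M" using D(1) by force
  have "tensor (ket w) k \<in> fst ` M" for w k
  proof (induction w)
    case Nil
    show ?case by (rule extend) (simp add: lann_tensor lann_ket_Nil zero)
  next
    case (Cons j w)
    show ?case by (rule extend) (use Cons in \<open>simp add: lann_tensor lann_ket_Cons zero\<close>)
  qed
  ultimately have "fst ` M = UNIV" by (rule closed_csubspace_UNIV_if_ket_tensors)
  then have "\<exists>y. (x, y) \<in> M" for x by (metis UNIV_I imageE prod.collapse)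
  then obtain Z' where Z': "\<And>x. (x, Z' x) \<in> M" by metis
  have unique: "y = Z' x" if "(x, y) \<in> M" for x y
  proof -
    have "(x, y) - (x, Z' x) \<in> M" by (intro subspace_diff[OF subspace] that Z')
    then show ?thesis using D(4) by fastforce
  qed
  have Z'_bound: "norm (Z' x) \<le> c * norm x" for x using D(4)[OF Z'[of x]] by simp
  show thesis
  proof (rule that)
    show "Z' \<in> bop UNIV UNIV"
    proof (rule linear_bopI[OF _ _ Z'_bound])
      show "Z' (x + y) = Z' x + Z' y" for x y using unique D(2)[OF Z'[of x] Z'[of y]] by simp
      show "Z' (a *\<^sub>C x) = a *\<^sub>C Z' x" for a x using unique D(3)[OF Z'[of x], of a] by simp
    qed
    show "Z' (lann i x) = lann i (Z' x)" for i x using unique D(5)[OF Z'[of x], of i] by simp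
    show "Z' x = Z x" if "x \<in> E" for x using unique[of x "Z x"] M(2) that by (auto simp: \<Gamma>0_def)
  qed (rule Z'_bound)
qed


section \<open>Fejer means\<close>

lift_definition trunc :: "'n list set \<Rightarrow> ('n, 'k::real_inner) vfock \<Rightarrow> ('n, 'k) vfock"
  is "\<lambda>A f w. if w \<in> A then f w else 0"
  by (erule summable_on_comparison_test) auto

lemma trunc_eq_sum:
  assumes "finite A"
  shows "trunc A y = (\<Sum>u\<in>A. tensor (ket u) (coord y u))"
proof (rule ell2_eqI)
  fix w
  have "coord (\<Sum>u\<in>A. tensor (ket u) (coord y u)) w = (\<Sum>u\<in>A. if w = u then coord y u else 0)"
    unfolding coord_sum by (intro sum.cong) (auto simp: tensor.rep_eq ket.rep_eq)
  then show "coord (trunc A y) w = coord (\<Sum>u\<in>A. tensor (ket u) (coord y u)) w"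
    using assms by (simp add: trunc.rep_eq)
qed

lemma finite_words_less: "finite {w :: 'n::finite list. length w < m}"
  using finite_lists_length_le[of "UNIV :: 'n set" m]
  by (rule rev_finite_subset) auto

lemma tensor_add_right: "tensor f (k + l) = tensor f k + tensor f l"
  by (rule ell2_eqI) (simp add: tensor.rep_eq coord_simps scaleC_add_right)

lemma tensor_scaleC_right: "tensor f (c *\<^sub>C k) = c *\<^sub>C tensor f k"
  by (rule ell2_eqI) (simp add: tensor.rep_eq coord_simps scaleC_scaleC mult.commute)

lemma rann_eq_0: "(\<And>v. coord y (v @ w) = 0) \<Longrightarrow> rann w y = 0"
  by (rule ell2_eqI) (simp add: rann.rep_eq coord_simps)

lemma slice_rann: "slice k (rann w y) = rann w (slice k y)"
  by (rule ell2_eqI) (simp add: slice.rep_eq rann.rep_eq)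

section \<open>Fourier coefficients and Fejer means of an intertwiner\<close>

locale backward_shift_intertwiner =
  fixes Z :: "('n::finite, 'k\<^sub>2::chilbert_space) vfock \<Rightarrow> ('n, 'k\<^sub>1::chilbert_space) vfock" and c :: real
  assumes Z: "Z \<in> bop UNIV UNIV" and c: "0 \<le> c" and Z_bound: "norm (Z y) \<le> c * norm y"
    and Z_lann: "Z (lann i y) = lann i (Z y)"
begin

text \<open>The Fourier coefficient of \<open>Z\<close>; its adjoint is the operator A_w in the
  series of G.\<close>

definition coefficient :: "'n list \<Rightarrow> 'k\<^sub>2 \<Rightarrow> 'k\<^sub>1" where
  "coefficient w k = coord (Z (tensor (ket w) k)) []"

lemma coefficient_bop: "coefficient w \<in> bop UNIV UNIV"
proof (rule linear_bopI)
  show "norm (coefficient w k) \<le> c * norm (ket w) * norm k" for k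
    using order_trans[OF norm_coord_le Z_bound, of "tensor (ket w) k" "[]"]
    by (simp add: coefficient_def norm_tensor mult.assoc)
qed (simp_all add: coefficient_def tensor_add_right tensor_scaleC_right bopD[OF Z] coord_simps)

lemmas coefficient_zero [simp] = bop_zero[OF coefficient_bop closed_csubspace_UNIV]

lemma Z_zero [simp]: "Z 0 = 0"
  by (rule bop_zero[OF Z closed_csubspace_UNIV])

text \<open>Reading off coordinate \<open>i # v\<close> is reading off \<open>v\<close> after
  \<open>lann i\<close>, which passes through \<open>Z\<close>. So the letters of \<open>v\<close>
  are peeled off \<open>u\<close> until the vacuum coordinate remains, or a mismatch gives
  0.\<close>

lemma coord_Z_ket:
  "coord (Z (tensor (ket u) k)) v
    = (if take (length v) u = v then coefficient (drop (length v) u) k else 0)"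
proof (induction v arbitrary: u)
  case Nil
  then show ?case by (simp add: coefficient_def)
next
  case (Cons i v)
  have "coord (Z (tensor (ket u) k)) (i # v) = coord (Z (lann i (tensor (ket u) k))) v"
    by (simp add: Z_lann lann.rep_eq)
  then show ?case
    by (cases u) (auto simp: lann_tensor lann_ket_Nil lann_ket_Cons Cons.IH coord_simps)
qed

text \<open>Only the words of \<open>A\<close> with prefix \<open>v\<close> contribute. The bound
  \<open>m\<close> makes the index set independent of \<open>A\<close>, so that sums over several
  windows can be interchanged.\<close>

lemma coord_Z_trunc:
  assumes "finite A" "\<And>w. v @ w \<in> A \<Longrightarrow> length w < m"
  shows "coord (Z (trunc A y)) v
    = (\<Sum>w | length w < m. if v @ w \<in> A then coefficient w (coord y (v @ w)) else 0)"
proof -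
  let ?g = "\<lambda>u. if take (length v) u = v then coefficient (drop (length v) u) (coord y u) else 0"
  have "coord (Z (trunc A y)) v = (\<Sum>u\<in>A. ?g u)"
    unfolding trunc_eq_sum[OF assms(1)] bop_sum[OF Z closed_csubspace_UNIV UNIV_I] coord_sum coord_Z_ket ..
  also have "\<dots> = (\<Sum>u\<in>(@) v ` {w. length w < m}. if u \<in> A then ?g u else 0)"
  proof (rule sum.mono_neutral_cong)
    fix u assume u: "u \<in> A - (@) v ` {w. length w < m}"
    have "take (length v) u \<noteq> v"
    proof
      assume "take (length v) u = v"
      then have "u = v @ drop (length v) u" by (metis append_take_drop_id)
      then show False using u assms(2)[of "drop (length v) u"] by auto
    qed
    then show "?g u = 0" by simp
  qed (auto simp: assms(1) finite_words_less)
  also have "\<dots> = (\<Sum>w | length w < m. if v @ w \<in> A then coefficient w (coord y (v @ w)) else 0)"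
    by (subst sum.reindex) (auto simp: inj_on_def intro!: sum.cong)
  finally show ?thesis .
qed

definition fejer :: "nat \<Rightarrow> ('n, 'k\<^sub>2) vfock \<Rightarrow> ('n, 'k\<^sub>1) vfock" where
  "fejer m y = (\<Sum>w | length w < m. (1 - length w / m) *\<^sub>R amplify (coefficient w) (rann w y))"

lemma coord_fejer:
  "coord (fejer m y) v = (\<Sum>w | length w < m. (1 - length w / m) *\<^sub>R coefficient w (coord y (v @ w)))"
  by (simp add: fejer_def coord_sum coord_simps coord_amplify[OF coefficient_bop] rann.rep_eq)

text \<open>
  Each word lies in exactly \<open>m\<close> of the windows \<open>window m a\<close>. Hence the Fejer mean is the average
  of the compressions of \<open>Z\<close> to the windows, which are orthogonal enough to give the bound \<open>c\<close>.
\<close>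

definition window :: "nat \<Rightarrow> nat \<Rightarrow> 'n list set" where
  "window m a = {u. length u \<le> a \<and> a < length u + m}"

lemma finite_window: "finite (window m a)"
  by (rule finite_subset[OF _ finite_words_less[of "Suc a"]]) (auto simp: window_def)

text \<open>Only the \<open>m\<close> windows containing \<open>v\<close> are averaged. The word
  \<open>v @ w\<close> lies in those with index from \<open>length v + length w\<close> up to
  \<open>length v + m - 1\<close>; these are \<open>m - length w\<close> many, which is the Fejer
  weight times \<open>m\<close>.\<close>

lemma fejer_eq_average:
  assumes "0 < m"
  shows "real m *\<^sub>R coord (fejer m y) v = (\<Sum>a = length v..<length v + m. coord (Z (trunc (window m a) y)) v)"
proof -
  let ?B = "\<lambda>w. coefficient w (coord y (v @ w))"
  have "(\<Sum>a = length v..<length v + m. coord (Z (trunc (window m a) y)) v)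
      = (\<Sum>a = length v..<length v + m. \<Sum>w | length w < m. if length v + length w \<le> a then ?B w else 0)"
  proof (intro sum.cong refl)
    fix a assume a: "a \<in> {length v..<length v + m}"
    have "coord (Z (trunc (window m a) y)) v
        = (\<Sum>w | length w < m. if v @ w \<in> window m a then ?B w else 0)"
      by (rule coord_Z_trunc[OF finite_window]) (use a in \<open>auto simp: window_def\<close>)
    also have "\<dots> = (\<Sum>w | length w < m. if length v + length w \<le> a then ?B w else 0)"
      using a by (intro sum.cong refl) (auto simp: window_def)
    finally show "coord (Z (trunc (window m a) y)) v
        = (\<Sum>w | length w < m. if length v + length w \<le> a then ?B w else 0)" .
  qed
  also have "\<dots> = (\<Sum>w | length w < m.
      \<Sum>a = length v..<length v + m. if length v + length w \<le> a then ?B w else 0)"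
    by (rule sum.swap)
  also have "\<dots> = (\<Sum>w | length w < m. real m *\<^sub>R (1 - length w / m) *\<^sub>R ?B w)"
  proof (intro sum.cong refl)
    fix w :: "'n list" assume w: "w \<in> {w. length w < m}"
    have "(\<Sum>a = length v..<length v + m. if length v + length w \<le> a then ?B w else 0)
        = (\<Sum>a = length v + length w..<length v + m. ?B w)"
      by (rule sum.mono_neutral_cong_right) auto
    also have "\<dots> = real (m - length w) *\<^sub>R ?B w" by (simp add: sum_constant_scaleR)
    also have "real (m - length w) = real m * (1 - length w / m)"
      using w assms by (simp add: of_nat_diff field_simps)
    finally show "(\<Sum>a = length v..<length v + m. if length v + length w \<le> a then ?B w else 0)
        = real m *\<^sub>R (1 - length w / m) *\<^sub>R ?B w" by simp
  qed
  finally show ?thesis by (simp add: coord_fejer scaleR_sum_right)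
qed

lemma sum_norm_sq_window_le: "(\<Sum>a<N. (norm (trunc (window m a) y))\<^sup>2) \<le> real m * (norm y)\<^sup>2"
proof -
  let ?f = "\<lambda>a w. (norm (coord (trunc (window m a) y) w))\<^sup>2"
  have "(?f a has_sum (norm (trunc (window m a) y))\<^sup>2) UNIV" for a
    unfolding norm_sq_ell2 by (rule has_sum_infsum[OF coord_summable])
  then have "((\<lambda>w. \<Sum>a<N. ?f a w) has_sum (\<Sum>a<N. (norm (trunc (window m a) y))\<^sup>2)) UNIV"
    by (intro has_sum_finite_sum) auto
  moreover have "((\<lambda>w. real m * (norm (coord y w))\<^sup>2) has_sum real m * (norm y)\<^sup>2) UNIV"
    unfolding norm_sq_ell2 by (intro has_sum_cmult_right has_sum_infsum coord_summable)
  moreover have "(\<Sum>a<N. ?f a w) \<le> real m * (norm (coord y w))\<^sup>2" for w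
  proof -
    have "(\<Sum>a<N. ?f a w) = (\<Sum>a\<in>{..<N} \<inter> {length w..<length w + m}. (norm (coord y w))\<^sup>2)"
      by (rule sum.mono_neutral_cong_right) (auto simp: trunc.rep_eq window_def)
    also have "\<dots> = card ({..<N} \<inter> {length w..<length w + m}) * (norm (coord y w))\<^sup>2" by simp
    also have "\<dots> \<le> real m * (norm (coord y w))\<^sup>2"
      using card_mono[of "{length w..<length w + m}" "{..<N} \<inter> {length w..<length w + m}"]
      by (intro mult_right_mono) auto
    finally show ?thesis .
  qed
  ultimately show ?thesis by (rule has_sum_mono)
qed

text \<open>Cauchy-Schwarz over the windows at a coordinate costs a factor \<open>m\<close>, the
  overlap of the windows another one; both cancel against the square of the averaging
  factor.\<close>

lemma norm_fejer_le:
  assumes "0 < m"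
  shows "norm (fejer m y) \<le> c * norm y"
proof (rule norm_ell2_le)
  let ?t = "\<lambda>a. Z (trunc (window m a) y)"
  fix A :: "'n list set" assume "finite A"
  \<comment> \<open>Large enough that every window containing a word of \<open>A\<close> has index
    below \<open>N\<close>.\<close>
  define N where "N = Max (insert 0 (length ` A)) + m"
  have N: "length v + m \<le> N" if "v \<in> A" for v
    using that \<open>finite A\<close> by (simp add: N_def)
  have v: "(real m)\<^sup>2 * (norm (coord (fejer m y) v))\<^sup>2 \<le> real m * (\<Sum>a<N. (norm (coord (?t a) v))\<^sup>2)"
    if "v \<in> A" for v
  proof -
    have "real m * norm (coord (fejer m y) v) = norm (\<Sum>a = length v..<length v + m. coord (?t a) v)"
      unfolding fejer_eq_average[OF assms, symmetric] by simp
    also have "\<dots> \<le> (\<Sum>a = length v..<length v + m. norm (coord (?t a) v))" by (rule norm_sum)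
    finally have "(real m * norm (coord (fejer m y) v))\<^sup>2
        \<le> (\<Sum>a = length v..<length v + m. norm (coord (?t a) v))\<^sup>2"
      by (rule power_mono) simp
    also have "\<dots> \<le> (\<Sum>a = length v..<length v + m. (norm (coord (?t a) v))\<^sup>2) * real m"
      using sum_squared_le_sum_of_squares[of "\<lambda>a. norm (coord (?t a) v)" "{length v..<length v + m}"] by simp
    also have "\<dots> \<le> (\<Sum>a<N. (norm (coord (?t a) v))\<^sup>2) * real m"
      using N[OF that] by (intro mult_right_mono sum_mono2) auto
    finally show ?thesis by (simp add: power_mult_distrib mult.commute)
  qed
  have "(real m)\<^sup>2 * (\<Sum>v\<in>A. (norm (coord (fejer m y) v))\<^sup>2)
      \<le> (\<Sum>v\<in>A. real m * (\<Sum>a<N. (norm (coord (?t a) v))\<^sup>2))"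
    unfolding sum_distrib_left by (rule sum_mono) (use v in \<open>simp add: sum_distrib_left\<close>)
  also have "\<dots> = real m * (\<Sum>a<N. \<Sum>v\<in>A. (norm (coord (?t a) v))\<^sup>2)"
    by (simp add: sum_distrib_left[symmetric] sum.swap[of _ A])
  also have "\<dots> \<le> real m * (\<Sum>a<N. c\<^sup>2 * (norm (trunc (window m a) y))\<^sup>2)"
  proof (intro mult_left_mono sum_mono)
    fix a
    have "(\<Sum>v\<in>A. (norm (coord (?t a) v))\<^sup>2) \<le> (norm (?t a))\<^sup>2" by (rule norm_sq_sum_le[OF \<open>finite A\<close>])
    also have "\<dots> \<le> (c * norm (trunc (window m a) y))\<^sup>2" by (intro power_mono Z_bound) simp
    finally show "(\<Sum>v\<in>A. (norm (coord (?t a) v))\<^sup>2) \<le> c\<^sup>2 * (norm (trunc (window m a) y))\<^sup>2"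
      by (simp add: power_mult_distrib)
  qed simp
  also have "\<dots> \<le> real m * (c\<^sup>2 * (real m * (norm y)\<^sup>2))"
    unfolding sum_distrib_left[symmetric] by (intro mult_left_mono sum_norm_sq_window_le) simp_all
  finally have "(real m)\<^sup>2 * (\<Sum>v\<in>A. (norm (coord (fejer m y) v))\<^sup>2) \<le> (real m)\<^sup>2 * (c * norm y)\<^sup>2"
    by (simp add: power_mult_distrib power2_eq_square ac_simps)
  then show "(\<Sum>v\<in>A. (norm (coord (fejer m y) v))\<^sup>2) \<le> (c * norm y)\<^sup>2"
    using assms by simp
qed (simp add: c)

lemma fejer_diff: "fejer m (x - y) = fejer m x - fejer m y"
  by (simp add: fejer_def bop_diff[OF rann_bop closed_csubspace_UNIV]
      bop_diff[OF amplify_bop[OF coefficient_bop] closed_csubspace_UNIV]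
      scaleR_diff_right sum_subtractf)

lemma fejer_add: "fejer m (x + y) = fejer m x + fejer m y"
  by (simp add: fejer_def bopD[OF rann_bop] bopD[OF amplify_bop[OF coefficient_bop]]
      scaleR_add_right sum.distrib)

lemma fejer_scaleC: "fejer m (a *\<^sub>C x) = a *\<^sub>C fejer m x"
  by (simp add: fejer_def bopD[OF rann_bop] bopD[OF amplify_bop[OF coefficient_bop]]
      linear_sum[OF bounded_linear.linear[OF bounded_linear_scaleC]]
      linear_scale[OF bounded_linear.linear[OF bounded_linear_scaleC]])

text \<open>No suffix longer than \<open>u\<close> can be removed, so the sum stays finite and fixed
  while its weights tend to 1.\<close>

lemma fejer_tendsto_ket: "(\<lambda>m. fejer (Suc m) (tensor (ket u) k)) \<longlonglongrightarrow> Z (tensor (ket u) k)"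
proof -
  let ?x = "tensor (ket u) k" and ?L = "{w. length w < Suc (length u)}"
  let ?T = "\<lambda>w. amplify (coefficient w) (rann w ?x)"
  have coord_x: "coord ?x (v @ w) = (if v @ w = u then k else 0)" for v w
    by (simp add: tensor.rep_eq ket.rep_eq)
  have long: "?T w = 0" if "length u < length w" for w
  proof -
    have "rann w ?x = 0" using that by (intro rann_eq_0) (auto simp: coord_x)
    then show ?thesis by (simp add: bop_zero[OF amplify_bop[OF coefficient_bop] closed_csubspace_UNIV])
  qed
  have "fejer (Suc m) ?x = (\<Sum>w\<in>?L. (1 - length w / Suc m) *\<^sub>R ?T w)" if "length u \<le> m" for m
    unfolding fejer_def
    by (rule sum.mono_neutral_right) (use that long in \<open>auto simp: finite_words_less\<close>)
  then have ev: "\<forall>\<^sub>F m in sequentially. (\<Sum>w\<in>?L. (1 - length w / Suc m) *\<^sub>R ?T w) = fejer (Suc m) ?x"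
    unfolding eventually_sequentially by (intro exI[of _ "length u"]) simp
  have lim: "(\<lambda>m. \<Sum>w\<in>?L. (1 - length w / Suc m) *\<^sub>R ?T w) \<longlonglongrightarrow> (\<Sum>w\<in>?L. (1 - 0) *\<^sub>R ?T w)"
    by (intro tendsto_sum tendsto_scaleR tendsto_diff tendsto_const
        filterlim_compose[OF lim_const_over_n filterlim_Suc])
  have eq: "(\<Sum>w\<in>?L. (1 - 0) *\<^sub>R ?T w) = Z ?x"
  proof (rule ell2_eqI)
    fix v
    have "coord (\<Sum>w\<in>?L. (1 - 0) *\<^sub>R ?T w) v = (\<Sum>w\<in>?L. if v @ w = u then coefficient w k else 0)"
      by (auto simp: coord_sum coord_simps coord_amplify[OF coefficient_bop] rann.rep_eq coord_x intro!: sum.cong)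
    also have "\<dots> = coord (Z ?x) v"
    proof (cases "take (length v) u = v")
      case True
      then obtain w0 where u: "u = v @ w0" by (metis append_take_drop_id)
      have "(\<Sum>w\<in>?L. if v @ w = u then coefficient w k else 0)
          = (\<Sum>w\<in>?L. if w = w0 then coefficient w k else 0)"
        by (simp add: u)
      then show ?thesis by (simp add: coord_Z_ket u finite_words_less)
    next
      case False
      then have "v @ w \<noteq> u" for w by auto
      then show ?thesis using False by (simp add: coord_Z_ket)
    qed
    finally show "coord (\<Sum>w\<in>?L. (1 - 0) *\<^sub>R ?T w) v = coord (Z ?x) v" .
  qed
  show ?thesis by (rule Lim_transform_eventually[OF lim[unfolded eq] ev])
qed

text \<open>The uniform bound \<open>c\<close> makes the set of vectors with convergence
  closed.\<close>

lemma fejer_tendsto: "(\<lambda>m. fejer (Suc m) y) \<longlonglongrightarrow> Z y"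
proof -
  let ?E = "{y. (\<lambda>m. fejer (Suc m) y) \<longlonglongrightarrow> Z y}"
  have "y \<in> ?E" if y: "y \<in> closure ?E" for y
  proof (clarify, rule metric_LIMSEQ_I)
    fix \<epsilon> :: real assume "0 < \<epsilon>"
    \<comment> \<open>The denominator contains \<open>c + 1\<close> because \<open>c\<close> may be
      0.\<close>
    define \<delta> where "\<delta> = \<epsilon> / (3 * (c + 1))"
    have \<delta>: "0 < \<delta>" "c * \<delta> < \<epsilon> / 3" using \<open>0 < \<epsilon>\<close> c by (simp_all add: \<delta>_def field_simps)
    obtain x where x: "x \<in> ?E" "dist x y < \<delta>" using y \<open>0 < \<delta>\<close> unfolding closure_approachable by blast
    then obtain M where M: "\<And>m. m \<ge> M \<Longrightarrow> dist (fejer (Suc m) x) (Z x) < \<epsilon> / 3"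
      using metric_LIMSEQ_D[of "\<lambda>m. fejer (Suc m) x" "Z x" "\<epsilon> / 3"] \<open>0 < \<epsilon>\<close> by auto
    have "dist (fejer (Suc m) y) (Z y) < \<epsilon>" if "m \<ge> M" for m
    proof -
      have le: "c * norm (x - y) \<le> c * \<delta>" using x(2) c by (intro mult_left_mono) (auto simp: dist_norm)
      have "norm (fejer (Suc m) (x - y)) \<le> c * norm (x - y)" "norm (Z (x - y)) \<le> c * norm (x - y)"
        by (rule norm_fejer_le Z_bound; simp)+
      then have "dist (fejer (Suc m) x) (fejer (Suc m) y) < \<epsilon> / 3" "dist (Z x) (Z y) < \<epsilon> / 3"
        using le \<delta>(2) by (simp_all add: dist_norm fejer_diff bop_diff[OF Z closed_csubspace_UNIV])
      then show ?thesis
        using M[OF that] dist_triangle[of "fejer (Suc m) y" "Z y" "fejer (Suc m) x"]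
          dist_triangle[of "fejer (Suc m) x" "Z y" "Z x"]
        by (simp add: dist_commute)
    qed
    then show "\<exists>M. \<forall>m\<ge>M. dist (fejer (Suc m) y) (Z y) < \<epsilon>" by blast
  qed
  then have "closure ?E \<subseteq> ?E" by blast
  then have "closed ?E" by (simp only: closure_subset_eq)
  moreover have "fejer m 0 = 0" for m using fejer_diff[of m 0 0] by simp
  ultimately have "closed_csubspace ?E"
    unfolding closed_csubspace_def
    by (auto simp: fejer_add fejer_scaleC bopD[OF Z] intro!: tendsto_add tendsto_scaleC)
  then have "?E = UNIV" using fejer_tendsto_ket by (intro closed_csubspace_UNIV_if_ket_tensors) auto
  then show ?thesis by blast
qed

end


section \<open>The lifting theorem\<close>

text \<open>The first letter acts first, so that the word is appended in reading order and the
  adjoint removes the suffix \<open>w\<close>.\<close>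

primrec shift_W_word :: "('n fock \<Rightarrow> 'n fock) set \<Rightarrow> 'n list \<Rightarrow> 'n fock \<Rightarrow> 'n fock" where
  "shift_W_word J [] = id"
| "shift_W_word J (i # w) = shift_W_word J w \<circ> shift_W J i"

lemma shift_W_word_in_algebra_W: "shift_W_word J w \<in> algebra_W J"
  unfolding algebra_W_def hull_def
proof clarify
  fix A assume "unital_op_algebra (\<N> J) A" and A: "range (shift_W J) \<subseteq> A"
  then have "id \<in> A" "\<And>S T. S \<in> A \<Longrightarrow> T \<in> A \<Longrightarrow> S \<circ> T \<in> A" by (auto simp: unital_op_algebra_def)
  moreover have "shift_W J i \<in> A" for i using A by blast
  ultimately show "shift_W_word J w \<in> A" by (induction w) auto
qed

lemma op_space_sum:
  assumes V: "op_space E F V" and "finite A" "\<And>w. w \<in> A \<Longrightarrow> T w \<in> V"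
  shows "(\<lambda>x. \<Sum>w\<in>A. T w x) \<in> V"
  using assms(2,3)
proof (induction A)
  case empty
  then show ?case using V by (simp add: op_space_def)
next
  case (insert w A)
  then have "(\<lambda>x. T w x + (\<Sum>w\<in>A. T w x)) \<in> V" using V by (simp add: op_space_def)
  then show ?case using insert by simp
qed

context toeplitz_ideal
begin

lemma cinner_shift_W_word:
  "f \<in> \<N> J \<Longrightarrow> g \<in> \<N> J \<Longrightarrow> cinner (shift_W_word J w f) g = cinner f (rann w g)"
proof (induction w arbitrary: f)
  case Nil
  have "rann [] g = g" by (rule ell2_eqI) (simp add: rann.rep_eq)
  then show ?case by simp
next
  case (Cons i w)
  have "rann [i] (rann w g) = rann (i # w) g" by (rule ell2_eqI) (simp add: rann.rep_eq)
  then show ?case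
    using Cons by (simp add: bopD(1)[OF shift_W_bop] cinner_shift_W rann_N)
qed

text \<open>Identifies one term of the Fejer mean of \<open>Z\<close> as the adjoint of a generator
  of \<open>multipliers_W J\<close>.\<close>

lemma cinner_shift_W_word_tensor_op:
  fixes B :: "'k\<^sub>2::chilbert_space \<Rightarrow> 'k\<^sub>1::chilbert_space"
  assumes B: "B \<in> bop UNIV UNIV" and x: "x \<in> H" and y: "y \<in> H"
  shows "cinner (tensor_op (\<N> J) (shift_W_word J w) (adj UNIV B) x) y = cinner x (amplify B (rann w y))"
proof (rule cinner_eq_on_hull)
  let ?S = "{tensor f k |f k :: 'k\<^sub>1. f \<in> \<N> J}"
  let ?T = "tensor_op (\<N> J) (shift_W_word J w) (adj UNIV B)"
  note W = algebra_W_commutes(1)[OF shift_W_word_in_algebra_W]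
  note adj_B = adj_bop[OF closed_csubspace_UNIV B]
  show "?T \<in> bop (closed_csubspace hull ?S) H"
    using tensor_op_bop[OF N_closed W adj_B] by (simp add: tensor_space_def)
  show "x \<in> closed_csubspace hull ?S" using x by (simp add: tensor_space_def)
  fix z assume "z \<in> ?S"
  then obtain f k where "f \<in> \<N> J" "z = tensor f k" by blast
  then show "cinner (?T z) y = cinner z (amplify B (rann w y))"
    using y by (simp add: tensor_op_tensor[OF N_closed W adj_B] cinner_tensor_left cinner_shift_W_word
        in_H_iff slice_amplify[OF B] slice_rann)
qed

lemma multipliers_W_if_intertwiner:
  fixes Z :: "('n, 'k\<^sub>2::chilbert_space) vfock \<Rightarrow> ('n, 'k\<^sub>1::chilbert_space) vfock"
  assumes Z: "backward_shift_intertwiner Z c" and G: "G \<in> bop H H"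
    and eq: "\<And>x y. x \<in> H \<Longrightarrow> y \<in> H \<Longrightarrow> cinner (G x) y = cinner x (Z y)"
  shows "G \<in> multipliers_W J"
  unfolding multipliers_W_def hull_def
proof clarify
  interpret Z: backward_shift_intertwiner Z c by (rule Z)
  fix V :: "(('n, 'k\<^sub>1) vfock \<Rightarrow> ('n, 'k\<^sub>2) vfock) set"
  assume V: "op_space H H V" "closedin (wot H H) V"
    and gen: "{tensor_op (\<N> J) A T |A T. A \<in> algebra_W J \<and> T \<in> bop UNIV UNIV} \<subseteq> V"
  let ?W = "\<lambda>w. tensor_op (\<N> J) (shift_W_word J w) (adj UNIV (Z.coefficient w))"
  \<comment> \<open>The weak adjoint of \<open>Z.fejer (Suc m)\<close> on \<open>H\<close>; its
    weights are real, so conjugation leaves them unchanged.\<close>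
  define T where "T m x = (\<Sum>w | length w < Suc m. complex_of_real (1 - length w / Suc m) *\<^sub>C ?W w x)" for m x
  have "?W w \<in> V" for w
    using gen shift_W_word_in_algebra_W adj_bop[OF closed_csubspace_UNIV Z.coefficient_bop] by blast
  then have "T m \<in> V" for m
    unfolding T_def using V(1) by (intro op_space_sum[OF V(1)] finite_words_less) (simp add: op_space_def)
  moreover have "(\<lambda>m. cinner (T m x) y) \<longlonglongrightarrow> cinner (G x) y" if "x \<in> H" "y \<in> H" for x y
  proof -
    have "cinner (T m x) y = cinner x (Z.fejer (Suc m) y)" for m
      unfolding T_def Z.fejer_def cinner_sum_left cinner_sum_right cinner_scaleC_left cinner.scaleR_right
      by (intro sum.cong refl)
        (simp only: cinner_shift_W_word_tensor_op[OF Z.coefficient_bop that] scaleR_conv_of_real)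
    then show ?thesis
      unfolding eq[OF that] by (simp only:) (intro cinner.tendsto tendsto_const Z.fejer_tendsto)
  qed
  ultimately show "G \<in> V" by (rule limit_in_wot_closed[OF V(2) _ G])
qed

text \<open>For fixed \<open>k\<close> and \<open>l\<close> the map sending \<open>f\<close> to
  \<open>slice k (Z (tensor f l))\<close> is a scalar operator commuting with the backward shifts,
  so \<open>lann_commutant_N\<close> applies to it.\<close>

lemma intertwiner_maps_H:
  fixes Z :: "('n, 'k\<^sub>2::chilbert_space) vfock \<Rightarrow> ('n, 'k\<^sub>1::chilbert_space) vfock"
  assumes Z: "backward_shift_intertwiner Z c" and "y \<in> H"
  shows "Z y \<in> H"
proof -
  interpret Z: backward_shift_intertwiner Z c by (rule Z)
  interpret bounded_linear Z by (rule bop_UNIV_bounded_linear[OF Z.Z])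
  have "closed (Z -` H)"
    by (rule continuous_closed_vimage[OF closed_csubspaceD(4)[OF H_closed]]) (rule isCont, simp)
  then have "closed_csubspace (Z -` H)"
    by (simp add: closed_csubspace_def bopD[OF Z.Z] closed_csubspaceD[OF H_closed])
  moreover have "tensor f l \<in> Z -` H" if f: "f \<in> \<N> J" for f l
  proof -
    have "slice k (Z (tensor f l)) \<in> \<N> J" for k
    proof (rule lann_commutant_N[of "\<lambda>f. slice k (Z (tensor f l))", OF _ _ f])
      show "(\<lambda>f. slice k (Z (tensor f l))) \<in> bop UNIV UNIV"
      proof (rule linear_bopI)
        fix f :: "'n fock"
        have "norm (slice k (Z (tensor f l))) \<le> norm k * norm (Z (tensor f l))" by (rule norm_slice_le)
        also have "\<dots> \<le> norm k * (c * (norm f * norm l))"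
          using Z.Z_bound[of "tensor f l"] by (intro mult_left_mono) (simp_all add: norm_tensor)
        finally show "norm (slice k (Z (tensor f l))) \<le> (norm k * c * norm l) * norm f" by (simp add: ac_simps)
      qed (simp_all add: tensor_add_left tensor_scaleC_left bopD[OF Z.Z] bopD[OF slice_bop])
    qed (simp add: lann_tensor[symmetric] Z.Z_lann slice_lann)
    then show ?thesis by (simp add: in_H_iff)
  qed
  then have "{tensor f l |f l. f \<in> \<N> J} \<subseteq> Z -` H" by blast
  ultimately have "closed_csubspace hull {tensor f l |f l. f \<in> \<N> J} \<subseteq> Z -` H" by (intro hull_minimal)
  then show ?thesis using \<open>y \<in> H\<close> by (auto simp: tensor_space_def)
qed

lemma coinvariant_lann:
  assumes "E \<subseteq> H" "\<forall>i. coinvariant H (shift_BI J i) E" "y \<in> E"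
  shows "lann i y \<in> E"
  using assms adj_shift_BI[of y i] unfolding coinvariant_def by (metis subsetD)

text \<open>Tested against vectors of the subspaces, the projections in the compressions drop out.
  Co-invariance of \<open>E\<^sub>1\<close> puts \<open>lann i (adj E\<^sub>1 X y)\<close> back into
  \<open>E\<^sub>1\<close>, so these tests determine it.\<close>

lemma intertwines_iff:
  fixes E\<^sub>1 :: "('n, 'k\<^sub>1::chilbert_space) vfock set" and E\<^sub>2 :: "('n, 'k\<^sub>2::chilbert_space) vfock set"
  assumes E\<^sub>1: "closed_csubspace E\<^sub>1" "E\<^sub>1 \<subseteq> H" "\<forall>i. coinvariant H (shift_BI J i) E\<^sub>1"
    and E\<^sub>2: "closed_csubspace E\<^sub>2" "E\<^sub>2 \<subseteq> H" "\<forall>i. coinvariant H (shift_BI J i) E\<^sub>2"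
    and X: "X \<in> bop E\<^sub>1 E\<^sub>2"
  shows "intertwines J E\<^sub>1 E\<^sub>2 X \<longleftrightarrow> (\<forall>i. \<forall>y\<in>E\<^sub>2. adj E\<^sub>1 X (lann i y) = lann i (adj E\<^sub>1 X y))"
proof -
  note adj = adj_in[OF E\<^sub>1(1) X] cinner_adj[OF E\<^sub>1(1) X]
  have left: "cinner (X (proj E\<^sub>1 (shift_BI J i x))) y = cinner x (lann i (adj E\<^sub>1 X y))"
    if "x \<in> E\<^sub>1" for i x y
    using that adj E\<^sub>1(2) by (auto simp: proj_in[OF E\<^sub>1(1)] cinner_proj[OF E\<^sub>1(1)] cinner_shift_BI subset_iff)
  have right: "cinner (proj E\<^sub>2 (shift_BI J i (X x))) y = cinner x (adj E\<^sub>1 X (lann i y))"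
    if "x \<in> E\<^sub>1" "y \<in> E\<^sub>2" for i x y
  proof -
    have "X x \<in> H" "y \<in> H" using that bopD(1)[OF X] E\<^sub>2(2) by auto
    then show ?thesis using that by (simp add: cinner_proj[OF E\<^sub>2(1)] cinner_shift_BI adj)
  qed
  show ?thesis
  proof
    assume inter: "intertwines J E\<^sub>1 E\<^sub>2 X"
    show "\<forall>i. \<forall>y\<in>E\<^sub>2. adj E\<^sub>1 X (lann i y) = lann i (adj E\<^sub>1 X y)"
    proof (intro allI ballI eq_if_cinner_eq[OF E\<^sub>1(1)])
      fix i y x assume "y \<in> E\<^sub>2" "x \<in> E\<^sub>1"
      then show "cinner x (adj E\<^sub>1 X (lann i y)) = cinner x (lann i (adj E\<^sub>1 X y))"
        using left[of x i y] right[of x y i] inter by (simp add: intertwines_def)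
    qed (auto intro: adj coinvariant_lann[OF E\<^sub>1(2,3)])
  next
    assume comm: "\<forall>i. \<forall>y\<in>E\<^sub>2. adj E\<^sub>1 X (lann i y) = lann i (adj E\<^sub>1 X y)"
    show "intertwines J E\<^sub>1 E\<^sub>2 X"
      unfolding intertwines_def
    proof (intro allI ballI eq_if_cinner_eq[OF E\<^sub>2(1)])
      fix i x y assume "x \<in> E\<^sub>1" "y \<in> E\<^sub>2"
      then have "cinner (X (proj E\<^sub>1 (shift_BI J i x))) y = cinner (proj E\<^sub>2 (shift_BI J i (X x))) y"
        using left[of x i y] right[of x y i] comm by simp
      then show "cinner y (X (proj E\<^sub>1 (shift_BI J i x))) = cinner y (proj E\<^sub>2 (shift_BI J i (X x)))"
        by (metis cinner_commute)
    qed (auto intro: bopD(1)[OF X] proj_in E\<^sub>1 E\<^sub>2)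
  qed
qed

lemma commutant_lifting:
  fixes E\<^sub>1 :: "('n, 'k\<^sub>1::chilbert_space) vfock set" and E\<^sub>2 :: "('n, 'k\<^sub>2::chilbert_space) vfock set"
  assumes E\<^sub>1: "closed_csubspace E\<^sub>1" "E\<^sub>1 \<subseteq> H" "\<forall>i. coinvariant H (shift_BI J i) E\<^sub>1"
    and E\<^sub>2: "closed_csubspace E\<^sub>2" "E\<^sub>2 \<subseteq> H" "\<forall>i. coinvariant H (shift_BI J i) E\<^sub>2"
    and X: "X \<in> bop E\<^sub>1 E\<^sub>2" and inter: "intertwines J E\<^sub>1 E\<^sub>2 X"
  shows "\<exists>G\<in>multipliers_W J. lifts J E\<^sub>1 E\<^sub>2 X G"
proof -
  let ?X' = "adj E\<^sub>1 X" and ?c = "onorm_on E\<^sub>1 X"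
  note X' = adj_bop[OF E\<^sub>1(1) X]
  have c: "0 \<le> ?c" by (rule onorm_on_nonneg[OF X E\<^sub>1(1)])
  obtain Z where Z: "Z \<in> bop UNIV UNIV" "\<And>y. norm (Z y) \<le> ?c * norm y"
    "\<And>i y. Z (lann i y) = lann i (Z y)" and ZX: "\<And>y. y \<in> E\<^sub>2 \<Longrightarrow> Z y = ?X' y"
  proof (rule backward_shift_lifting[OF E\<^sub>2(1) X' c])
    show "norm (?X' y) \<le> ?c * norm y" for y
      by (rule norm_adj_le[OF E\<^sub>1(1) X c onorm_on_bound[OF X]])
    show "lann i y \<in> E\<^sub>2" if "y \<in> E\<^sub>2" for i y by (rule coinvariant_lann[OF E\<^sub>2(2,3) that])
    show "?X' (lann i y) = lann i (?X' y)" if "y \<in> E\<^sub>2" for i y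
      using inter that intertwines_iff[OF E\<^sub>1 E\<^sub>2 X] by blast
  qed blast
  have inter_Z: "backward_shift_intertwiner Z ?c"
    by unfold_locales (rule Z c)+
  have ZH: "Z \<in> bop H H"
    by (rule bop_subset[OF Z(1)]) (auto intro: intertwiner_maps_H[OF inter_Z])
  \<comment> \<open>\<open>Z\<close> extends the adjoint of \<open>X\<close>, so the operator sought
    is the adjoint of \<open>Z\<close> restricted to \<open>H\<close>.\<close>
  define G where "G = adj H Z"
  have G: "G \<in> bop H H" unfolding G_def by (rule adj_bop[OF H_closed ZH])
  have GZ: "cinner (G x) y = cinner x (Z y)" if "y \<in> H" for x y
    unfolding G_def using cinner_adj[OF H_closed ZH that, of x] by (metis cinner_commute)
  have adj_G: "adj H G y = Z y" if "y \<in> H" for y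
    by (rule adj_eqI[OF H_closed]) (simp_all add: GZ that bopD(1)[OF ZH])
  have "G \<in> multipliers_W J" by (rule multipliers_W_if_intertwiner[OF inter_Z G GZ])
  moreover have "lifts J E\<^sub>1 E\<^sub>2 X G"
    unfolding lifts_def
  proof (intro conjI ballI)
    show eq: "adj H G y = ?X' y" if "y \<in> E\<^sub>2" for y using that E\<^sub>2(2) by (auto simp: adj_G ZX)
    then show "adj H G ` E\<^sub>2 \<subseteq> E\<^sub>1" by (auto simp: adj_in[OF E\<^sub>1(1) X])
    show "onorm_on H G = ?c"
    proof (rule antisym)
      show "onorm_on H G \<le> ?c"
      proof (rule onorm_on_le[OF _ c])
        show "H \<noteq> {}" using closed_csubspaceD(1)[OF H_closed] by blast
        show "norm (G x) \<le> ?c * norm x" for x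
          unfolding G_def by (rule norm_adj_le[OF H_closed ZH c Z(2)])
      qed
      \<comment> \<open>\<open>X\<close> is the adjoint of its adjoint, which is a restriction of
        the adjoint of \<open>G\<close> and hence bounded by the norm of \<open>G\<close>.\<close>
      have "norm (X x) \<le> onorm_on H G * norm x" if "x \<in> E\<^sub>1" for x
      proof -
        have "adj E\<^sub>2 ?X' x = X x"
        proof (rule adj_eqI[OF E\<^sub>2(1) bopD(1)[OF X that]])
          show "cinner (?X' y) x = cinner y (X x)" for y
            using cinner_adj[OF E\<^sub>1(1) X that, of y] by (metis cinner_commute)
        qed
        moreover have "norm (adj E\<^sub>2 ?X' x) \<le> onorm_on H G * norm x"
        proof (rule norm_adj_le[OF E\<^sub>2(1) X' onorm_on_nonneg[OF G H_closed]])
          show "norm (?X' y) \<le> onorm_on H G * norm y" if "y \<in> E\<^sub>2" for y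
            using norm_adj_le[OF H_closed G onorm_on_nonneg[OF G H_closed] onorm_on_bound[OF G]] eq[OF that]
            by metis
        qed
        ultimately show ?thesis by simp
      qed
      then show "?c \<le> onorm_on H G"
        using closed_csubspaceD(1)[OF E\<^sub>1(1)] by (intro onorm_on_le onorm_on_nonneg[OF G H_closed]) auto
    qed
  qed
  ultimately show ?thesis by blast
qed

text \<open>The adjoint of \<open>G\<close> commutes with \<open>lann i\<close> on \<open>H\<close>,
  agrees with that of \<open>X\<close> on \<open>E\<^sub>2\<close>, and \<open>lann i\<close> does
  not leave \<open>E\<^sub>2\<close>.\<close>

lemma intertwines_if_lifts:
  fixes E\<^sub>1 :: "('n, 'k\<^sub>1::chilbert_space) vfock set" and E\<^sub>2 :: "('n, 'k\<^sub>2::chilbert_space) vfock set"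
  assumes E\<^sub>1: "closed_csubspace E\<^sub>1" "E\<^sub>1 \<subseteq> H" "\<forall>i. coinvariant H (shift_BI J i) E\<^sub>1"
    and E\<^sub>2: "closed_csubspace E\<^sub>2" "E\<^sub>2 \<subseteq> H" "\<forall>i. coinvariant H (shift_BI J i) E\<^sub>2"
    and X: "X \<in> bop E\<^sub>1 E\<^sub>2" and G: "G \<in> multipliers_W J" and lifts: "lifts J E\<^sub>1 E\<^sub>2 X G"
  shows "intertwines J E\<^sub>1 E\<^sub>2 X"
  unfolding intertwines_iff[OF E\<^sub>1 E\<^sub>2 X]
proof (intro allI ballI)
  note GH = multipliers_W_commute(1)[OF G] and comm = multipliers_W_commute(2)[OF G]
  note adj = adj_in[OF H_closed GH] cinner_adj[OF H_closed GH]
  fix i y assume y: "y \<in> E\<^sub>2"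
  then have "y \<in> H" using E\<^sub>2(2) by blast
  have "adj H G (lann i y) = lann i (adj H G y)"
  proof (rule eq_if_cinner_eq[OF H_closed])
    fix x :: "('n, 'k\<^sub>1) vfock" assume x: "x \<in> H"
    have "cinner x (adj H G (lann i y)) = cinner (G (shift_BI J i x)) y"
      using adj(2)[OF x, of "lann i y"] comm[OF x \<open>y \<in> H\<close>, of i] by simp
    also have "\<dots> = cinner x (lann i (adj H G y))"
      using adj bopD(1)[OF shift_BI_bop x] by (simp add: cinner_shift_BI x)
    finally show "cinner x (adj H G (lann i y)) = cinner x (lann i (adj H G y))" .
  qed (simp_all add: adj lann_H)
  then show "adj E\<^sub>1 X (lann i y) = lann i (adj E\<^sub>1 X y)"
    using lifts y coinvariant_lann[OF E\<^sub>2(2,3) y, of i] by (simp add: lifts_def)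
qed

text \<open>Both claims are checked on slices, where \<open>lann i\<close> is the adjoint of
  \<open>shift_B J i\<close>.\<close>

lemma
  assumes \<G>: "closed_csubspace \<G>" "\<G> \<subseteq> \<N> J" "\<forall>i. coinvariant (\<N> J) (shift_B J i) \<G>"
  shows tensor_space_subset_H: "(tensor_space \<G> :: ('n, 'k::chilbert_space) vfock set) \<subseteq> H"
    and tensor_space_coinvariant:
      "coinvariant H (shift_BI J i) (tensor_space \<G> :: ('n, 'k) vfock set)"
proof -
  show sub: "(tensor_space \<G> :: ('n, 'k) vfock set) \<subseteq> H"
    using \<G>(2) unfolding subset_iff slice_in_iff[OF \<G>(1)] in_H_iff by blast
  have "lann i f \<in> \<G>" if "f \<in> \<G>" for f
  proof -
    have "f \<in> \<N> J" using that \<G>(2) by blast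
    then have "adj (\<N> J) (shift_B J i) f = lann i f"
      by (intro adj_eqI[OF N_closed]) (simp_all add: lann_N cinner_shift_B)
    then show ?thesis using \<G>(3) that unfolding coinvariant_def by metis
  qed
  then show "coinvariant H (shift_BI J i) (tensor_space \<G> :: ('n, 'k) vfock set)"
    using sub by (auto simp: coinvariant_def adj_shift_BI slice_in_iff[OF \<G>(1)] slice_lann subset_iff)
qed

end

theorem theorem5p1:
  fixes J :: "('n::finite fock \<Rightarrow> 'n fock) set"
  assumes "wot_closed_ideal J" and "J \<noteq> toeplitz_algebra"
  shows
    "(\<forall>(E\<^sub>1 :: ('n, 'k\<^sub>1::chilbert_space) vfock set) (E\<^sub>2 :: ('n, 'k\<^sub>2::chilbert_space) vfock set) X.
        closed_csubspace E\<^sub>1 \<and> E\<^sub>1 \<subseteq> tensor_space (\<N> J) \<and>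
        (\<forall>i. coinvariant (tensor_space (\<N> J)) (shift_BI J i) E\<^sub>1) \<and>
        closed_csubspace E\<^sub>2 \<and> E\<^sub>2 \<subseteq> tensor_space (\<N> J) \<and>
        (\<forall>i. coinvariant (tensor_space (\<N> J)) (shift_BI J i) E\<^sub>2) \<and>
        X \<in> bop E\<^sub>1 E\<^sub>2 \<and> intertwines J E\<^sub>1 E\<^sub>2 X \<longrightarrow>
        (\<exists>G\<in>multipliers_W J. lifts J E\<^sub>1 E\<^sub>2 X G))
     \<and>
     (\<forall>(\<G> :: 'n fock set) (E\<^sub>1 :: ('n, 'k\<^sub>1) vfock set) (E\<^sub>2 :: ('n, 'k\<^sub>2) vfock set) X.
        closed_csubspace \<G> \<and> \<G> \<subseteq> \<N> J \<and>
        (\<forall>i. coinvariant (\<N> J) (shift_B J i) \<G> \<and> coinvariant (\<N> J) (shift_W J i) \<G>) \<and>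
        E\<^sub>1 = tensor_space \<G> \<and> E\<^sub>2 = tensor_space \<G> \<and> X \<in> bop E\<^sub>1 E\<^sub>2 \<longrightarrow>
        (intertwines J E\<^sub>1 E\<^sub>2 X \<longleftrightarrow> (\<exists>G\<in>multipliers_W J. lifts J E\<^sub>1 E\<^sub>2 X G)))"
proof -
  interpret toeplitz_ideal J by unfold_locales (rule assms(1))
  show ?thesis
  proof (intro conjI allI impI, goal_cases)
    case (1 E\<^sub>1 E\<^sub>2 X)
    then show ?case by (intro commutant_lifting) auto
  next
    case (2 \<G> E\<^sub>1 E\<^sub>2 X)
    then have \<G>: "closed_csubspace \<G>" "\<G> \<subseteq> \<N> J" "\<forall>i. coinvariant (\<N> J) (shift_B J i) \<G>"
      and E: "E\<^sub>1 = tensor_space \<G>" "E\<^sub>2 = tensor_space \<G>" and X: "X \<in> bop E\<^sub>1 E\<^sub>2" by auto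
    have E\<^sub>1: "closed_csubspace E\<^sub>1" "E\<^sub>1 \<subseteq> H" "\<forall>i. coinvariant H (shift_BI J i) E\<^sub>1"
      and E\<^sub>2: "closed_csubspace E\<^sub>2" "E\<^sub>2 \<subseteq> H" "\<forall>i. coinvariant H (shift_BI J i) E\<^sub>2"
      unfolding E
      by (intro allI closed_csubspace_tensor_space tensor_space_subset_H[OF \<G>]
          tensor_space_coinvariant[OF \<G>])+
    show ?case
      using commutant_lifting[OF E\<^sub>1 E\<^sub>2 X] intertwines_if_lifts[OF E\<^sub>1 E\<^sub>2 X] by blast
  qed
qed

end
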